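(* Let $A$ and $H$ be two Hopf algebras over $k$. Then the relation $\approx$ is an equivalence relation on the set of objects of the category $\mathcal{MP}(A, H)$, and there exists a one-to-one correspondence between the set of objects of the skeleton of the category $\mathcal{MP}(A, H)$ and the pointed quotient set $\mathcal{H}^{2}(A, H) := \mathcal{MP}(A, H)/\approx$. Here $(\triangleright, \triangleleft) \approx (\triangleright', \triangleleft')$ (the two objects are cohomologous) means that there exists a pair of maps $(r, v)$ such that: (1) $r: H \to A$ is a unitary cocentral map and $v: H \to H$ is a unitary isomorphism of coalgebras satisfying, for all $g, h \in H$, $$r(hg) = r(h_{(1)}) \, \bigl(v(h_{(2)}) \triangleright' r(g)\bigr), \qquad v(hg) = \bigl(v(h) \triangleleft' r(g_{(1)})\bigr) \, v(g_{(2)});$$ (2) for all $a \in A$, $h \in H$, $$h \triangleleft a = v^{-1} \bigl(v(h) \triangleleft' a \bigr), \qquad h \triangleright a = r(h_{(1)}) \, \bigl(v(h_{(2)}) \triangleright' a_{(1)} \bigr) \, \bigl(S_A \circ r \circ v^{-1}\bigr) \bigl( v(h_{(3)}) \triangleleft' a_{(2)}\bigr).$$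
   Context: $k$ is a field; all algebras, coalgebras, Hopf algebras, tensor products and homomorphisms are over $k$. Sweedler notation is used; $S_A$ is the antipode of $A$. A map $f$ between Hopf algebras is unitary if $f(1)=1$. A coalgebra map $r: H \to A$ is cocentral if $r(h_{(1)}) \otimes h_{(2)} = r(h_{(2)}) \otimes h_{(1)}$ for all $h \in H$. A matched pair of Hopf algebras is a system $(A, H, \triangleleft, \triangleright)$ (also written $(A,H,\triangleright,\triangleleft)$) where $\triangleleft : H \otimes A \to H$, $\triangleright: H \otimes A \to A$ are coalgebra maps such that $(A, \triangleright)$ is a left $H$-module, $(H, \triangleleft)$ is a right $A$-module, and for all $a, b \in A$, $g, h \in H$: $h \triangleright 1_A = \varepsilon_H(h) 1_A$, $1_H \triangleleft a = \varepsilon_A(a) 1_H$; $g \triangleright (ab) = (g_{(1)} \triangleright a_{(1)}) \bigl( (g_{(2)} \triangleleft a_{(2)}) \triangleright b \bigr)$; $(gh) \triangleleft a = \bigl( g \triangleleft (h_{(1)} \triangleright a_{(1)}) \bigr)(h_{(2)} \triangleleft a_{(2)})$; $g_{(1)} \triangleleft a_{(1)} \otimes g_{(2)} \triangleright a_{(2)} = g_{(2)} \triangleleft a_{(2)} \otimes g_{(1)} \triangleright a_{(1)}$. The bicrossed product $A \bowtie H$ is $A \otimes H$ (with $a \bowtie h := a \otimes h$) with unit $1_A \bowtie 1_H$, multiplication $(a \bowtie h)(c \bowtie g) = a (h_{(1)} \triangleright c_{(1)}) \bowtie (h_{(2)} \triangleleft c_{(2)}) g$ and the tensor product coalgebra structure;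 it is a Hopf algebra. A Hopf algebra morphism $\psi : A \bowtie H \to A \bowtie' H$ stabilizes $A$ if $\psi(a \bowtie 1_H) = a \bowtie' 1_H$ for all $a \in A$ (equivalently, $\psi$ is left $A$-linear). The category $\mathcal{MP}(A, H)$: its objects are all pairs $(\triangleleft, \triangleright)$ (also written $(\triangleright, \triangleleft)$) such that $(A, H, \triangleright, \triangleleft)$ is a matched pair of Hopf algebras; a morphism $(\triangleleft, \triangleright) \to (\triangleleft', \triangleright')$ is a Hopf algebra map $A \bowtie H \to A \bowtie' H$ between the associated bicrossed products that stabilizes $A$. The objects of its skeleton are the isomorphism classes of objects. The distinguished point of $\mathcal{H}^2(A,H)$ is the class of the trivial object, in which $h \triangleleft a = \varepsilon_A(a) h$ and $h \triangleright a = \varepsilon_H(h) a$. *)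

theory Defs
  imports Complex_Main "HOL-Library.FuncSet" "HOL-Library.Function_Algebras"
begin

text \<open>
  A vector space over the field \<open>'k\<close> is a subspace \<open>vecs V\<close> of an ambient type carrying the
  library's \<open>vector_space\<close> structure. Carriers are needed because the tensor product, which depends
  on the scalar multiplications, cannot itself be a type. Taking \<open>vecs V = UNIV\<close> covers every vector
  space.
\<close>

record ('k, 'v) kspace =
  vecs :: "'v set"
  scl :: "'k \<Rightarrow> 'v \<Rightarrow> 'v" (infixr \<open>\<star>\<index>\<close> 75)

definition kspace :: "('k::field, 'v::ab_group_add, 'z) kspace_scheme \<Rightarrow> bool" where
  "kspace V \<longleftrightarrow> vector_space (scl V) \<and> module.subspace (scl V) (vecs V)"

definition ground :: "('k::field, 'k) kspace" where
  "ground = \<lparr>vecs = UNIV, scl = (*)\<rparr>"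

text \<open>
  Linear maps are extensional (equal to \<open>undefined\<close> off their domain), so that equality of HOL functions
  is equality of maps.
\<close>

definition linear_map ::
  "('k::field, 'v::ab_group_add, 'y) kspace_scheme \<Rightarrow> ('k, 'w::ab_group_add, 'z) kspace_scheme
    \<Rightarrow> ('v \<Rightarrow> 'w) \<Rightarrow> bool" where
  "linear_map V W f \<longleftrightarrow> f \<in> vecs V \<rightarrow>\<^sub>E vecs W \<and>
     (\<forall>x\<in>vecs V. \<forall>y\<in>vecs V. f (x + y) = f x + f y) \<and>
     (\<forall>c. \<forall>x\<in>vecs V. f (c \<star>\<^bsub>V\<^esub> x) = c \<star>\<^bsub>W\<^esub> f x)"

definition bilinear_map ::
  "('k::field, 'v::ab_group_add, 'x) kspace_scheme \<Rightarrow> ('k, 'w::ab_group_add, 'y) kspace_scheme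
    \<Rightarrow> ('k, 'u::ab_group_add, 'z) kspace_scheme \<Rightarrow> ('v \<Rightarrow> 'w \<Rightarrow> 'u) \<Rightarrow> bool" where
  "bilinear_map V W U f \<longleftrightarrow>
     (\<forall>y\<in>vecs W. linear_map V U (\<lambda>x\<in>vecs V. f x y)) \<and>
     (\<forall>x\<in>vecs V. linear_map W U (\<lambda>y\<in>vecs W. f x y))"

text \<open>
  The tensor product of \<open>V\<close> and \<open>W\<close> is realised as the span of the evaluations
  \<open>\<beta> \<mapsto> \<beta>(x, y)\<close> inside the space of functions on bilinear forms. Since \<open>'k\<close> is a field this has the
  universal property of the tensor product, see \<open>tensor_universal\<close>.
\<close>

type_synonym ('v, 'w, 'k) tensor = "('v \<Rightarrow> 'w \<Rightarrow> 'k) \<Rightarrow> 'k"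

definition tens ::
  "'v \<Rightarrow> ('k::field, 'v::ab_group_add, 'y) kspace_scheme \<Rightarrow> ('k, 'w::ab_group_add, 'z) kspace_scheme
    \<Rightarrow> 'w \<Rightarrow> ('v, 'w, 'k) tensor" (\<open>_ \<otimes>\<^bsub>_,_\<^esub> _\<close> [71, 0, 0, 71] 70) where
  "x \<otimes>\<^bsub>V,W\<^esub> y = (\<lambda>\<beta>. if bilinear_map V W ground \<beta> then \<beta> x y else 0)"

definition tensor_space ::
  "('k::field, 'v::ab_group_add, 'y) kspace_scheme \<Rightarrow> ('k, 'w::ab_group_add, 'z) kspace_scheme
    \<Rightarrow> ('k, ('v, 'w, 'k) tensor) kspace" (infixr \<open>\<Otimes>\<close> 70) where
  "V \<Otimes> W = \<lparr>vecs = module.span (\<lambda>c T \<beta>. c * T \<beta>) {x \<otimes>\<^bsub>V,W\<^esub> y | x y. x \<in> vecs V \<and> y \<in> vecs W},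
             scl = (\<lambda>c T \<beta>. c * T \<beta>)\<rparr>"

definition tlift ::
  "('k::field, 'v::ab_group_add, 'x) kspace_scheme \<Rightarrow> ('k, 'w::ab_group_add, 'y) kspace_scheme
    \<Rightarrow> ('k, 'u::ab_group_add, 'z) kspace_scheme \<Rightarrow> ('v \<Rightarrow> 'w \<Rightarrow> 'u) \<Rightarrow> ('v, 'w, 'k) tensor \<Rightarrow> 'u" where
  "tlift V W U f =
     (THE F. linear_map (V \<Otimes> W) U F \<and> (\<forall>x\<in>vecs V. \<forall>y\<in>vecs W. F (x \<otimes>\<^bsub>V,W\<^esub> y) = f x y))"

lemma tensor_vector_space: "vector_space (\<lambda>(c::'k::field) (T::'b \<Rightarrow> 'k) \<beta>. c * T \<beta>)"
  by unfold_locales (auto simp: fun_eq_iff algebra_simps)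

lemma kspace_tensor_space:
  fixes V :: "('k::field, 'v::ab_group_add, 'x) kspace_scheme"
    and W :: "('k, 'w::ab_group_add, 'y) kspace_scheme"
  shows "kspace (V \<Otimes> W)"
proof -
  interpret T: vector_space "\<lambda>(c::'k) (T::('v \<Rightarrow> 'w \<Rightarrow> 'k) \<Rightarrow> 'k) \<beta>. c * T \<beta>"
    by (rule tensor_vector_space)
  show ?thesis
    unfolding kspace_def tensor_space_def by (simp add: T.vector_space_axioms)
qed

lemma tens_mem:
  fixes V :: "('k::field, 'v::ab_group_add, 'x) kspace_scheme"
    and W :: "('k, 'w::ab_group_add, 'y) kspace_scheme"
  assumes "x \<in> vecs V" "y \<in> vecs W"
  shows "x \<otimes>\<^bsub>V,W\<^esub> y \<in> vecs (V \<Otimes> W)"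
proof -
  interpret T: vector_space "\<lambda>(c::'k) (T::('v \<Rightarrow> 'w \<Rightarrow> 'k) \<Rightarrow> 'k) \<beta>. c * T \<beta>"
    by (rule tensor_vector_space)
  show ?thesis
    using assms unfolding tensor_space_def by (auto intro!: T.span_base)
qed

lemma kspace_closed:
  assumes "kspace V"
  shows "x \<in> vecs V \<Longrightarrow> y \<in> vecs V \<Longrightarrow> x + y \<in> vecs V" "x \<in> vecs V \<Longrightarrow> c \<star>\<^bsub>V\<^esub> x \<in> vecs V"
    "0 \<in> vecs V"
proof -
  interpret vector_space "scl V" using assms by (simp add: kspace_def)
  have "subspace (vecs V)" using assms by (simp add: kspace_def)
  then show "x \<in> vecs V \<Longrightarrow> y \<in> vecs V \<Longrightarrow> x + y \<in> vecs V" "x \<in> vecs V \<Longrightarrow> c \<star>\<^bsub>V\<^esub> x \<in> vecs V"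
    "0 \<in> vecs V"
    by (auto intro: subspace_add subspace_scale subspace_0)
qed

lemma bilinear_mapD:
  assumes "bilinear_map V W U f" "kspace V" "kspace W"
  shows "x \<in> vecs V \<Longrightarrow> y \<in> vecs W \<Longrightarrow> f x y \<in> vecs U"
    "x \<in> vecs V \<Longrightarrow> x' \<in> vecs V \<Longrightarrow> y \<in> vecs W \<Longrightarrow> f (x + x') y = f x y + f x' y"
    "x \<in> vecs V \<Longrightarrow> y \<in> vecs W \<Longrightarrow> f (c \<star>\<^bsub>V\<^esub> x) y = c \<star>\<^bsub>U\<^esub> f x y"
    "x \<in> vecs V \<Longrightarrow> y \<in> vecs W \<Longrightarrow> y' \<in> vecs W \<Longrightarrow> f x (y + y') = f x y + f x y'"
    "x \<in> vecs V \<Longrightarrow> y \<in> vecs W \<Longrightarrow> f x (c \<star>\<^bsub>W\<^esub> y) = c \<star>\<^bsub>U\<^esub> f x y"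
proof -
  note closed = kspace_closed[OF assms(2)] kspace_closed[OF assms(3)]
  have 1: "linear_map V U (\<lambda>x\<in>vecs V. f x y)" if "y \<in> vecs W" for y
    using assms that by (auto simp: bilinear_map_def)
  have 2: "linear_map W U (\<lambda>y\<in>vecs W. f x y)" if "x \<in> vecs V" for x
    using assms that by (auto simp: bilinear_map_def)
  show "x \<in> vecs V \<Longrightarrow> y \<in> vecs W \<Longrightarrow> f x y \<in> vecs U"
    using 1[of y] by (auto simp: linear_map_def PiE_iff)
  show "x \<in> vecs V \<Longrightarrow> x' \<in> vecs V \<Longrightarrow> y \<in> vecs W \<Longrightarrow> f (x + x') y = f x y + f x' y"
    using 1[of y] closed by (auto simp: linear_map_def)
  show "x \<in> vecs V \<Longrightarrow> y \<in> vecs W \<Longrightarrow> f (c \<star>\<^bsub>V\<^esub> x) y = c \<star>\<^bsub>U\<^esub> f x y"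
    using 1[of y] closed by (auto simp: linear_map_def)
  show "x \<in> vecs V \<Longrightarrow> y \<in> vecs W \<Longrightarrow> y' \<in> vecs W \<Longrightarrow> f x (y + y') = f x y + f x y'"
    using 2[of x] closed by (auto simp: linear_map_def)
  show "x \<in> vecs V \<Longrightarrow> y \<in> vecs W \<Longrightarrow> f x (c \<star>\<^bsub>W\<^esub> y) = c \<star>\<^bsub>U\<^esub> f x y"
    using 2[of x] closed by (auto simp: linear_map_def)
qed

lemma bilinear_map_tens:
  assumes "kspace V" "kspace W"
  shows "bilinear_map V W (V \<Otimes> W) (\<lambda>x y. x \<otimes>\<^bsub>V,W\<^esub> y)"
proof -
  have s: "scl (V \<Otimes> W) = (\<lambda>c T \<beta>. c * T \<beta>)" by (simp add: tensor_space_def)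
  have g: "scl ground = (*)" by (simp add: ground_def)
  note closed = kspace_closed[OF assms(1)] kspace_closed[OF assms(2)]
  have "(x + x') \<otimes>\<^bsub>V,W\<^esub> y = x \<otimes>\<^bsub>V,W\<^esub> y + x' \<otimes>\<^bsub>V,W\<^esub> y"
    "(c \<star>\<^bsub>V\<^esub> x) \<otimes>\<^bsub>V,W\<^esub> y = c \<star>\<^bsub>V \<Otimes> W\<^esub> (x \<otimes>\<^bsub>V,W\<^esub> y)"
    if "x \<in> vecs V" "x' \<in> vecs V" "y \<in> vecs W" for x x' y c
    using that by (auto simp: tens_def s g fun_eq_iff bilinear_mapD[OF _ assms])
  moreover have "x \<otimes>\<^bsub>V,W\<^esub> (y + y') = x \<otimes>\<^bsub>V,W\<^esub> y + x \<otimes>\<^bsub>V,W\<^esub> y'"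
    "x \<otimes>\<^bsub>V,W\<^esub> (c \<star>\<^bsub>W\<^esub> y) = c \<star>\<^bsub>V \<Otimes> W\<^esub> (x \<otimes>\<^bsub>V,W\<^esub> y)"
    if "x \<in> vecs V" "y \<in> vecs W" "y' \<in> vecs W" for x y y' c
    using that by (auto simp: tens_def s g fun_eq_iff bilinear_mapD[OF _ assms])
  ultimately show ?thesis
    using closed by (auto simp: bilinear_map_def[of V W "V \<Otimes> W"] linear_map_def PiE_iff tens_mem)
qed

theorem tensor_universal:
  fixes V :: "('k::field, 'v::ab_group_add, 'x) kspace_scheme"
    and W :: "('k, 'w::ab_group_add, 'y) kspace_scheme"
    and U :: "('k, 'u::ab_group_add, 'z) kspace_scheme"
  assumes "kspace V" "kspace W" "kspace U" "bilinear_map V W U f"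
  shows "\<exists>!F. linear_map (V \<Otimes> W) U F \<and> (\<forall>x\<in>vecs V. \<forall>y\<in>vecs W. F (x \<otimes>\<^bsub>V,W\<^esub> y) = f x y)"
proof -
  interpret T: vector_space "\<lambda>(c::'k) (T::('v \<Rightarrow> 'w \<Rightarrow> 'k) \<Rightarrow> 'k) \<beta>. c * T \<beta>"
    by (rule tensor_vector_space)
  interpret U: vector_space "scl U" using assms by (simp add: kspace_def)
  interpret K: vector_space "(*) :: 'k \<Rightarrow> 'k \<Rightarrow> 'k"
    by unfold_locales (auto simp: algebra_simps)
  interpret UK: vector_space_pair "scl U" "(*) :: 'k \<Rightarrow> 'k \<Rightarrow> 'k" ..
  let ?G = "{x \<otimes>\<^bsub>V,W\<^esub> y | x y. x \<in> vecs V \<and> y \<in> vecs W}"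
  have vT: "vecs (V \<Otimes> W) = T.span ?G" and sT: "scl (V \<Otimes> W) = (\<lambda>c T \<beta>. c * T \<beta>)"
    by (simp_all add: tensor_space_def)
  define lin where "lin = (\<lambda>\<phi>. Vector_Spaces.linear (scl U) ((*) :: 'k \<Rightarrow> 'k \<Rightarrow> 'k) \<phi>)"
  have linD: "\<phi> (a + b) = \<phi> a + \<phi> b" "\<phi> (c \<star>\<^bsub>U\<^esub> a) = c * \<phi> a" "\<phi> 0 = 0" "\<phi> (a - b) = \<phi> a - \<phi> b"
    if "lin \<phi>" for \<phi> a b c
  proof -
    interpret P: Vector_Spaces.linear "scl U" "(*) :: 'k \<Rightarrow> 'k \<Rightarrow> 'k" \<phi>
      using that by (simp add: lin_def)
    show "\<phi> (a + b) = \<phi> a + \<phi> b" "\<phi> (c \<star>\<^bsub>U\<^esub> a) = c * \<phi> a" "\<phi> 0 = 0" "\<phi> (a - b) = \<phi> a - \<phi> b"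
      by (auto simp: P.add P.scale P.zero P.diff)
  qed
  have sep: "a = b" if "\<And>\<phi>. lin \<phi> \<Longrightarrow> \<phi> a = \<phi> b" for a b
  proof (rule ccontr)
    assume "a \<noteq> b"
    then have "U.independent {a - b}" by (simp add: U.dependent_single)
    from UK.linear_independent_extend[OF this, of "\<lambda>_. 1"]
    obtain \<phi> where "lin \<phi>" "\<phi> (a - b) = 1" by (auto simp: lin_def)
    then show False using that[of \<phi>] linD(4)[of \<phi> a b] by simp
  qed
  define R where "R = (\<lambda>T u. u \<in> vecs U \<and> (\<forall>\<phi>. lin \<phi> \<longrightarrow> \<phi> u = T (\<lambda>x y. \<phi> (f x y))))"
  have R_unique: "u = u'" if "R T u" "R T u'" for T u u'
    using that sep by (auto simp: R_def)
  have R_add: "R (T + T') (u + u')" if "R T u" "R T' u'" for T T' u u'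
    using that linD kspace_closed[OF assms(3)] by (auto simp: R_def)
  have R_scale: "R (\<lambda>\<beta>. c * T \<beta>) (c \<star>\<^bsub>U\<^esub> u)" if "R T u" for c T u
    using that linD kspace_closed[OF assms(3)] by (auto simp: R_def)
  have R_zero: "R 0 0"
    using linD kspace_closed[OF assms(3)] by (auto simp: R_def)
  have bil: "bilinear_map V W ground (\<lambda>x y. \<phi> (f x y))" if "lin \<phi>" for \<phi>
    using kspace_closed[OF assms(1)] kspace_closed[OF assms(2)] linD[OF that]
      bilinear_mapD[OF assms(4,1,2)]
    by (simp add: bilinear_map_def[of V W "\<lparr>vecs = UNIV, scl = (*)\<rparr>"] linear_map_def ground_def PiE_iff)
  have R_tens: "R (x \<otimes>\<^bsub>V,W\<^esub> y) (f x y)" if "x \<in> vecs V" "y \<in> vecs W" for x y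
    using that bil bilinear_mapD[OF assms(4,1,2)] by (auto simp: R_def tens_def)
  have R_ex: "\<exists>u. R T u" if "T \<in> T.span ?G" for T
    using that
  proof (induction T rule: T.span_induct_alt)
    case base
    then show ?case using R_zero by blast
  next
    case (step c T T')
    then obtain u u' where "R T u" "R T' u'" using R_tens by auto
    then show ?case using R_add R_scale by blast
  qed
  define F where "F = (\<lambda>T\<in>vecs (V \<Otimes> W). THE u. R T u)"
  have F: "R T (F T)" if "T \<in> vecs (V \<Otimes> W)" for T
    using theI'[of "R T"] R_ex[of T] R_unique[of T] that by (auto simp: F_def vT)
  have F_eq: "F T = u" if "T \<in> vecs (V \<Otimes> W)" "R T u" for T u
    using F[OF that(1)] that(2) R_unique by blast
  note closed = kspace_closed[OF kspace_tensor_space[of V W], unfolded sT]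
  show ?thesis
  proof (rule ex1I[of _ F])
    have "F (T + T') = F T + F T'" if "T \<in> vecs (V \<Otimes> W)" "T' \<in> vecs (V \<Otimes> W)" for T T'
      using that F closed R_add by (intro F_eq) auto
    moreover have "F (\<lambda>\<beta>. c * T \<beta>) = c \<star>\<^bsub>U\<^esub> F T" if "T \<in> vecs (V \<Otimes> W)" for c T
      using that F closed R_scale by (intro F_eq) auto
    moreover have "F \<in> vecs (V \<Otimes> W) \<rightarrow>\<^sub>E vecs U"
      using F by (auto simp: PiE_iff R_def F_def)
    moreover have "F (x \<otimes>\<^bsub>V,W\<^esub> y) = f x y" if "x \<in> vecs V" "y \<in> vecs W" for x y
      using that by (intro F_eq tens_mem R_tens)
    ultimately show "linear_map (V \<Otimes> W) U F \<and> (\<forall>x\<in>vecs V. \<forall>y\<in>vecs W. F (x \<otimes>\<^bsub>V,W\<^esub> y) = f x y)"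
      by (auto simp: linear_map_def sT)
  next
    fix F' assume F': "linear_map (V \<Otimes> W) U F' \<and> (\<forall>x\<in>vecs V. \<forall>y\<in>vecs W. F' (x \<otimes>\<^bsub>V,W\<^esub> y) = f x y)"
    have span_R: "T \<in> T.span ?G \<and> R T (F' T)" if "T \<in> T.span ?G" for T
      using that
    proof (induction T rule: T.span_induct_alt)
      case base
      have "F' 0 = F' (\<lambda>\<beta>. 0 * 0 \<beta>)" by (simp add: zero_fun_def)
      also have "\<dots> = 0 \<star>\<^bsub>U\<^esub> F' 0"
        using F' closed(3) by (simp only: linear_map_def sT)
      finally have "F' 0 = 0" by simp
      then show ?case using R_zero T.span_zero[of ?G] by (simp add: zero_fun_def[symmetric])
    next
      case (step c T T')
      then have mem: "T \<in> vecs (V \<Otimes> W)" "T' \<in> vecs (V \<Otimes> W)"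
        by (auto simp: vT intro: T.span_base)
      have "F' ((\<lambda>\<beta>. c * T \<beta>) + T') = c \<star>\<^bsub>U\<^esub> F' T + F' T'"
        using F' mem closed by (simp add: linear_map_def sT)
      moreover have "R T (F' T)" using step(1) F' R_tens by auto
      ultimately have "R ((\<lambda>\<beta>. c * T \<beta>) + T') (F' ((\<lambda>\<beta>. c * T \<beta>) + T'))"
        using step R_add R_scale by simp
      moreover have "(\<lambda>\<beta>. c * T \<beta>) + T' \<in> T.span ?G"
        using mem closed unfolding vT by blast
      ultimately show ?case by blast
    qed
    have "F' T = F T" if "T \<in> vecs (V \<Otimes> W)" for T
      using F_eq[OF that] span_R[of T] that by (simp add: vT)
    then show "F' = F"
      using F' by (intro extensionalityI[of _ "vecs (V \<Otimes> W)"])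
        (auto simp: linear_map_def F_def PiE_iff)
  qed
qed

record ('k, 'v) coalg = "('k, 'v) kspace" +
  comult :: "'v \<Rightarrow> ('v, 'v, 'k) tensor"
  counit :: "'v \<Rightarrow> 'k"

text \<open>
  Sweedler notation: \<open>sweedler C U c f\<close> is \<open>f(c\<^sub>1, c\<^sub>2)\<close> for \<open>f\<close> bilinear on \<open>C\<close> with values in \<open>U\<close>.
  Expressions in \<open>c\<^sub>1, c\<^sub>2, c\<^sub>3\<close> are written by splitting \<open>c\<^sub>2\<close> once more.
\<close>

definition sweedler ::
  "('k::field, 'v::ab_group_add, 'y) coalg_scheme \<Rightarrow> ('k, 'u::ab_group_add, 'z) kspace_scheme
    \<Rightarrow> 'v \<Rightarrow> ('v \<Rightarrow> 'v \<Rightarrow> 'u) \<Rightarrow> 'u" where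
  "sweedler C U c f = tlift C C U f (comult C c)"

definition coalgebra :: "('k::field, 'v::ab_group_add, 'z) coalg_scheme \<Rightarrow> bool" where
  "coalgebra C \<longleftrightarrow> kspace C \<and> linear_map C (C \<Otimes> C) (comult C) \<and> linear_map C ground (counit C) \<and>
     (\<forall>c\<in>vecs C.
        sweedler C (C \<Otimes> C \<Otimes> C) c (\<lambda>c1 c2. sweedler C (C \<Otimes> C \<Otimes> C) c1
          (\<lambda>c11 c12. c11 \<otimes>\<^bsub>C, C \<Otimes> C\<^esub> (c12 \<otimes>\<^bsub>C,C\<^esub> c2)))
        = sweedler C (C \<Otimes> C \<Otimes> C) c (\<lambda>c1 c2. c1 \<otimes>\<^bsub>C, C \<Otimes> C\<^esub> comult C c2) \<and>
        sweedler C C c (\<lambda>c1 c2. counit C c1 \<star>\<^bsub>C\<^esub> c2) = c \<and>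
        sweedler C C c (\<lambda>c1 c2. counit C c2 \<star>\<^bsub>C\<^esub> c1) = c)"

definition coalgebra_map ::
  "('k::field, 'v::ab_group_add, 'y) coalg_scheme \<Rightarrow> ('k, 'w::ab_group_add, 'z) coalg_scheme
    \<Rightarrow> ('v \<Rightarrow> 'w) \<Rightarrow> bool" where
  "coalgebra_map C D f \<longleftrightarrow> linear_map C D f \<and>
     (\<forall>c\<in>vecs C. comult D (f c) = sweedler C (D \<Otimes> D) c (\<lambda>c1 c2. f c1 \<otimes>\<^bsub>D,D\<^esub> f c2) \<and>
                 counit D (f c) = counit C c)"

definition coalgebra_iso ::
  "('k::field, 'v::ab_group_add, 'y) coalg_scheme \<Rightarrow> ('k, 'w::ab_group_add, 'z) coalg_scheme
    \<Rightarrow> ('v \<Rightarrow> 'w) \<Rightarrow> bool" where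
  "coalgebra_iso C D f \<longleftrightarrow> coalgebra_map C D f \<and>
     (\<exists>g. coalgebra_map D C g \<and> (\<forall>c\<in>vecs C. g (f c) = c) \<and> (\<forall>d\<in>vecs D. f (g d) = d))"

definition cocentral ::
  "('k::field, 'v::ab_group_add, 'y) coalg_scheme \<Rightarrow> ('k, 'w::ab_group_add, 'z) coalg_scheme
    \<Rightarrow> ('v \<Rightarrow> 'w) \<Rightarrow> bool" where
  "cocentral C D r \<longleftrightarrow> coalgebra_map C D r \<and>
     (\<forall>c\<in>vecs C. sweedler C (D \<Otimes> C) c (\<lambda>c1 c2. r c1 \<otimes>\<^bsub>D,C\<^esub> c2)
                = sweedler C (D \<Otimes> C) c (\<lambda>c1 c2. r c2 \<otimes>\<^bsub>D,C\<^esub> c1))"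

definition tensor_coalg ::
  "('k::field, 'v::ab_group_add, 'y) coalg_scheme \<Rightarrow> ('k, 'w::ab_group_add, 'z) coalg_scheme
    \<Rightarrow> ('k, ('v, 'w, 'k) tensor) coalg" (infixr \<open>\<Otimes>\<^sub>c\<close> 70) where
  "C \<Otimes>\<^sub>c D = \<lparr>vecs = vecs (C \<Otimes> D), scl = scl (C \<Otimes> D),
     comult = tlift C D ((C \<Otimes> D) \<Otimes> (C \<Otimes> D)) (\<lambda>c d.
       sweedler C ((C \<Otimes> D) \<Otimes> (C \<Otimes> D)) c (\<lambda>c1 c2.
       sweedler D ((C \<Otimes> D) \<Otimes> (C \<Otimes> D)) d (\<lambda>d1 d2.
         (c1 \<otimes>\<^bsub>C,D\<^esub> d1) \<otimes>\<^bsub>C \<Otimes> D, C \<Otimes> D\<^esub> (c2 \<otimes>\<^bsub>C,D\<^esub> d2)))),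
     counit = tlift C D ground (\<lambda>c d. counit C c * counit D d)\<rparr>"

record ('k, 'v) bialg = "('k, 'v) coalg" +
  mult :: "'v \<Rightarrow> 'v \<Rightarrow> 'v" (infixl \<open>\<odot>\<index>\<close> 72)
  unit :: 'v (\<open>\<one>\<index>\<close>)

definition algebra :: "('k::field, 'v::ab_group_add, 'z) bialg_scheme \<Rightarrow> bool" where
  "algebra A \<longleftrightarrow> kspace A \<and> bilinear_map A A A (mult A) \<and> \<one>\<^bsub>A\<^esub> \<in> vecs A \<and>
     (\<forall>x\<in>vecs A. \<forall>y\<in>vecs A. \<forall>z\<in>vecs A. (x \<odot>\<^bsub>A\<^esub> y) \<odot>\<^bsub>A\<^esub> z = x \<odot>\<^bsub>A\<^esub> (y \<odot>\<^bsub>A\<^esub> z)) \<and>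
     (\<forall>x\<in>vecs A. \<one>\<^bsub>A\<^esub> \<odot>\<^bsub>A\<^esub> x = x \<and> x \<odot>\<^bsub>A\<^esub> \<one>\<^bsub>A\<^esub> = x)"

definition bialgebra :: "('k::field, 'v::ab_group_add, 'z) bialg_scheme \<Rightarrow> bool" where
  "bialgebra A \<longleftrightarrow> algebra A \<and> coalgebra A \<and>
     (\<forall>x\<in>vecs A. \<forall>y\<in>vecs A.
        comult A (x \<odot>\<^bsub>A\<^esub> y) =
          sweedler A (A \<Otimes> A) x (\<lambda>x1 x2. sweedler A (A \<Otimes> A) y (\<lambda>y1 y2.
            (x1 \<odot>\<^bsub>A\<^esub> y1) \<otimes>\<^bsub>A,A\<^esub> (x2 \<odot>\<^bsub>A\<^esub> y2))) \<and>
        counit A (x \<odot>\<^bsub>A\<^esub> y) = counit A x * counit A y) \<and>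
     comult A \<one>\<^bsub>A\<^esub> = \<one>\<^bsub>A\<^esub> \<otimes>\<^bsub>A,A\<^esub> \<one>\<^bsub>A\<^esub> \<and> counit A \<one>\<^bsub>A\<^esub> = 1"

definition is_antipode :: "('k::field, 'v::ab_group_add, 'z) bialg_scheme \<Rightarrow> ('v \<Rightarrow> 'v) \<Rightarrow> bool" where
  "is_antipode A S \<longleftrightarrow> linear_map A A S \<and>
     (\<forall>x\<in>vecs A. sweedler A A x (\<lambda>x1 x2. S x1 \<odot>\<^bsub>A\<^esub> x2) = counit A x \<star>\<^bsub>A\<^esub> \<one>\<^bsub>A\<^esub> \<and>
                 sweedler A A x (\<lambda>x1 x2. x1 \<odot>\<^bsub>A\<^esub> S x2) = counit A x \<star>\<^bsub>A\<^esub> \<one>\<^bsub>A\<^esub>)"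

definition hopf_algebra :: "('k::field, 'v::ab_group_add, 'z) bialg_scheme \<Rightarrow> bool" where
  "hopf_algebra A \<longleftrightarrow> bialgebra A \<and> (\<exists>S. is_antipode A S)"

text \<open>The antipode is the convolution inverse of the identity, hence unique.\<close>

definition antipode :: "('k::field, 'v::ab_group_add, 'z) bialg_scheme \<Rightarrow> 'v \<Rightarrow> 'v" where
  "antipode A = (THE S. is_antipode A S)"

text \<open>As usual, a bialgebra map between Hopf algebras; it automatically commutes with the antipodes.\<close>

definition hopf_map ::
  "('k::field, 'v::ab_group_add, 'y) bialg_scheme \<Rightarrow> ('k, 'w::ab_group_add, 'z) bialg_scheme
    \<Rightarrow> ('v \<Rightarrow> 'w) \<Rightarrow> bool" where
  "hopf_map A B f \<longleftrightarrow> coalgebra_map A B f \<and> f \<one>\<^bsub>A\<^esub> = \<one>\<^bsub>B\<^esub> \<and>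
     (\<forall>x\<in>vecs A. \<forall>y\<in>vecs A. f (x \<odot>\<^bsub>A\<^esub> y) = f x \<odot>\<^bsub>B\<^esub> f y)"

text \<open>
  The locale makes no assumptions and only fixes notation. A pair \<open>X = (\<triangleleft>, \<triangleright>)\<close> consists of maps
  \<open>H \<Otimes> A \<rightarrow> H\<close> and \<open>H \<Otimes> A \<rightarrow> A\<close>, and the subscript in \<open>h \<triangleleft>\<^bsub>X\<^esub> a\<close>, \<open>h \<triangleright>\<^bsub>X\<^esub> a\<close> selects the pair.
\<close>

type_synonym ('k, 'a, 'h) actions = "(('h, 'a, 'k) tensor \<Rightarrow> 'h) \<times> (('h, 'a, 'k) tensor \<Rightarrow> 'a)"

locale hopf_pair =
  fixes A :: "('k::field, 'a::ab_group_add) bialg"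
    and H :: "('k, 'h::ab_group_add) bialg"
begin

abbreviation ract :: "'h \<Rightarrow> ('k, 'a, 'h) actions \<Rightarrow> 'a \<Rightarrow> 'h" (\<open>_ \<triangleleft>\<^bsub>_\<^esub> _\<close> [75, 0, 75] 74) where
  "h \<triangleleft>\<^bsub>X\<^esub> a \<equiv> fst X (h \<otimes>\<^bsub>H,A\<^esub> a)"

abbreviation lact :: "'h \<Rightarrow> ('k, 'a, 'h) actions \<Rightarrow> 'a \<Rightarrow> 'a" (\<open>_ \<triangleright>\<^bsub>_\<^esub> _\<close> [75, 0, 75] 74) where
  "h \<triangleright>\<^bsub>X\<^esub> a \<equiv> snd X (h \<otimes>\<^bsub>H,A\<^esub> a)"

definition matched_pair :: "('k, 'a, 'h) actions \<Rightarrow> bool" where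
  "matched_pair X \<longleftrightarrow>
     coalgebra_map (H \<Otimes>\<^sub>c A) H (fst X) \<and> coalgebra_map (H \<Otimes>\<^sub>c A) A (snd X) \<and>
     (\<forall>g\<in>vecs H. \<forall>h\<in>vecs H. \<forall>a\<in>vecs A.
        (g \<odot>\<^bsub>H\<^esub> h) \<triangleright>\<^bsub>X\<^esub> a = g \<triangleright>\<^bsub>X\<^esub> (h \<triangleright>\<^bsub>X\<^esub> a)) \<and>
     (\<forall>a\<in>vecs A. \<one>\<^bsub>H\<^esub> \<triangleright>\<^bsub>X\<^esub> a = a) \<and>
     (\<forall>h\<in>vecs H. \<forall>a\<in>vecs A. \<forall>b\<in>vecs A.
        h \<triangleleft>\<^bsub>X\<^esub> (a \<odot>\<^bsub>A\<^esub> b) = (h \<triangleleft>\<^bsub>X\<^esub> a) \<triangleleft>\<^bsub>X\<^esub> b) \<and>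
     (\<forall>h\<in>vecs H. h \<triangleleft>\<^bsub>X\<^esub> \<one>\<^bsub>A\<^esub> = h) \<and>
     (\<forall>h\<in>vecs H. h \<triangleright>\<^bsub>X\<^esub> \<one>\<^bsub>A\<^esub> = counit H h \<star>\<^bsub>A\<^esub> \<one>\<^bsub>A\<^esub>) \<and>
     (\<forall>a\<in>vecs A. \<one>\<^bsub>H\<^esub> \<triangleleft>\<^bsub>X\<^esub> a = counit A a \<star>\<^bsub>H\<^esub> \<one>\<^bsub>H\<^esub>) \<and>
     (\<forall>g\<in>vecs H. \<forall>a\<in>vecs A. \<forall>b\<in>vecs A.
        g \<triangleright>\<^bsub>X\<^esub> (a \<odot>\<^bsub>A\<^esub> b) =
          sweedler H A g (\<lambda>g1 g2. sweedler A A a (\<lambda>a1 a2.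
            (g1 \<triangleright>\<^bsub>X\<^esub> a1) \<odot>\<^bsub>A\<^esub> ((g2 \<triangleleft>\<^bsub>X\<^esub> a2) \<triangleright>\<^bsub>X\<^esub> b)))) \<and>
     (\<forall>g\<in>vecs H. \<forall>h\<in>vecs H. \<forall>a\<in>vecs A.
        (g \<odot>\<^bsub>H\<^esub> h) \<triangleleft>\<^bsub>X\<^esub> a =
          sweedler H H h (\<lambda>h1 h2. sweedler A H a (\<lambda>a1 a2.
            (g \<triangleleft>\<^bsub>X\<^esub> (h1 \<triangleright>\<^bsub>X\<^esub> a1)) \<odot>\<^bsub>H\<^esub> (h2 \<triangleleft>\<^bsub>X\<^esub> a2)))) \<and>
     (\<forall>g\<in>vecs H. \<forall>a\<in>vecs A.
        sweedler H (H \<Otimes> A) g (\<lambda>g1 g2. sweedler A (H \<Otimes> A) a (\<lambda>a1 a2.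
          (g1 \<triangleleft>\<^bsub>X\<^esub> a1) \<otimes>\<^bsub>H,A\<^esub> (g2 \<triangleright>\<^bsub>X\<^esub> a2)))
        = sweedler H (H \<Otimes> A) g (\<lambda>g1 g2. sweedler A (H \<Otimes> A) a (\<lambda>a1 a2.
          (g2 \<triangleleft>\<^bsub>X\<^esub> a2) \<otimes>\<^bsub>H,A\<^esub> (g1 \<triangleright>\<^bsub>X\<^esub> a1))))"

definition bicrossed :: "('k, 'a, 'h) actions \<Rightarrow> ('k, ('a, 'h, 'k) tensor) bialg" where
  "bicrossed X = \<lparr>vecs = vecs (A \<Otimes>\<^sub>c H), scl = scl (A \<Otimes>\<^sub>c H),
     comult = comult (A \<Otimes>\<^sub>c H), counit = counit (A \<Otimes>\<^sub>c H),
     mult = (\<lambda>x y.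
       tlift A H (A \<Otimes> H) (\<lambda>a h. tlift A H (A \<Otimes> H) (\<lambda>c g.
         sweedler H (A \<Otimes> H) h (\<lambda>h1 h2. sweedler A (A \<Otimes> H) c (\<lambda>c1 c2.
           (a \<odot>\<^bsub>A\<^esub> (h1 \<triangleright>\<^bsub>X\<^esub> c1)) \<otimes>\<^bsub>A,H\<^esub> ((h2 \<triangleleft>\<^bsub>X\<^esub> c2) \<odot>\<^bsub>H\<^esub> g)))) y) x),
     unit = \<one>\<^bsub>A\<^esub> \<otimes>\<^bsub>A,H\<^esub> \<one>\<^bsub>H\<^esub>\<rparr>"

definition MP :: "('k, 'a, 'h) actions set" where
  "MP = {X. matched_pair X}"

definition MP_hom ::
  "('k, 'a, 'h) actions \<Rightarrow> ('k, 'a, 'h) actions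
    \<Rightarrow> (('a, 'h, 'k) tensor \<Rightarrow> ('a, 'h, 'k) tensor) set" where
  "MP_hom X Y = {\<psi>. hopf_map (bicrossed X) (bicrossed Y) \<psi> \<and>
     (\<forall>a\<in>vecs A. \<psi> (a \<otimes>\<^bsub>A,H\<^esub> \<one>\<^bsub>H\<^esub>) = a \<otimes>\<^bsub>A,H\<^esub> \<one>\<^bsub>H\<^esub>)}"

definition MP_iso :: "('k, 'a, 'h) actions rel" where
  "MP_iso = {(X, Y). X \<in> MP \<and> Y \<in> MP \<and> (\<exists>\<psi>\<in>MP_hom X Y. \<exists>\<phi>\<in>MP_hom Y X.
     (\<forall>x\<in>vecs (bicrossed X). \<phi> (\<psi> x) = x) \<and> (\<forall>y\<in>vecs (bicrossed Y). \<psi> (\<phi> y) = y))}"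

definition skeleton_objects :: "('k, 'a, 'h) actions set set" where
  "skeleton_objects = MP // MP_iso"

definition cohomologous :: "('k, 'a, 'h) actions rel" where
  "cohomologous = {(X, Y). X \<in> MP \<and> Y \<in> MP \<and> (\<exists>r v.
     cocentral H A r \<and> r \<one>\<^bsub>H\<^esub> = \<one>\<^bsub>A\<^esub> \<and>
     coalgebra_iso H H v \<and> v \<one>\<^bsub>H\<^esub> = \<one>\<^bsub>H\<^esub> \<and>
     (\<forall>h\<in>vecs H. \<forall>g\<in>vecs H.
        r (h \<odot>\<^bsub>H\<^esub> g) = sweedler H A h (\<lambda>h1 h2. r h1 \<odot>\<^bsub>A\<^esub> (v h2 \<triangleright>\<^bsub>Y\<^esub> r g)) \<and>
        v (h \<odot>\<^bsub>H\<^esub> g) = sweedler H H g (\<lambda>g1 g2. (v h \<triangleleft>\<^bsub>Y\<^esub> r g1) \<odot>\<^bsub>H\<^esub> v g2)) \<and>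
     (let v_inv = inv_into (vecs H) v in
      \<forall>a\<in>vecs A. \<forall>h\<in>vecs H.
        h \<triangleleft>\<^bsub>X\<^esub> a = v_inv (v h \<triangleleft>\<^bsub>Y\<^esub> a) \<and>
        h \<triangleright>\<^bsub>X\<^esub> a =
          sweedler H A h (\<lambda>h1 h'. sweedler H A h' (\<lambda>h2 h3. sweedler A A a (\<lambda>a1 a2.
            r h1 \<odot>\<^bsub>A\<^esub> (v h2 \<triangleright>\<^bsub>Y\<^esub> a1) \<odot>\<^bsub>A\<^esub> antipode A (r (v_inv (v h3 \<triangleleft>\<^bsub>Y\<^esub> a2))))))))}"

definition H2 :: "('k, 'a, 'h) actions set set" where
  "H2 = MP // cohomologous"

definition trivial_object :: "('k, 'a, 'h) actions" where
  "trivial_object = (tlift H A H (\<lambda>h a. counit A a \<star>\<^bsub>H\<^esub> h), tlift H A A (\<lambda>h a. counit H h \<star>\<^bsub>A\<^esub> a))"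

definition H2_point :: "('k, 'a, 'h) actions set" where
  "H2_point = cohomologous `` {trivial_object}"

end

end

theory Submission
  imports Defs
begin

text \<open>
  A Hopf map \<open>\<psi> : A \<bowtie> H \<rightarrow> A \<bowtie>' H\<close> that stabilizes \<open>A\<close> is left \<open>A\<close>-linear, so it is determined by the
  coalgebra map \<open>h \<mapsto> \<psi>(1 \<bowtie> h)\<close>. Every element \<open>t\<close> of \<open>A \<otimes> H\<close> equals \<open>(id \<otimes> \<epsilon>)(t\<^sub>1) \<otimes> (\<epsilon> \<otimes> id)(t\<^sub>2)\<close>;
  hence, with \<open>r = (id \<otimes> \<epsilon>) \<circ> \<psi>\<close> and \<open>v = (\<epsilon> \<otimes> id) \<circ> \<psi>\<close> restricted to \<open>H\<close>,
  \<open>\<psi>(a \<bowtie> h) = a r(h\<^sub>1) \<bowtie>' v(h\<^sub>2)\<close>. This is the map \<open>twist r v\<close> below.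
  
  Read in terms of \<open>(r, v)\<close>, the properties of \<open>\<psi>\<close> become those in the definition of cohomologous
  objects. Compatibility with comultiplication means that \<open>r\<close> and \<open>v\<close> are coalgebra maps and that
  \<open>r(h\<^sub>1) \<otimes> v(h\<^sub>2) = r(h\<^sub>2) \<otimes> v(h\<^sub>1)\<close>, which for bijective \<open>v\<close> is cocentrality of \<open>r\<close>. Comparing
  \<open>\<psi>((1 \<bowtie> h)(1 \<bowtie> g))\<close> with \<open>\<psi>(1 \<bowtie> h)\<psi>(1 \<bowtie> g)\<close> gives the formulas for \<open>r(hg)\<close> and \<open>v(hg)\<close>, and comparing
  \<open>\<psi>((1 \<bowtie> h)(a \<bowtie> 1))\<close> with \<open>\<psi>(1 \<bowtie> h)(a \<bowtie>' 1)\<close> gives \<open>v(h \<triangleleft> a) = v(h) \<triangleleft>' a\<close> together with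
  \<open>(h\<^sub>1 \<triangleright> a\<^sub>1) r(h\<^sub>2 \<triangleleft> a\<^sub>2) = r(h\<^sub>1)(v(h\<^sub>2) \<triangleright>' a)\<close>. In the convolution algebra \<open>Hom(H \<otimes> A, A)\<close> the map
  \<open>h \<otimes> a \<mapsto> r(h \<triangleleft> a)\<close> has the inverse \<open>h \<otimes> a \<mapsto> S(r(h \<triangleleft> a))\<close>, so the last equation can be solved for
  \<open>h \<triangleright> a\<close>; the solution is the formula in condition (2) (\<open>lact_iff\<close>). Finally \<open>\<psi>\<close> is invertible exactly
  when \<open>v\<close> is: \<open>(\<epsilon> \<otimes> id) \<circ> \<psi> = v \<circ> (\<epsilon> \<otimes> id)\<close> shows that \<open>v\<close> is bijective if \<open>\<psi>\<close> is, and in the other direction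
  the inverse is \<open>twist (S \<circ> r \<circ> v\<^sup>-\<^sup>1) v\<^sup>-\<^sup>1\<close> (\<open>twist_twist\<close>).
  
  Therefore two objects are cohomologous if and only if they are isomorphic
  (\<open>cohomologous_eq_MP_iso\<close>). Isomorphism is an equivalence relation because identities, inverses and
  composites of stabilizing Hopf maps are again such maps, and the required bijection is the identity.
  
  The calculations are multilinear identities between expressions in Sweedler notation. Sweedler
  sums are treated as honest finite sums, which may be exchanged and moved through linear maps, while coassociativity, counits, coalgebra maps and multiplicativity of
  the comultiplication become rewriting rules for multilinear functions.
\<close>

section \<open>Linear maps and tensor products\<close>

text \<open>
  Unlike \<open>linear_map\<close>, this does not restrict the values off the carrier, so that expressions with one
  free variable can be treated as linear maps without inserting \<open>restrict\<close>.
\<close>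

definition lin ::
  "('k::field, 'v::ab_group_add, 'y) kspace_scheme \<Rightarrow> ('k, 'w::ab_group_add, 'z) kspace_scheme
    \<Rightarrow> ('v \<Rightarrow> 'w) \<Rightarrow> bool" where
  "lin V W f \<longleftrightarrow> (\<forall>x\<in>vecs V. f x \<in> vecs W) \<and>
     (\<forall>x\<in>vecs V. \<forall>y\<in>vecs V. f (x + y) = f x + f y) \<and>
     (\<forall>c. \<forall>x\<in>vecs V. f (c \<star>\<^bsub>V\<^esub> x) = c \<star>\<^bsub>W\<^esub> f x)"

lemma lin_mem: "lin V W f \<Longrightarrow> x \<in> vecs V \<Longrightarrow> f x \<in> vecs W"
  by (simp add: lin_def)

lemma lin_add: "lin V W f \<Longrightarrow> x \<in> vecs V \<Longrightarrow> y \<in> vecs V \<Longrightarrow> f (x + y) = f x + f y"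
  by (simp add: lin_def)

lemma lin_scale: "lin V W f \<Longrightarrow> x \<in> vecs V \<Longrightarrow> f (c \<star>\<^bsub>V\<^esub> x) = c \<star>\<^bsub>W\<^esub> f x"
  by (simp add: lin_def)

lemma lin_congI: "kspace V \<Longrightarrow> lin V W f \<Longrightarrow> (\<And>x. x \<in> vecs V \<Longrightarrow> f x = g x) \<Longrightarrow> lin V W g"
  by (simp add: lin_def kspace_closed)

lemma kspace_scale_one: "kspace V \<Longrightarrow> 1 \<star>\<^bsub>V\<^esub> x = x"
  by (simp add: kspace_def vector_space.vector_space_assms(4))

lemma kspace_scale_scale: "kspace V \<Longrightarrow> c \<star>\<^bsub>V\<^esub> d \<star>\<^bsub>V\<^esub> x = (c * d) \<star>\<^bsub>V\<^esub> x"
  by (simp add: kspace_def vector_space.vector_space_assms(3))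

lemma kspace_scale_add: "kspace V \<Longrightarrow> c \<star>\<^bsub>V\<^esub> (x + y) = c \<star>\<^bsub>V\<^esub> x + c \<star>\<^bsub>V\<^esub> y"
  by (simp add: kspace_def vector_space.vector_space_assms(1))

lemma kspace_add_scale: "kspace V \<Longrightarrow> (c + d) \<star>\<^bsub>V\<^esub> x = c \<star>\<^bsub>V\<^esub> x + d \<star>\<^bsub>V\<^esub> x"
  by (simp add: kspace_def vector_space.vector_space_assms(2))

lemma kspace_scale_zero: "kspace V \<Longrightarrow> 0 \<star>\<^bsub>V\<^esub> x = 0"
  using kspace_add_scale[of V 0 0 x] by simp

lemma kspace_ground: "kspace (ground :: ('k::field, 'k) kspace)"
proof -
  interpret K: vector_space "(*) :: 'k \<Rightarrow> 'k \<Rightarrow> 'k"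
    by unfold_locales (auto simp: algebra_simps)
  show ?thesis by (simp add: kspace_def ground_def K.vector_space_axioms)
qed

lemma ground_simps [simp]: "vecs ground = UNIV" "scl ground = (*)"
  by (simp_all add: ground_def)

lemma lin_zero: "lin V W f \<Longrightarrow> kspace V \<Longrightarrow> kspace W \<Longrightarrow> f 0 = 0"
  using lin_scale[of V W f 0 0] by (simp add: kspace_scale_zero kspace_closed)

lemma lin_sum_list:
  assumes "lin V W f" "kspace V" "kspace W" "\<And>p. p \<in> set ps \<Longrightarrow> g p \<in> vecs V"
  shows "f (\<Sum>p\<leftarrow>ps. g p) = (\<Sum>p\<leftarrow>ps. f (g p))"
proof -
  have "(\<Sum>p\<leftarrow>ps. g p) \<in> vecs V \<and> f (\<Sum>p\<leftarrow>ps. g p) = (\<Sum>p\<leftarrow>ps. f (g p))"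
    using assms(4)
    by (induction ps) (auto simp: lin_zero[OF assms(1-3)] kspace_closed[OF assms(2)] lin_add[OF assms(1)])
  then show ?thesis ..
qed

lemma linear_map_lin: "linear_map V W f \<Longrightarrow> lin V W f"
  by (auto simp: linear_map_def lin_def)

lemma linear_map_restrict:
  "kspace V \<Longrightarrow> linear_map V W (restrict f (vecs V)) \<longleftrightarrow> lin V W f"
  by (auto simp: linear_map_def lin_def kspace_closed)

lemma linear_map_ext:
  "linear_map V W f \<Longrightarrow> linear_map V W g \<Longrightarrow> (\<And>x. x \<in> vecs V \<Longrightarrow> f x = g x) \<Longrightarrow> f = g"
  by (auto simp: linear_map_def PiE_iff intro: extensionalityI[of _ "vecs V"])

lemma bilinear_map_iff:
  "kspace V \<Longrightarrow> kspace W \<Longrightarrow> bilinear_map V W U f \<longleftrightarrow>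
    (\<forall>y\<in>vecs W. lin V U (\<lambda>x. f x y)) \<and> (\<forall>x\<in>vecs V. lin W U (f x))"
  by (simp add: bilinear_map_def linear_map_restrict)

lemma
  assumes "kspace V" "kspace W" "kspace U" "bilinear_map V W U f"
  shows linear_map_tlift: "linear_map (V \<Otimes> W) U (tlift V W U f)"
    and tlift_tens: "x \<in> vecs V \<Longrightarrow> y \<in> vecs W \<Longrightarrow> tlift V W U f (x \<otimes>\<^bsub>V,W\<^esub> y) = f x y"
  using theI'[OF tensor_universal[OF assms]] by (simp_all add: tlift_def)

text \<open>
  A scalar in front of a generator is absorbed into its first factor, so sums suffice.
\<close>

lemma tensor_decomposition:
  assumes "kspace V" "kspace W" "T \<in> vecs (V \<Otimes> W)"
  shows "\<exists>ps. (\<forall>(x, y)\<in>set ps. x \<in> vecs V \<and> y \<in> vecs W) \<and> T = (\<Sum>(x, y)\<leftarrow>ps. x \<otimes>\<^bsub>V,W\<^esub> y)"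
proof -
  interpret T: vector_space "\<lambda>c (T::('b \<Rightarrow> 'd \<Rightarrow> 'a) \<Rightarrow> 'a) \<beta>. c * T \<beta>"
    by (rule tensor_vector_space)
  have "T \<in> T.span {x \<otimes>\<^bsub>V,W\<^esub> y | x y. x \<in> vecs V \<and> y \<in> vecs W}"
    using assms(3) by (simp add: tensor_space_def)
  then show ?thesis
  proof (induction T rule: T.span_induct_alt)
    case base
    show ?case by (rule exI[of _ "[]"]) simp
  next
    case (step c t T')
    then obtain x y ps where *: "t = x \<otimes>\<^bsub>V,W\<^esub> y" "x \<in> vecs V" "y \<in> vecs W"
      "\<forall>(x, y)\<in>set ps. x \<in> vecs V \<and> y \<in> vecs W" "T' = (\<Sum>(x, y)\<leftarrow>ps. x \<otimes>\<^bsub>V,W\<^esub> y)" by blast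
    have "(c \<star>\<^bsub>V\<^esub> x) \<otimes>\<^bsub>V,W\<^esub> y = c \<star>\<^bsub>V \<Otimes> W\<^esub> (x \<otimes>\<^bsub>V,W\<^esub> y)"
      using bilinear_mapD(3)[OF bilinear_map_tens[OF assms(1,2)] assms(1,2)] * by blast
    then have "(\<lambda>\<beta>. c * t \<beta>) = (c \<star>\<^bsub>V\<^esub> x) \<otimes>\<^bsub>V,W\<^esub> y"
      by (simp add: tensor_space_def *)
    then show ?case using * kspace_closed[OF assms(1)]
      by (intro exI[of _ "(c \<star>\<^bsub>V\<^esub> x, y) # ps"]) auto
  qed
qed

text \<open>
  The uniqueness half of the universal property, in the form in which it reduces an identity between
  linear expressions to pure tensors.
\<close>

lemma lin_tensor_eq:
  assumes "kspace V" "kspace W" "kspace U" "lin (V \<Otimes> W) U f" "lin (V \<Otimes> W) U g"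
    "\<And>x y. x \<in> vecs V \<Longrightarrow> y \<in> vecs W \<Longrightarrow> f (x \<otimes>\<^bsub>V,W\<^esub> y) = g (x \<otimes>\<^bsub>V,W\<^esub> y)"
    "T \<in> vecs (V \<Otimes> W)"
  shows "f T = g T"
proof -
  obtain ps where ps: "\<forall>(x, y)\<in>set ps. x \<in> vecs V \<and> y \<in> vecs W" "T = (\<Sum>(x, y)\<leftarrow>ps. x \<otimes>\<^bsub>V,W\<^esub> y)"
    using tensor_decomposition[OF assms(1,2,7)] by blast
  have mem: "(case p of (x, y) \<Rightarrow> x \<otimes>\<^bsub>V,W\<^esub> y) \<in> vecs (V \<Otimes> W)" if "p \<in> set ps" for p
    using that ps(1) by (auto intro!: tens_mem)
  have "f T = (\<Sum>p\<leftarrow>ps. f (case p of (x, y) \<Rightarrow> x \<otimes>\<^bsub>V,W\<^esub> y))"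
    unfolding ps(2) by (rule lin_sum_list[OF assms(4)]) (auto simp: assms kspace_tensor_space mem)
  also have "\<dots> = (\<Sum>p\<leftarrow>ps. g (case p of (x, y) \<Rightarrow> x \<otimes>\<^bsub>V,W\<^esub> y))"
    using ps(1) assms(6) by (intro arg_cong[of _ _ sum_list] map_cong) auto
  also have "\<dots> = g T"
    unfolding ps(2) by (rule lin_sum_list[OF assms(5), symmetric]) (auto simp: assms kspace_tensor_space mem)
  finally show ?thesis .
qed

section \<open>Sweedler sums\<close>

text \<open>
  Coassociativity and counitality enter only after Sweedler sums are available: for a tensor product of
  coalgebras the sums are used to establish these two laws.
\<close>

definition precoalgebra :: "('k::field, 'v::ab_group_add, 'z) coalg_scheme \<Rightarrow> bool" where
  "precoalgebra C \<longleftrightarrow> kspace C \<and> lin C (C \<Otimes> C) (comult C)"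

definition cosplit :: "('k::field, 'v::ab_group_add, 'z) coalg_scheme \<Rightarrow> 'v \<Rightarrow> ('v \<times> 'v) list" where
  "cosplit C c = (SOME ps. (\<forall>(x, y)\<in>set ps. x \<in> vecs C \<and> y \<in> vecs C) \<and>
     comult C c = (\<Sum>(x, y)\<leftarrow>ps. x \<otimes>\<^bsub>C,C\<^esub> y))"

text \<open>
  The value depends on the chosen decomposition of \<open>comult C c\<close> only if \<open>f\<close> is not bilinear; for bilinear
  \<open>f\<close> it agrees with \<open>sweedler\<close>, see \<open>sweedler_eq_sw\<close>. Being a finite sum for every \<open>f\<close>, it can be
  exchanged with other such sums unconditionally.
\<close>

definition sw ::
  "('k::field, 'v::ab_group_add, 'z) coalg_scheme \<Rightarrow> 'v \<Rightarrow> ('v \<Rightarrow> 'v \<Rightarrow> 'u) \<Rightarrow> 'u::ab_group_add" where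
  "sw C c f = (\<Sum>(x, y)\<leftarrow>cosplit C c. f x y)"

lemma cosplit:
  assumes "precoalgebra C" "c \<in> vecs C"
  shows "(x, y) \<in> set (cosplit C c) \<Longrightarrow> x \<in> vecs C \<and> y \<in> vecs C"
    and "comult C c = (\<Sum>(x, y)\<leftarrow>cosplit C c. x \<otimes>\<^bsub>C,C\<^esub> y)"
proof -
  have "comult C c \<in> vecs (C \<Otimes> C)" "kspace C"
    using assms by (auto simp: precoalgebra_def lin_def)
  from someI_ex[OF tensor_decomposition[OF this(2) this(2) this(1)]]
  show "(x, y) \<in> set (cosplit C c) \<Longrightarrow> x \<in> vecs C \<and> y \<in> vecs C"
    and "comult C c = (\<Sum>(x, y)\<leftarrow>cosplit C c. x \<otimes>\<^bsub>C,C\<^esub> y)"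
    by (auto simp: cosplit_def)
qed

lemma sw_cong:
  assumes "precoalgebra C" "c \<in> vecs C"
    "\<And>x y. x \<in> vecs C \<Longrightarrow> y \<in> vecs C \<Longrightarrow> f x y = g x y"
  shows "sw C c f = sw C c g"
  unfolding sw_def using cosplit(1)[OF assms(1,2)] assms(3)
  by (intro arg_cong[of _ _ sum_list] map_cong) auto

lemma sw_mem:
  assumes "precoalgebra C" "kspace U" "c \<in> vecs C"
    "\<And>x y. x \<in> vecs C \<Longrightarrow> y \<in> vecs C \<Longrightarrow> f x y \<in> vecs U"
  shows "sw C c f \<in> vecs U"
proof -
  have "(\<Sum>p\<leftarrow>ps. case p of (x, y) \<Rightarrow> f x y) \<in> vecs U"
    if "\<And>x y. (x, y) \<in> set ps \<Longrightarrow> x \<in> vecs C \<and> y \<in> vecs C" for ps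
    using that
  proof (induction ps)
    case (Cons p ps)
    then have "(\<Sum>p\<leftarrow>ps. case p of (x, y) \<Rightarrow> f x y) \<in> vecs U" by auto
    moreover have "(case p of (x, y) \<Rightarrow> f x y) \<in> vecs U"
      using Cons.prems assms(4) by (cases p) auto
    ultimately show ?case by (simp add: kspace_closed[OF assms(2)])
  qed (simp add: kspace_closed[OF assms(2)])
  then show ?thesis unfolding sw_def using cosplit(1)[OF assms(1,3)] by blast
qed

lemma lin_sw:
  assumes "lin V U F" "precoalgebra C" "kspace V" "kspace U" "c \<in> vecs C"
    "\<And>x y. x \<in> vecs C \<Longrightarrow> y \<in> vecs C \<Longrightarrow> f x y \<in> vecs V"
  shows "F (sw C c f) = sw C c (\<lambda>x y. F (f x y))"
proof -
  have *: "(case p of (x, y) \<Rightarrow> f x y) \<in> vecs V" if "p \<in> set (cosplit C c)" for p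
    using that cosplit(1)[OF assms(2,5), of "fst p" "snd p"] assms(6) by (simp add: case_prod_unfold)
  show ?thesis unfolding sw_def
    by (subst lin_sum_list[OF assms(1,3,4) *]) (simp_all add: case_prod_unfold)
qed

lemma sw_swap:
  fixes C :: "('k::field, 'v::ab_group_add, 'y) coalg_scheme"
    and D :: "('l::field, 'w::ab_group_add, 'z) coalg_scheme"
    and f :: "'v \<Rightarrow> 'v \<Rightarrow> 'w \<Rightarrow> 'w \<Rightarrow> 'u::ab_group_add"
  shows "sw C c (\<lambda>x y. sw D d (f x y)) = sw D d (\<lambda>z w. sw C c (\<lambda>x y. f x y z w))"
proof -
  have "(\<Sum>p\<leftarrow>ps. \<Sum>q\<leftarrow>qs. g p q) = (\<Sum>q\<leftarrow>qs. \<Sum>p\<leftarrow>ps. g p q)"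
    for ps :: "('v \<times> 'v) list" and qs :: "('w \<times> 'w) list" and g :: "_ \<Rightarrow> _ \<Rightarrow> 'u"
    by (induction ps) (simp_all add: sum_list_addf)
  from this[of "\<lambda>p q. f (fst p) (snd p) (fst q) (snd q)"] show ?thesis
    by (simp add: sw_def case_prod_unfold)
qed

lemma sw_add: "sw C c (\<lambda>x y. f x y + g x y) = sw C c f + sw C c g"
  by (simp add: sw_def case_prod_unfold sum_list_addf)

text \<open>
  The second sum may run over a part \<open>d x y\<close> of the first one; the outermost position is reached by two
  exchanges.
\<close>

lemma sw_swap_inner:
  "sw C c (\<lambda>x y. sw D (d x y) (\<lambda>z w. sw E e (F x y z w)))
    = sw E e (\<lambda>s t. sw C c (\<lambda>x y. sw D (d x y) (\<lambda>z w. F x y z w s t)))"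
proof -
  have "sw D (d x y) (\<lambda>z w. sw E e (F x y z w)) = sw E e (\<lambda>s t. sw D (d x y) (\<lambda>z w. F x y z w s t))" for x y
    by (rule sw_swap)
  then have "sw C c (\<lambda>x y. sw D (d x y) (\<lambda>z w. sw E e (F x y z w))) =
     sw C c (\<lambda>x y. sw E e (\<lambda>s t. sw D (d x y) (\<lambda>z w. F x y z w s t)))" by simp
  also have "\<dots> = sw E e (\<lambda>s t. sw C c (\<lambda>x y. sw D (d x y) (\<lambda>z w. F x y z w s t)))"
    by (rule sw_swap)
  finally show ?thesis .
qed

lemma
  assumes "precoalgebra C" "kspace U" "c \<in> vecs C"
    "\<And>y. y \<in> vecs C \<Longrightarrow> lin C U (\<lambda>x. f x y)" "\<And>x. x \<in> vecs C \<Longrightarrow> lin C U (f x)"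
  shows sweedler_eq_sw: "sweedler C U c f = sw C c f"
    and tlift_comult_eq_sw: "tlift C C U f (comult C c) = sw C c f"
proof -
  have C: "kspace C" and CC: "kspace (C \<Otimes> C)"
    using assms by (auto simp: precoalgebra_def kspace_tensor_space)
  have bil: "bilinear_map C C U f" using assms C by (auto simp: bilinear_map_iff)
  note L = linear_map_lin[OF linear_map_tlift[OF C C assms(2) bil]]
  have mem: "(case p of (x, y) \<Rightarrow> x \<otimes>\<^bsub>C,C\<^esub> y) \<in> vecs (C \<Otimes> C)" if "p \<in> set (cosplit C c)" for p
    using that cosplit(1)[OF assms(1,3), of "fst p" "snd p"] by (simp add: case_prod_unfold tens_mem)
  have "tlift C C U f (comult C c) = (\<Sum>p\<leftarrow>cosplit C c. tlift C C U f (case p of (x, y) \<Rightarrow> x \<otimes>\<^bsub>C,C\<^esub> y))"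
    unfolding cosplit(2)[OF assms(1,3)] by (rule lin_sum_list[OF L CC assms(2) mem])
  also have "\<dots> = sw C c f"
    unfolding sw_def using cosplit(1)[OF assms(1,3)] tlift_tens[OF C C assms(2) bil]
    by (intro arg_cong[of _ _ sum_list] map_cong) auto
  finally show "tlift C C U f (comult C c) = sw C c f" .
  then show "sweedler C U c f = sw C c f" by (simp add: sweedler_def)
qed

lemma lin_compose: "lin W U g \<Longrightarrow> lin V W f \<Longrightarrow> lin V U (\<lambda>x. g (f x))"
  by (simp add: lin_def)

text \<open>
  A Sweedler sum is linear in the element that is split only because the summand is bilinear; it is
  linear in any other variable of the summand without that condition, see \<open>lin_sw_body\<close>.
\<close>

lemma lin_sw_arg:
  assumes "precoalgebra C" "kspace V" "kspace U" "lin V C g"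
    "\<And>y. y \<in> vecs C \<Longrightarrow> lin C U (\<lambda>x. f x y)" "\<And>x. x \<in> vecs C \<Longrightarrow> lin C U (f x)"
  shows "lin V U (\<lambda>v. sw C (g v) f)"
proof -
  have C: "kspace C" using assms by (auto simp: precoalgebra_def)
  have bil: "bilinear_map C C U f" using assms C by (auto simp: bilinear_map_iff)
  note L = linear_map_lin[OF linear_map_tlift[OF C C assms(3) bil]]
  have "lin V U (\<lambda>v. tlift C C U f (comult C (g v)))"
    using lin_compose[OF L lin_compose[OF _ assms(4)]] assms(1) by (simp add: precoalgebra_def)
  moreover have "tlift C C U f (comult C (g v)) = sw C (g v) f" if "v \<in> vecs V" for v
    using tlift_comult_eq_sw[OF assms(1,3) lin_mem[OF assms(4) that] assms(5,6)] .
  ultimately show ?thesis by (rule lin_congI[OF assms(2)])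
qed

lemma lin_sw_body:
  assumes "precoalgebra C" "kspace V" "kspace U" "c \<in> vecs C"
    "\<And>x y. x \<in> vecs C \<Longrightarrow> y \<in> vecs C \<Longrightarrow> lin V U (\<lambda>v. f v x y)"
  shows "lin V U (\<lambda>v. sw C c (f v))"
proof -
  have s: "lin U U (scl U k)" for k
    using assms(3) kspace_closed[OF assms(3)]
    by (auto simp: lin_def kspace_scale_add kspace_scale_scale mult.commute)
  have "sw C c (f v) \<in> vecs U" if "v \<in> vecs V" for v
    using assms that by (intro sw_mem) (auto intro: lin_mem[OF assms(5)])
  moreover have "sw C c (f (v + w)) = sw C c (f v) + sw C c (f w)" if "v \<in> vecs V" "w \<in> vecs V" for v w
    unfolding sw_add[symmetric] using assms that
    by (intro sw_cong) (auto intro: lin_add[OF assms(5)])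
  moreover have "sw C c (f (k \<star>\<^bsub>V\<^esub> v)) = k \<star>\<^bsub>U\<^esub> sw C c (f v)" if "v \<in> vecs V" for k v
    by (subst lin_sw[OF s assms(1,3,3,4) lin_mem[OF assms(5) that]])
      (auto intro!: sw_cong[OF assms(1,4)] lin_scale[OF assms(5)] that)
  ultimately show ?thesis by (simp add: lin_def)
qed

text \<open>
  These rules reduce linearity in a variable that occurs exactly once in an expression to the linearity
  of the operations on the path to it.
\<close>

named_theorems linear_intros

lemma lin_id: "lin V V (\<lambda>x. x)"
  by (simp add: lin_def)

lemma lin_tlift:
  assumes "kspace V" "kspace W" "kspace U"
    "\<And>y. y \<in> vecs W \<Longrightarrow> lin V U (\<lambda>x. f x y)" "\<And>x. x \<in> vecs V \<Longrightarrow> lin W U (f x)"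
  shows "lin (V \<Otimes> W) U (tlift V W U f)"
    and "x \<in> vecs V \<Longrightarrow> y \<in> vecs W \<Longrightarrow> tlift V W U f (x \<otimes>\<^bsub>V,W\<^esub> y) = f x y"
  using assms by (auto intro!: linear_map_lin linear_map_tlift tlift_tens simp: bilinear_map_iff)

lemma lin_sum_list_fun:
  "kspace V \<Longrightarrow> kspace U \<Longrightarrow> (\<And>p. p \<in> set ps \<Longrightarrow> lin V U (f p)) \<Longrightarrow> lin V U (\<lambda>v. \<Sum>p\<leftarrow>ps. f p v)"
proof (induction ps)
  case Nil
  then show ?case using kspace_scale_zero[of U] kspace_scale_add[of U _ 0 0]
    by (simp add: lin_def kspace_closed)
next
  case (Cons p ps)
  then have "lin V U (f p)" "lin V U (\<lambda>v. \<Sum>p\<leftarrow>ps. f p v)" by auto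
  then show ?case using Cons.prems
    by (simp add: lin_def kspace_closed kspace_scale_add algebra_simps)
qed

text \<open>
  For a fixed tensor \<open>t = \<Sum> y \<otimes> z\<close> the value \<open>tlift Y Z U (f v) t\<close> is the sum of the \<open>f v y z\<close>.
\<close>

lemma lin_tlift_body:
  assumes "kspace V" "kspace Y" "kspace Z" "kspace U" "t \<in> vecs (Y \<Otimes> Z)"
    "\<And>y z. y \<in> vecs Y \<Longrightarrow> z \<in> vecs Z \<Longrightarrow> lin V U (\<lambda>v. f v y z)"
    "\<And>v z. v \<in> vecs V \<Longrightarrow> z \<in> vecs Z \<Longrightarrow> lin Y U (\<lambda>y. f v y z)"
    "\<And>v y. v \<in> vecs V \<Longrightarrow> y \<in> vecs Y \<Longrightarrow> lin Z U (\<lambda>z. f v y z)"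
  shows "lin V U (\<lambda>v. tlift Y Z U (f v) t)"
proof -
  obtain ps where ps: "\<forall>(x, y)\<in>set ps. x \<in> vecs Y \<and> y \<in> vecs Z" "t = (\<Sum>p\<leftarrow>ps. fst p \<otimes>\<^bsub>Y,Z\<^esub> snd p)"
    using tensor_decomposition[OF assms(2,3,5)] by (auto simp: case_prod_unfold)
  have eq: "(\<Sum>p\<leftarrow>ps. f v (fst p) (snd p)) = tlift Y Z U (f v) t" if "v \<in> vecs V" for v
  proof -
    have "tlift Y Z U (f v) t = (\<Sum>p\<leftarrow>ps. tlift Y Z U (f v) (fst p \<otimes>\<^bsub>Y,Z\<^esub> snd p))"
      unfolding ps(2) using ps(1) that assms
      by (intro lin_sum_list[OF lin_tlift(1)]) (auto intro!: tens_mem kspace_tensor_space)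
    also have "\<dots> = (\<Sum>p\<leftarrow>ps. f v (fst p) (snd p))"
      using ps(1) assms that by (intro arg_cong[of _ _ sum_list] map_cong lin_tlift(2)) auto
    finally show ?thesis ..
  qed
  have "lin V U (\<lambda>v. \<Sum>p\<leftarrow>ps. f v (fst p) (snd p))"
    using ps(1) assms by (intro lin_sum_list_fun) auto
  from lin_congI[OF assms(1) this eq] show ?thesis .
qed

lemma tlift_cong:
  assumes "\<And>x y. x \<in> vecs V \<Longrightarrow> y \<in> vecs W \<Longrightarrow> f x y = g x y"
  shows "tlift V W U f = tlift V W U g"
proof -
  have "(\<forall>x\<in>vecs V. \<forall>y\<in>vecs W. F (x \<otimes>\<^bsub>V,W\<^esub> y) = f x y) \<longleftrightarrow>
    (\<forall>x\<in>vecs V. \<forall>y\<in>vecs W. F (x \<otimes>\<^bsub>V,W\<^esub> y) = g x y)" for F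
    using assms by simp
  then show ?thesis by (simp add: tlift_def)
qed

lemma sweedler_cong:
  "(\<And>x y. x \<in> vecs C \<Longrightarrow> y \<in> vecs C \<Longrightarrow> f x y = g x y) \<Longrightarrow> sweedler C U c f = sweedler C U c g"
  unfolding sweedler_def by (simp cong: tlift_cong)

lemma lin_tens_left:
  "kspace V \<Longrightarrow> kspace W \<Longrightarrow> lin U V f \<Longrightarrow> y \<in> vecs W \<Longrightarrow> lin U (V \<Otimes> W) (\<lambda>x. f x \<otimes>\<^bsub>V,W\<^esub> y)"
  using bilinear_map_tens[of V W] by (auto simp: bilinear_map_iff intro: lin_compose[of V _ _ U f])

lemma lin_tens_right:
  "kspace V \<Longrightarrow> kspace W \<Longrightarrow> lin U W f \<Longrightarrow> x \<in> vecs V \<Longrightarrow> lin U (V \<Otimes> W) (\<lambda>y. x \<otimes>\<^bsub>V,W\<^esub> f y)"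
  using bilinear_map_tens[of V W] by (auto simp: bilinear_map_iff intro: lin_compose[of W _ _ U f])

lemma lin_scale_vector: "kspace W \<Longrightarrow> lin V W f \<Longrightarrow> lin V W (\<lambda>x. c \<star>\<^bsub>W\<^esub> f x)"
  by (auto simp: lin_def kspace_scale_add kspace_scale_scale mult.commute kspace_closed)

lemma lin_scale_scalar: "kspace W \<Longrightarrow> lin V ground f \<Longrightarrow> y \<in> vecs W \<Longrightarrow> lin V W (\<lambda>x. f x \<star>\<^bsub>W\<^esub> y)"
  by (auto simp: lin_def kspace_add_scale kspace_scale_scale kspace_closed)

lemma lin_times_left: "lin V ground f \<Longrightarrow> lin V ground (\<lambda>x. f x * c)"
  by (auto simp: lin_def algebra_simps)

lemma lin_times_right: "lin V ground f \<Longrightarrow> lin V ground (\<lambda>x. c * f x)"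
  by (auto simp: lin_def algebra_simps)

declare lin_id [linear_intros] lin_tens_left [linear_intros] lin_tens_right [linear_intros]
  lin_scale_vector [linear_intros] lin_scale_scalar [linear_intros]
  lin_times_left [linear_intros] lin_times_right [linear_intros]
  lin_sw_arg [linear_intros] lin_sw_body [linear_intros]
  kspace_tensor_space [linear_intros] kspace_ground [linear_intros]
  tens_mem [linear_intros] sw_mem [linear_intros] kspace_closed(2) [linear_intros]

lemma coalgebraD:
  assumes "coalgebra C"
  shows coalgebra_kspace: "kspace C" and coalgebra_precoalgebra: "precoalgebra C"
    and lin_counit: "lin C ground (counit C)"
  using assms by (auto simp: coalgebra_def precoalgebra_def linear_map_lin)

text \<open>
  Coassociativity is an identity in \<open>C \<Otimes> C \<Otimes> C\<close>; it holds for every trilinear \<open>f\<close> because \<open>f\<close> factors through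
  that space.
\<close>

lemma sw_coassoc:
  assumes C: "coalgebra C" and U: "kspace U" and c: "c \<in> vecs C"
    and f: "\<And>y z. y \<in> vecs C \<Longrightarrow> z \<in> vecs C \<Longrightarrow> lin C U (\<lambda>x. f x y z)"
    "\<And>x z. x \<in> vecs C \<Longrightarrow> z \<in> vecs C \<Longrightarrow> lin C U (\<lambda>y. f x y z)"
    "\<And>x y. x \<in> vecs C \<Longrightarrow> y \<in> vecs C \<Longrightarrow> lin C U (\<lambda>z. f x y z)"
  shows "sw C c (\<lambda>x z. sw C x (\<lambda>x y. f x y z)) = sw C c (\<lambda>x y. sw C y (\<lambda>y z. f x y z))"
proof -
  note [linear_intros] = coalgebraD[OF C]
  have co: "lin C (C \<Otimes> C) (comult C)" using C by (simp add: coalgebra_def linear_map_lin)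
  note [linear_intros] = lin_compose[OF co] lin_mem[OF co] lin_compose[OF f(1)] lin_compose[OF f(2)] lin_compose[OF f(3)]
    U c
  define F2 where "F2 = (\<lambda>x. tlift C C U (\<lambda>y z. f x y z))"
  have F2: "lin (C \<Otimes> C) U (F2 x)"
    "\<And>y z. y \<in> vecs C \<Longrightarrow> z \<in> vecs C \<Longrightarrow> F2 x (y \<otimes>\<^bsub>C,C\<^esub> z) = f x y z"
    "\<And>y. y \<in> vecs C \<Longrightarrow> F2 x (comult C y) = sw C y (f x)"
    if "x \<in> vecs C" for x
    unfolding F2_def using that
    by (auto intro!: linear_intros lin_tlift tlift_comult_eq_sw)
  have F2': "lin C U (\<lambda>x. F2 x t)" if "t \<in> vecs (C \<Otimes> C)" for t
    unfolding F2_def using that by (intro lin_tlift_body) (auto intro!: linear_intros f)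
  define F3 where "F3 = tlift C (C \<Otimes> C) U F2"
  have F3: "lin (C \<Otimes> C \<Otimes> C) U F3"
    "\<And>x t. x \<in> vecs C \<Longrightarrow> t \<in> vecs (C \<Otimes> C) \<Longrightarrow> F3 (x \<otimes>\<^bsub>C,C \<Otimes> C\<^esub> t) = F2 x t"
    unfolding F3_def by (auto intro!: linear_intros lin_tlift F2 F2')
  have "F3 (sweedler C (C \<Otimes> C \<Otimes> C) c (\<lambda>x z. sweedler C (C \<Otimes> C \<Otimes> C) x
      (\<lambda>x y. x \<otimes>\<^bsub>C, C \<Otimes> C\<^esub> (y \<otimes>\<^bsub>C,C\<^esub> z))))
    = F3 (sweedler C (C \<Otimes> C \<Otimes> C) c (\<lambda>x y. x \<otimes>\<^bsub>C, C \<Otimes> C\<^esub> comult C y))"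
    using C c by (simp add: coalgebra_def)
  then show ?thesis
    by (simp add: linear_intros sweedler_eq_sw F3 F2 lin_sw[OF F3(1)] cong: sweedler_cong sw_cong)
qed

lemma sw_counit_left:
  assumes "coalgebra C" "kspace U" "c \<in> vecs C" "lin C U f"
  shows "sw C c (\<lambda>x y. counit C x \<star>\<^bsub>U\<^esub> f y) = f c"
proof -
  note [simp] = coalgebraD[OF assms(1)] lin_compose[OF lin_counit[OF assms(1)]] assms linear_intros
    lin_scale[OF assms(4)]
  have "sw C c (\<lambda>x y. counit C x \<star>\<^bsub>C\<^esub> y) = c"
    using assms(1,3) by (simp add: coalgebra_def sweedler_eq_sw)
  then have "f c = f (sw C c (\<lambda>x y. counit C x \<star>\<^bsub>C\<^esub> y))" by simp
  also have "\<dots> = sw C c (\<lambda>x y. counit C x \<star>\<^bsub>U\<^esub> f y)"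
    by (simp add: lin_sw[OF assms(4)] cong: sw_cong)
  finally show ?thesis ..
qed

lemma sw_counit_right:
  assumes "coalgebra C" "kspace U" "c \<in> vecs C" "lin C U f"
  shows "sw C c (\<lambda>x y. counit C y \<star>\<^bsub>U\<^esub> f x) = f c"
proof -
  note [simp] = coalgebraD[OF assms(1)] lin_compose[OF lin_counit[OF assms(1)]] assms linear_intros
    lin_scale[OF assms(4)]
  have "sw C c (\<lambda>x y. counit C y \<star>\<^bsub>C\<^esub> x) = c"
    using assms(1,3) by (simp add: coalgebra_def sweedler_eq_sw)
  then have "f c = f (sw C c (\<lambda>x y. counit C y \<star>\<^bsub>C\<^esub> x))" by simp
  also have "\<dots> = sw C c (\<lambda>x y. counit C y \<star>\<^bsub>U\<^esub> f x)"
    by (simp add: lin_sw[OF assms(4)] cong: sw_cong)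
  finally show ?thesis ..
qed

section \<open>Coalgebra maps and tensor products of coalgebras\<close>

lemma sw_coalgebra_map:
  assumes "coalgebra_map C D f" "precoalgebra C" "precoalgebra D" "kspace U" "c \<in> vecs C"
    and g: "\<And>y. y \<in> vecs D \<Longrightarrow> lin D U (\<lambda>x. g x y)" "\<And>x. x \<in> vecs D \<Longrightarrow> lin D U (g x)"
  shows "sw D (f c) g = sw C c (\<lambda>x y. g (f x) (f y))"
proof -
  have f: "lin C D f" and comult: "comult D (f c) = sweedler C (D \<Otimes> D) c (\<lambda>x y. f x \<otimes>\<^bsub>D,D\<^esub> f y)"
    and kspaces: "kspace C" "kspace D"
    using assms by (auto simp: coalgebra_map_def linear_map_lin precoalgebra_def)
  note [simp] = linear_intros lin_mem[OF f] lin_compose[OF f] assms g kspaces lin_compose[OF g(1)] lin_compose[OF g(2)]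
  have L: "lin (D \<Otimes> D) U (tlift D D U g)"
    "\<And>x y. x \<in> vecs D \<Longrightarrow> y \<in> vecs D \<Longrightarrow> tlift D D U g (x \<otimes>\<^bsub>D,D\<^esub> y) = g x y"
    by (auto intro!: lin_tlift)
  have "sw D (f c) g = tlift D D U g (comult D (f c))"
    by (simp add: tlift_comult_eq_sw)
  also have "\<dots> = sw C c (\<lambda>x y. g (f x) (f y))"
    unfolding comult by (simp add: sweedler_eq_sw L lin_sw[OF L(1)] cong: sw_cong)
  finally show ?thesis .
qed

lemma coalgebra_mapI:
  assumes "linear_map C D f" "precoalgebra C" "kspace D" "\<And>c. c \<in> vecs C \<Longrightarrow> counit D (f c) = counit C c"
   "\<And>c. c \<in> vecs C \<Longrightarrow> comult D (f c) = sw C c (\<lambda>x y. f x \<otimes>\<^bsub>D,D\<^esub> f y)"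
 shows "coalgebra_map C D f"
proof -
  have f: "lin C D f" and "kspace C"
    using assms by (auto simp: coalgebra_map_def linear_map_lin precoalgebra_def)
  note [simp] = this linear_intros lin_mem[OF f] lin_compose[OF f] assms
  show ?thesis by (simp add: coalgebra_map_def sweedler_eq_sw)
qed

lemma tensor_coalg_simps [simp]:
  "vecs (C \<Otimes>\<^sub>c D) = vecs (C \<Otimes> D)" "scl (C \<Otimes>\<^sub>c D) = scl (C \<Otimes> D)"
  by (simp_all add: tensor_coalg_def)

text \<open>
  Linearity and tensor products see only the underlying space. This identifies the tensor product
  coalgebra, and later the bicrossed products, with \<open>C \<Otimes> D\<close> as spaces.
\<close>

lemma carrier_cong:
  assumes "vecs V = vecs V'" "scl V = scl V'"
  shows lin_cong_left: "lin V U f = lin V' U f"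
    and lin_cong_right: "lin U V g = lin U V' g"
    and linear_map_cong_left: "linear_map V U f = linear_map V' U f"
    and linear_map_cong_right: "linear_map U V g = linear_map U V' g"
    and kspace_cong: "kspace V = kspace V'"
    and tens_cong_left: "(x \<otimes>\<^bsub>V,U\<^esub> y) = (x \<otimes>\<^bsub>V',U\<^esub> y)"
    and tens_cong_right: "(y \<otimes>\<^bsub>U,V\<^esub> x) = (y \<otimes>\<^bsub>U,V'\<^esub> x)"
    and tensor_cong_left: "V \<Otimes> U = V' \<Otimes> U"
    and tensor_cong_right: "U \<Otimes> V = U \<Otimes> V'"
  using assms by (auto simp: lin_def kspace_def tens_def tensor_space_def bilinear_map_def linear_map_def)

lemmas tensor_coalg_carrier [simp] = carrier_cong[OF tensor_coalg_simps]

lemma tlift_carrier: "tlift (C \<Otimes>\<^sub>c D) (C \<Otimes>\<^sub>c D) = tlift (C \<Otimes> D) (C \<Otimes> D)"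
  by (simp add: tlift_def fun_eq_iff)

lemma
  assumes C: "precoalgebra C" and D: "precoalgebra D"
  shows precoalgebra_tensor: "precoalgebra (C \<Otimes>\<^sub>c D)"
    and linear_map_comult_tensor: "linear_map (C \<Otimes> D) ((C \<Otimes> D) \<Otimes> (C \<Otimes> D)) (comult (C \<Otimes>\<^sub>c D))"
    and comult_tens: "c \<in> vecs C \<Longrightarrow> d \<in> vecs D \<Longrightarrow> comult (C \<Otimes>\<^sub>c D) (c \<otimes>\<^bsub>C,D\<^esub> d) =
      sw C c (\<lambda>c1 c2. sw D d (\<lambda>d1 d2. (c1 \<otimes>\<^bsub>C,D\<^esub> d1) \<otimes>\<^bsub>C \<Otimes> D,C \<Otimes> D\<^esub> (c2 \<otimes>\<^bsub>C,D\<^esub> d2)))"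
proof -
  have [simp]: "kspace C" "kspace D" using assms by (auto simp: precoalgebra_def)
  note [simp] = assms linear_intros
  have comult: "comult (C \<Otimes>\<^sub>c D) = tlift C D ((C \<Otimes> D) \<Otimes> (C \<Otimes> D)) (\<lambda>c d.
      sw C c (\<lambda>c1 c2. sw D d (\<lambda>d1 d2. (c1 \<otimes>\<^bsub>C,D\<^esub> d1) \<otimes>\<^bsub>C \<Otimes> D,C \<Otimes> D\<^esub> (c2 \<otimes>\<^bsub>C,D\<^esub> d2))))"
    by (simp add: tensor_coalg_def sweedler_eq_sw cong: tlift_cong sweedler_cong)
  then show L: "linear_map (C \<Otimes> D) ((C \<Otimes> D) \<Otimes> (C \<Otimes> D)) (comult (C \<Otimes>\<^sub>c D))"
    by (simp add: linear_map_tlift bilinear_map_iff)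
  then show "precoalgebra (C \<Otimes>\<^sub>c D)"
    by (simp add: precoalgebra_def linear_map_lin)
  show "c \<in> vecs C \<Longrightarrow> d \<in> vecs D \<Longrightarrow> comult (C \<Otimes>\<^sub>c D) (c \<otimes>\<^bsub>C,D\<^esub> d) =
      sw C c (\<lambda>c1 c2. sw D d (\<lambda>d1 d2. (c1 \<otimes>\<^bsub>C,D\<^esub> d1) \<otimes>\<^bsub>C \<Otimes> D,C \<Otimes> D\<^esub> (c2 \<otimes>\<^bsub>C,D\<^esub> d2)))"
    unfolding comult by (simp add: tlift_tens bilinear_map_iff)
qed

lemma
  assumes C: "coalgebra C" and D: "coalgebra D"
  shows linear_map_counit_tensor: "linear_map (C \<Otimes> D) ground (counit (C \<Otimes>\<^sub>c D))"
    and counit_tens: "c \<in> vecs C \<Longrightarrow> d \<in> vecs D \<Longrightarrow>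
      counit (C \<Otimes>\<^sub>c D) (c \<otimes>\<^bsub>C,D\<^esub> d) = counit C c * counit D d"
  using C D by (auto simp: tensor_coalg_def linear_map_tlift tlift_tens bilinear_map_iff linear_intros coalgebraD)

lemma sw_tens:
  assumes C: "precoalgebra C" and D: "precoalgebra D" and "kspace U" "c \<in> vecs C" "d \<in> vecs D"
    "\<And>y. y \<in> vecs (C \<Otimes> D) \<Longrightarrow> lin (C \<Otimes> D) U (\<lambda>x. g x y)"
    "\<And>x. x \<in> vecs (C \<Otimes> D) \<Longrightarrow> lin (C \<Otimes> D) U (g x)"
  shows "sw (C \<Otimes>\<^sub>c D) (c \<otimes>\<^bsub>C,D\<^esub> d) g =
    sw C c (\<lambda>c1 c2. sw D d (\<lambda>d1 d2. g (c1 \<otimes>\<^bsub>C,D\<^esub> d1) (c2 \<otimes>\<^bsub>C,D\<^esub> d2)))"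
proof -
  have [simp]: "kspace C" "kspace D" using assms by (auto simp: precoalgebra_def)
  note [simp] = assms linear_intros precoalgebra_tensor[OF C D]
  let ?CD = "C \<Otimes> D"
  have L: "lin (?CD \<Otimes> ?CD) U (tlift ?CD ?CD U g)"
    "\<And>x y. x \<in> vecs ?CD \<Longrightarrow> y \<in> vecs ?CD \<Longrightarrow> tlift ?CD ?CD U g (x \<otimes>\<^bsub>?CD,?CD\<^esub> y) = g x y"
    by (auto intro!: lin_tlift)
  have "sw (C \<Otimes>\<^sub>c D) (c \<otimes>\<^bsub>C,D\<^esub> d) g = tlift ?CD ?CD U g (comult (C \<Otimes>\<^sub>c D) (c \<otimes>\<^bsub>C,D\<^esub> d))"
    using tlift_comult_eq_sw[of "C \<Otimes>\<^sub>c D" U "c \<otimes>\<^bsub>C,D\<^esub> d" g] by (simp add: tlift_carrier)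
  also have "\<dots> = sw C c (\<lambda>c1 c2. sw D d (\<lambda>d1 d2. g (c1 \<otimes>\<^bsub>C,D\<^esub> d1) (c2 \<otimes>\<^bsub>C,D\<^esub> d2)))"
    by (simp add: comult_tens L lin_sw[OF L(1)] cong: sw_cong)
  finally show ?thesis .
qed

text \<open>
  Coassociativity in two coalgebras at once, for summands in which the four sums are interleaved as they
  are after splitting a tensor \<open>c \<otimes> d\<close>.
\<close>

lemma sw_coassoc_pair:
  assumes C: "coalgebra C" and D: "coalgebra D" and [simp]: "kspace U" "c \<in> vecs C" "d \<in> vecs D"
    and F1: "\<And>y z u v w. y \<in> vecs C \<Longrightarrow> z \<in> vecs C \<Longrightarrow> u \<in> vecs D \<Longrightarrow> v \<in> vecs D \<Longrightarrow> w \<in> vecs D \<Longrightarrow>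
      lin C U (\<lambda>x. F x y z u v w)"
    and F2: "\<And>x z u v w. x \<in> vecs C \<Longrightarrow> z \<in> vecs C \<Longrightarrow> u \<in> vecs D \<Longrightarrow> v \<in> vecs D \<Longrightarrow> w \<in> vecs D \<Longrightarrow>
      lin C U (\<lambda>y. F x y z u v w)"
    and F3: "\<And>x y u v w. x \<in> vecs C \<Longrightarrow> y \<in> vecs C \<Longrightarrow> u \<in> vecs D \<Longrightarrow> v \<in> vecs D \<Longrightarrow> w \<in> vecs D \<Longrightarrow>
      lin C U (\<lambda>z. F x y z u v w)"
    and F4: "\<And>x y z v w. x \<in> vecs C \<Longrightarrow> y \<in> vecs C \<Longrightarrow> z \<in> vecs C \<Longrightarrow> v \<in> vecs D \<Longrightarrow> w \<in> vecs D \<Longrightarrow>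
      lin D U (\<lambda>u. F x y z u v w)"
    and F5: "\<And>x y z u w. x \<in> vecs C \<Longrightarrow> y \<in> vecs C \<Longrightarrow> z \<in> vecs C \<Longrightarrow> u \<in> vecs D \<Longrightarrow> w \<in> vecs D \<Longrightarrow>
      lin D U (\<lambda>v. F x y z u v w)"
    and F6: "\<And>x y z u v. x \<in> vecs C \<Longrightarrow> y \<in> vecs C \<Longrightarrow> z \<in> vecs C \<Longrightarrow> u \<in> vecs D \<Longrightarrow> v \<in> vecs D \<Longrightarrow>
      lin D U (\<lambda>w. F x y z u v w)"
  shows "sw C c (\<lambda>x z. sw D d (\<lambda>u w. sw C x (\<lambda>x y. sw D u (\<lambda>u v. F x y z u v w))))
    = sw C c (\<lambda>x y. sw D d (\<lambda>u v. sw C y (\<lambda>y z. sw D v (\<lambda>v w. F x y z u v w))))"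
proof -
  note [simp] = coalgebraD[OF C] coalgebraD[OF D] linear_intros F1 F2 F3 F4 F5 F6
  have "sw C c (\<lambda>x z. sw D d (\<lambda>u w. sw C x (\<lambda>x y. sw D u (\<lambda>u v. F x y z u v w))))
    = sw C c (\<lambda>x z. sw C x (\<lambda>x y. sw D d (\<lambda>u w. sw D u (\<lambda>u v. F x y z u v w))))"
    by (simp only: sw_swap[of D d C])
  also have "\<dots> = sw C c (\<lambda>x y. sw C y (\<lambda>y z. sw D d (\<lambda>u v. sw D v (\<lambda>v w. F x y z u v w))))"
    by (simp add: sw_coassoc[OF C, where U=U] sw_coassoc[OF D, where U=U] cong: sw_cong)
  also have "\<dots> = sw C c (\<lambda>x y. sw D d (\<lambda>u v. sw C y (\<lambda>y z. sw D v (\<lambda>v w. F x y z u v w))))"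
    by (simp only: sw_swap[of D d C])
  finally show ?thesis .
qed

text \<open>
  Regrouping \<open>(c\<^sub>1, c\<^sub>2, c\<^sub>3, c\<^sub>4)\<close> so that the middle pair comes from a single factor. A symmetry of
  the comultiplication can then be applied to \<open>c\<^sub>2\<close> and \<open>c\<^sub>3\<close>.
\<close>

lemma sw_middle:
  assumes C: "coalgebra C" and [simp]: "kspace U" "c \<in> vecs C"
    and F1: "\<And>x y z. x \<in> vecs C \<Longrightarrow> y \<in> vecs C \<Longrightarrow> z \<in> vecs C \<Longrightarrow> lin C U (\<lambda>w. F w x y z)"
    and F2: "\<And>x y z. x \<in> vecs C \<Longrightarrow> y \<in> vecs C \<Longrightarrow> z \<in> vecs C \<Longrightarrow> lin C U (\<lambda>w. F x w y z)"
    and F3: "\<And>x y z. x \<in> vecs C \<Longrightarrow> y \<in> vecs C \<Longrightarrow> z \<in> vecs C \<Longrightarrow> lin C U (\<lambda>w. F x y w z)"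
    and F4: "\<And>x y z. x \<in> vecs C \<Longrightarrow> y \<in> vecs C \<Longrightarrow> z \<in> vecs C \<Longrightarrow> lin C U (\<lambda>w. F x y z w)"
  shows "sw C c (\<lambda>c1 c2. sw C c1 (\<lambda>x y. sw C c2 (\<lambda>z w. F x y z w)))
    = sw C c (\<lambda>x t. sw C t (\<lambda>m w. sw C m (\<lambda>y z. F x y z w)))"
proof -
  note [simp] = coalgebraD[OF C] linear_intros F1 F2 F3 F4
  show ?thesis
    by (simp add: sw_coassoc[OF C, where U=U] cong: sw_cong)
qed

text \<open>
  Instances for \<open>C \<Otimes>\<^sub>c D\<close> in which its carrier is written as that of \<open>C \<Otimes> D\<close>, the form in
  which membership is stated throughout.
\<close>

lemmas tensor_coalg_linear_intros [linear_intros] =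
  lin_sw_arg[of "C \<Otimes>\<^sub>c D" for C D, unfolded tensor_coalg_simps tensor_coalg_carrier]
  lin_sw_body[of "C \<Otimes>\<^sub>c D" for C D, unfolded tensor_coalg_simps tensor_coalg_carrier]
  sw_mem[of "C \<Otimes>\<^sub>c D" for C D, unfolded tensor_coalg_simps tensor_coalg_carrier]

lemmas sweedler_tensor_eq_sw =
  sweedler_eq_sw[of "C \<Otimes>\<^sub>c D" for C D, unfolded tensor_coalg_simps tensor_coalg_carrier]

lemmas sweedler_tensor_cong =
  sweedler_cong[of "C \<Otimes>\<^sub>c D" for C D, unfolded tensor_coalg_simps tensor_coalg_carrier]

lemma coalgebra_tensor:
  assumes C: "coalgebra C" and D: "coalgebra D"
  shows "coalgebra (C \<Otimes>\<^sub>c D)"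
proof -
  note [simp] = coalgebraD[OF C] coalgebraD[OF D] linear_intros precoalgebra_tensor
    lin_compose[OF lin_counit[OF C]] lin_compose[OF lin_counit[OF D]]
    linear_map_lin[OF linear_map_counit_tensor[OF C D]] lin_compose[OF linear_map_lin[OF linear_map_counit_tensor[OF C D]]]
    linear_map_counit_tensor linear_map_comult_tensor counit_tens C D
  let ?T = "C \<Otimes> D" let ?TT = "(C \<Otimes> D) \<Otimes> (C \<Otimes> D)" let ?TTT = "(C \<Otimes> D) \<Otimes> (C \<Otimes> D) \<Otimes> (C \<Otimes> D)"
  note co = linear_map_lin[OF linear_map_comult_tensor[OF coalgebra_precoalgebra[OF C] coalgebra_precoalgebra[OF D]]]
  note [simp] = lin_mem[OF co] lin_compose[OF co]
  show ?thesis
    unfolding coalgebra_def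
  proof (intro conjI ballI)
    fix t assume t: "t \<in> vecs (C \<Otimes>\<^sub>c D)"
    have "sw (C \<Otimes>\<^sub>c D) (c \<otimes>\<^bsub>C,D\<^esub> d) (\<lambda>x z. sw (C \<Otimes>\<^sub>c D) x (\<lambda>x y. x \<otimes>\<^bsub>?T,?TT\<^esub> (y \<otimes>\<^bsub>?T,?T\<^esub> z)))
       = sw (C \<Otimes>\<^sub>c D) (c \<otimes>\<^bsub>C,D\<^esub> d) (\<lambda>x y. x \<otimes>\<^bsub>?T,?TT\<^esub> comult (C \<Otimes>\<^sub>c D) y)"
      if [simp]: "c \<in> vecs C" "d \<in> vecs D" for c d
    proof -
      let ?F = "\<lambda>x u y v z w. (x \<otimes>\<^bsub>C,D\<^esub> u) \<otimes>\<^bsub>?T,?TT\<^esub> ((y \<otimes>\<^bsub>C,D\<^esub> v) \<otimes>\<^bsub>?T,?T\<^esub> (z \<otimes>\<^bsub>C,D\<^esub> w))"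
      have "sw (C \<Otimes>\<^sub>c D) (c \<otimes>\<^bsub>C,D\<^esub> d) (\<lambda>x z. sw (C \<Otimes>\<^sub>c D) x (\<lambda>x y. x \<otimes>\<^bsub>?T,?TT\<^esub> (y \<otimes>\<^bsub>?T,?T\<^esub> z)))
        = sw C c (\<lambda>x z. sw D d (\<lambda>u w. sw C x (\<lambda>x y. sw D u (\<lambda>u v. ?F x u y v z w))))"
        by (simp add: sw_tens[where U="?TTT"] cong: sw_cong)
      also have "\<dots> = sw C c (\<lambda>x y. sw D d (\<lambda>u v. sw C y (\<lambda>y z. sw D v (\<lambda>v w. ?F x u y v z w))))"
        by (rule sw_coassoc_pair[OF C D, where U="?TTT"]) simp_all
      also have "\<dots> = sw (C \<Otimes>\<^sub>c D) (c \<otimes>\<^bsub>C,D\<^esub> d) (\<lambda>x y. x \<otimes>\<^bsub>?T,?TT\<^esub> comult (C \<Otimes>\<^sub>c D) y)"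
        by (simp add: sw_tens[where U="?TTT"] comult_tens lin_sw[OF lin_tens_right[OF _ _ lin_id]] cong: sw_cong)
      finally show ?thesis .
    qed
    then have "sw (C \<Otimes>\<^sub>c D) t (\<lambda>x z. sw (C \<Otimes>\<^sub>c D) x (\<lambda>x y. x \<otimes>\<^bsub>?T,?TT\<^esub> (y \<otimes>\<^bsub>?T,?T\<^esub> z))) =
       sw (C \<Otimes>\<^sub>c D) t (\<lambda>x y. x \<otimes>\<^bsub>?T,?TT\<^esub> comult (C \<Otimes>\<^sub>c D) y)"
      using t by (intro lin_tensor_eq[where V=C and W=D and U="?TTT" and T=t
        and f="\<lambda>t. sw (C \<Otimes>\<^sub>c D) t (\<lambda>x z. sw (C \<Otimes>\<^sub>c D) x (\<lambda>x y. x \<otimes>\<^bsub>?T,?TT\<^esub> (y \<otimes>\<^bsub>?T,?T\<^esub> z)))"]) simp_all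
    then show "sweedler (C \<Otimes>\<^sub>c D) ((C \<Otimes>\<^sub>c D) \<Otimes> (C \<Otimes>\<^sub>c D) \<Otimes> C \<Otimes>\<^sub>c D) t
          (\<lambda>c1 c2.
              sweedler (C \<Otimes>\<^sub>c D) ((C \<Otimes>\<^sub>c D) \<Otimes> (C \<Otimes>\<^sub>c D) \<Otimes> C \<Otimes>\<^sub>c D) c1
               (\<lambda>c11 c12.
                   c11 \<otimes>\<^bsub>C \<Otimes>\<^sub>c D,(C \<Otimes>\<^sub>c D) \<Otimes> C \<Otimes>\<^sub>c D\<^esub>
                   (c12 \<otimes>\<^bsub>C \<Otimes>\<^sub>c D,C \<Otimes>\<^sub>c D\<^esub> c2))) =
         sweedler (C \<Otimes>\<^sub>c D) ((C \<Otimes>\<^sub>c D) \<Otimes> (C \<Otimes>\<^sub>c D) \<Otimes> C \<Otimes>\<^sub>c D) t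
          (\<lambda>c1 c2. c1 \<otimes>\<^bsub>C \<Otimes>\<^sub>c D,(C \<Otimes>\<^sub>c D) \<Otimes> C \<Otimes>\<^sub>c D\<^esub> comult (C \<Otimes>\<^sub>c D) c2)"
      using t by (simp add: sweedler_tensor_eq_sw cong: sweedler_tensor_cong)
  next
    fix t assume t: "t \<in> vecs (C \<Otimes>\<^sub>c D)"
    have "sw (C \<Otimes>\<^sub>c D) (c \<otimes>\<^bsub>C,D\<^esub> d) (\<lambda>c1 c2. counit (C \<Otimes>\<^sub>c D) c1 \<star>\<^bsub>?T\<^esub> c2) = c \<otimes>\<^bsub>C,D\<^esub> d"
      if [simp]: "c \<in> vecs C" "d \<in> vecs D" for c d
      by (simp add: sw_tens[where U="?T"] kspace_scale_scale[symmetric] lin_sw[OF lin_scale_vector[OF _ lin_id], symmetric]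
        sw_counit_left cong: sw_cong)
    then have "sw (C \<Otimes>\<^sub>c D) t (\<lambda>c1 c2. counit (C \<Otimes>\<^sub>c D) c1 \<star>\<^bsub>?T\<^esub> c2) = t"
      using t by (intro lin_tensor_eq[where V=C and W=D and U="?T" and T=t and g="\<lambda>t. t"
          and f="\<lambda>t. sw (C \<Otimes>\<^sub>c D) t (\<lambda>c1 c2. counit (C \<Otimes>\<^sub>c D) c1 \<star>\<^bsub>?T\<^esub> c2)"]) simp_all
    then show "sweedler (C \<Otimes>\<^sub>c D) (C \<Otimes>\<^sub>c D) t (\<lambda>c1 c2. counit (C \<Otimes>\<^sub>c D) c1 \<star>\<^bsub>C \<Otimes>\<^sub>c D\<^esub> c2) = t"
      using t by (simp add: sweedler_tensor_eq_sw cong: sweedler_tensor_cong)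
    have "sw (C \<Otimes>\<^sub>c D) (c \<otimes>\<^bsub>C,D\<^esub> d) (\<lambda>c1 c2. counit (C \<Otimes>\<^sub>c D) c2 \<star>\<^bsub>?T\<^esub> c1) = c \<otimes>\<^bsub>C,D\<^esub> d"
      if [simp]: "c \<in> vecs C" "d \<in> vecs D" for c d
      by (simp add: sw_tens[where U="?T"] kspace_scale_scale[symmetric] lin_sw[OF lin_scale_vector[OF _ lin_id], symmetric]
        sw_counit_right cong: sw_cong)
    then have "sw (C \<Otimes>\<^sub>c D) t (\<lambda>c1 c2. counit (C \<Otimes>\<^sub>c D) c2 \<star>\<^bsub>?T\<^esub> c1) = t"
      using t by (intro lin_tensor_eq[where V=C and W=D and U="?T" and T=t and g="\<lambda>t. t"
          and f="\<lambda>t. sw (C \<Otimes>\<^sub>c D) t (\<lambda>c1 c2. counit (C \<Otimes>\<^sub>c D) c2 \<star>\<^bsub>?T\<^esub> c1)"]) simp_all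
    then show "sweedler (C \<Otimes>\<^sub>c D) (C \<Otimes>\<^sub>c D) t (\<lambda>c1 c2. counit (C \<Otimes>\<^sub>c D) c2 \<star>\<^bsub>C \<Otimes>\<^sub>c D\<^esub> c1) = t"
      using t by (simp add: sweedler_tensor_eq_sw cong: sweedler_tensor_cong)
  qed simp_all
qed

lemma coalgebra_mapD:
  assumes "coalgebra_map C D f"
  shows lin_coalgebra_map: "lin C D f"
    and counit_coalgebra_map: "c \<in> vecs C \<Longrightarrow> counit D (f c) = counit C c"
  using assms by (simp_all add: coalgebra_map_def linear_map_lin)

lemma sw_scale:
  assumes "kspace U" "precoalgebra C" "c \<in> vecs C" "\<And>x y. x \<in> vecs C \<Longrightarrow> y \<in> vecs C \<Longrightarrow> f x y \<in> vecs U"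
  shows "sw C c (\<lambda>x y. k \<star>\<^bsub>U\<^esub> f x y) = k \<star>\<^bsub>U\<^esub> sw C c f"
  using lin_sw[OF lin_scale_vector[OF _ lin_id, of U k] assms(2,1,1,3,4)] assms(1) by simp

lemma
  assumes "kspace V" "kspace W" "x \<in> vecs V" "y \<in> vecs W"
  shows tens_scale_left: "(c \<star>\<^bsub>V\<^esub> x) \<otimes>\<^bsub>V,W\<^esub> y = c \<star>\<^bsub>V \<Otimes> W\<^esub> (x \<otimes>\<^bsub>V,W\<^esub> y)"
    and tens_scale_right: "x \<otimes>\<^bsub>V,W\<^esub> (c \<star>\<^bsub>W\<^esub> y) = c \<star>\<^bsub>V \<Otimes> W\<^esub> (x \<otimes>\<^bsub>V,W\<^esub> y)"
  using assms by (auto intro: lin_scale[OF lin_tens_left[OF _ _ lin_id]] lin_scale[OF lin_tens_right[OF _ _ lin_id]])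

lemma comult_eq_sw:
  assumes "precoalgebra C" "c \<in> vecs C"
  shows "comult C c = sw C c (\<lambda>x y. x \<otimes>\<^bsub>C,C\<^esub> y)"
  using cosplit(2)[OF assms] by (simp add: sw_def)

lemma lin_comult: "precoalgebra C \<Longrightarrow> lin C (C \<Otimes> C) (comult C)"
  by (simp add: precoalgebra_def)

text \<open>
  Both conditions on a coalgebra map are linear in the argument, so pure tensors suffice.
\<close>

lemma coalgebra_map_tensorI:
  assumes C: "coalgebra C" and D: "coalgebra D" and E: "coalgebra E"
    and f: "linear_map (C \<Otimes> D) E f"
    and counit: "\<And>c d. c \<in> vecs C \<Longrightarrow> d \<in> vecs D \<Longrightarrow> counit E (f (c \<otimes>\<^bsub>C,D\<^esub> d)) = counit C c * counit D d"
    and comult: "\<And>c d. c \<in> vecs C \<Longrightarrow> d \<in> vecs D \<Longrightarrow> comult E (f (c \<otimes>\<^bsub>C,D\<^esub> d)) =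
      sw C c (\<lambda>c1 c2. sw D d (\<lambda>d1 d2. f (c1 \<otimes>\<^bsub>C,D\<^esub> d1) \<otimes>\<^bsub>E,E\<^esub> f (c2 \<otimes>\<^bsub>C,D\<^esub> d2)))"
  shows "coalgebra_map (C \<Otimes>\<^sub>c D) E f"
proof (rule coalgebra_mapI)
  note L = linear_map_lin[OF f] and co = lin_comult[OF coalgebra_precoalgebra[OF E]]
  note [simp] = linear_intros coalgebraD[OF C] coalgebraD[OF D] coalgebraD[OF E] lin_compose[OF L] lin_mem[OF L]
    precoalgebra_tensor lin_compose[OF co] lin_compose[OF lin_counit[OF E]]
    linear_map_lin[OF linear_map_counit_tensor[OF C D]]
  show "linear_map (C \<Otimes>\<^sub>c D) E f" using f by simp
  show "precoalgebra (C \<Otimes>\<^sub>c D)" "kspace E" by simp_all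
  fix t assume t: "t \<in> vecs (C \<Otimes>\<^sub>c D)"
  show "counit E (f t) = counit (C \<Otimes>\<^sub>c D) t"
    using t by (intro lin_tensor_eq[where V=C and W=D and U=ground and T=t and f="\<lambda>t. counit E (f t)"])
      (simp_all add: counit_tens[OF C D] counit)
  show "comult E (f t) = sw (C \<Otimes>\<^sub>c D) t (\<lambda>x y. f x \<otimes>\<^bsub>E,E\<^esub> f y)"
    using t by (intro lin_tensor_eq[where V=C and W=D and U="E \<Otimes> E" and T=t and f="\<lambda>t. comult E (f t)"])
      (simp_all add: sw_tens[where U="E \<Otimes> E"] comult)
qed

lemma coalgebra_map_carrier_cong:
  assumes "vecs C = vecs C'" "scl C = scl C'" "comult C = comult C'" "counit C = counit C'"
  shows "coalgebra_map C D f = coalgebra_map C' D f" "coalgebra_map D C g = coalgebra_map D C' g"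
  by (simp_all add: coalgebra_map_def sweedler_def tlift_def assms carrier_cong[OF assms(1,2)])

lemma coalgebra_map_compose:
  assumes "coalgebra_map C D f" "coalgebra_map D E g" "precoalgebra C" "precoalgebra D" "precoalgebra E"
  shows "coalgebra_map C E (\<lambda>x\<in>vecs C. g (f x))"
proof (rule coalgebra_mapI)
  have k: "kspace C" "kspace D" "kspace E" using assms by (auto simp: precoalgebra_def)
  note f = lin_coalgebra_map[OF assms(1)] and g = lin_coalgebra_map[OF assms(2)]
  note [simp] = linear_intros f g k lin_mem[OF f] lin_mem[OF g] lin_compose[OF f] lin_compose[OF g] assms(3-5)
  show "linear_map C E (\<lambda>x\<in>vecs C. g (f x))" by (simp add: linear_map_restrict)
  show "precoalgebra C" "kspace E" by simp_all
  fix c assume c: "c \<in> vecs C"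
  then show "counit E ((\<lambda>x\<in>vecs C. g (f x)) c) = counit C c"
    by (simp add: counit_coalgebra_map[OF assms(1)] counit_coalgebra_map[OF assms(2)])
  show "comult E ((\<lambda>x\<in>vecs C. g (f x)) c) =
    sw C c (\<lambda>x y. (\<lambda>x\<in>vecs C. g (f x)) x \<otimes>\<^bsub>E,E\<^esub> (\<lambda>x\<in>vecs C. g (f x)) y)"
    using c by (simp add: comult_eq_sw sw_coalgebra_map[OF assms(1), where U="E \<Otimes> E"]
      sw_coalgebra_map[OF assms(2), where U="E \<Otimes> E"] cong: sw_cong)
qed

lemma coalgebra_map_id: "precoalgebra C \<Longrightarrow> coalgebra_map C C (\<lambda>x\<in>vecs C. x)"
proof (rule coalgebra_mapI)
  assume [simp]: "precoalgebra C"
  then have k: "kspace C" by (simp add: precoalgebra_def)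
  then show "linear_map C C (\<lambda>x\<in>vecs C. x)" by (simp add: linear_map_restrict lin_id)
  show "precoalgebra C" "kspace C" by (simp_all add: k)
  fix c assume [simp]: "c \<in> vecs C"
  show "counit C ((\<lambda>x\<in>vecs C. x) c) = counit C c" by simp
  show "comult C ((\<lambda>x\<in>vecs C. x) c) = sw C c (\<lambda>x y. (\<lambda>x\<in>vecs C. x) x \<otimes>\<^bsub>C,C\<^esub> (\<lambda>x\<in>vecs C. x) y)"
    by (simp add: comult_eq_sw cong: sw_cong)
qed

text \<open>
  Cocentrality is an identity in \<open>D \<Otimes> C\<close>, through which every bilinear \<open>G\<close> factors.
\<close>

lemma sw_cocentral:
  assumes r: "cocentral C D r" and C: "precoalgebra C" and [simp]: "kspace D" "kspace U" "c \<in> vecs C"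
    and G: "\<And>y. y \<in> vecs C \<Longrightarrow> lin D U (\<lambda>x. G x y)" "\<And>x. x \<in> vecs D \<Longrightarrow> lin C U (G x)"
  shows "sw C c (\<lambda>x y. G (r x) y) = sw C c (\<lambda>x y. G (r y) x)"
proof -
  have lr: "lin C D r" using r by (simp add: cocentral_def lin_coalgebra_map)
  have k: "kspace C" using C by (simp add: precoalgebra_def)
  note [simp] = linear_intros C k lin_mem[OF lr] lin_compose[OF lr] G
  have L: "lin (D \<Otimes> C) U (tlift D C U G)"
    "\<And>x y. x \<in> vecs D \<Longrightarrow> y \<in> vecs C \<Longrightarrow> tlift D C U G (x \<otimes>\<^bsub>D,C\<^esub> y) = G x y"
    by (auto intro!: lin_tlift)
  have "tlift D C U G (sw C c (\<lambda>x y. r x \<otimes>\<^bsub>D,C\<^esub> y)) = tlift D C U G (sw C c (\<lambda>x y. r y \<otimes>\<^bsub>D,C\<^esub> x))"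
    using r by (simp add: cocentral_def sweedler_eq_sw)
  then show ?thesis by (simp add: lin_sw[OF L(1)] L cong: sw_cong)
qed

lemma coalgebra_map_inverse:
  assumes f: "coalgebra_map C D f" and "precoalgebra C" "precoalgebra D" and g: "linear_map D C g"
    and gf: "\<And>x. x \<in> vecs C \<Longrightarrow> g (f x) = x" and fg: "\<And>y. y \<in> vecs D \<Longrightarrow> f (g y) = y"
  shows "coalgebra_map D C g"
proof (rule coalgebra_mapI)
  have k: "kspace C" "kspace D" using assms by (auto simp: precoalgebra_def)
  note lf = lin_coalgebra_map[OF f] and lg = linear_map_lin[OF g]
  note [simp] = linear_intros lf lg k lin_mem[OF lf] lin_mem[OF lg] lin_compose[OF lf] lin_compose[OF lg] assms(2-4) gf fg
  show "linear_map D C g" "precoalgebra D" "kspace C" by simp_all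
  fix d assume d: "d \<in> vecs D"
  then show "counit C (g d) = counit D d"
    using counit_coalgebra_map[OF f, of "g d"] by simp
  show "comult C (g d) = sw D d (\<lambda>x y. g x \<otimes>\<^bsub>C,C\<^esub> g y)"
    using d sw_coalgebra_map[OF f, of "C \<Otimes> C" "g d" "\<lambda>x y. g x \<otimes>\<^bsub>C,C\<^esub> g y", unfolded fg[OF d]]
    by (simp add: comult_eq_sw cong: sw_cong)
qed

section \<open>Convolution and the antipode\<close>

lemma algebraD:
  assumes "algebra B"
  shows algebra_kspace: "kspace B"
    and lin_mult_left: "lin V B f \<Longrightarrow> y \<in> vecs B \<Longrightarrow> lin V B (\<lambda>x. f x \<odot>\<^bsub>B\<^esub> y)"
    and lin_mult_right: "lin V B f \<Longrightarrow> y \<in> vecs B \<Longrightarrow> lin V B (\<lambda>x. y \<odot>\<^bsub>B\<^esub> f x)"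
    and mult_mem: "x \<in> vecs B \<Longrightarrow> y \<in> vecs B \<Longrightarrow> x \<odot>\<^bsub>B\<^esub> y \<in> vecs B"
    and unit_mem: "\<one>\<^bsub>B\<^esub> \<in> vecs B"
    and mult_assoc: "x \<in> vecs B \<Longrightarrow> y \<in> vecs B \<Longrightarrow> z \<in> vecs B \<Longrightarrow>
      (x \<odot>\<^bsub>B\<^esub> y) \<odot>\<^bsub>B\<^esub> z = x \<odot>\<^bsub>B\<^esub> (y \<odot>\<^bsub>B\<^esub> z)"
    and mult_unit: "x \<in> vecs B \<Longrightarrow> \<one>\<^bsub>B\<^esub> \<odot>\<^bsub>B\<^esub> x = x" "x \<in> vecs B \<Longrightarrow> x \<odot>\<^bsub>B\<^esub> \<one>\<^bsub>B\<^esub> = x"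
    and scale_mult: "x \<in> vecs B \<Longrightarrow> y \<in> vecs B \<Longrightarrow> (c \<star>\<^bsub>B\<^esub> x) \<odot>\<^bsub>B\<^esub> y = c \<star>\<^bsub>B\<^esub> (x \<odot>\<^bsub>B\<^esub> y)"
    and mult_scale: "x \<in> vecs B \<Longrightarrow> y \<in> vecs B \<Longrightarrow> x \<odot>\<^bsub>B\<^esub> (c \<star>\<^bsub>B\<^esub> y) = c \<star>\<^bsub>B\<^esub> (x \<odot>\<^bsub>B\<^esub> y)"
proof -
  have *: "kspace B" "bilinear_map B B B (mult B)" "\<one>\<^bsub>B\<^esub> \<in> vecs B"
    "\<forall>x\<in>vecs B. \<forall>y\<in>vecs B. \<forall>z\<in>vecs B. (x \<odot>\<^bsub>B\<^esub> y) \<odot>\<^bsub>B\<^esub> z = x \<odot>\<^bsub>B\<^esub> (y \<odot>\<^bsub>B\<^esub> z)"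
    "\<forall>x\<in>vecs B. \<one>\<^bsub>B\<^esub> \<odot>\<^bsub>B\<^esub> x = x \<and> x \<odot>\<^bsub>B\<^esub> \<one>\<^bsub>B\<^esub> = x"
    using assms by (simp_all add: algebra_def)
  then have left: "y \<in> vecs B \<Longrightarrow> lin B B (\<lambda>x. x \<odot>\<^bsub>B\<^esub> y)" and right: "y \<in> vecs B \<Longrightarrow> lin B B ((\<odot>\<^bsub>B\<^esub>) y)" for y
    by (auto simp: bilinear_map_iff)
  show "kspace B" "\<one>\<^bsub>B\<^esub> \<in> vecs B"
    "x \<in> vecs B \<Longrightarrow> y \<in> vecs B \<Longrightarrow> z \<in> vecs B \<Longrightarrow> (x \<odot>\<^bsub>B\<^esub> y) \<odot>\<^bsub>B\<^esub> z = x \<odot>\<^bsub>B\<^esub> (y \<odot>\<^bsub>B\<^esub> z)"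
    "x \<in> vecs B \<Longrightarrow> \<one>\<^bsub>B\<^esub> \<odot>\<^bsub>B\<^esub> x = x" "x \<in> vecs B \<Longrightarrow> x \<odot>\<^bsub>B\<^esub> \<one>\<^bsub>B\<^esub> = x"
    using * by auto
  show "lin V B f \<Longrightarrow> y \<in> vecs B \<Longrightarrow> lin V B (\<lambda>x. f x \<odot>\<^bsub>B\<^esub> y)"
    "lin V B f \<Longrightarrow> y \<in> vecs B \<Longrightarrow> lin V B (\<lambda>x. y \<odot>\<^bsub>B\<^esub> f x)"
    by (auto intro: lin_compose[OF left] lin_compose[OF right])
  show "x \<in> vecs B \<Longrightarrow> y \<in> vecs B \<Longrightarrow> x \<odot>\<^bsub>B\<^esub> y \<in> vecs B"
    "x \<in> vecs B \<Longrightarrow> y \<in> vecs B \<Longrightarrow> (c \<star>\<^bsub>B\<^esub> x) \<odot>\<^bsub>B\<^esub> y = c \<star>\<^bsub>B\<^esub> (x \<odot>\<^bsub>B\<^esub> y)"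
    "x \<in> vecs B \<Longrightarrow> y \<in> vecs B \<Longrightarrow> x \<odot>\<^bsub>B\<^esub> (c \<star>\<^bsub>B\<^esub> y) = c \<star>\<^bsub>B\<^esub> (x \<odot>\<^bsub>B\<^esub> y)"
    using lin_mem[OF left] lin_scale[OF left] lin_scale[OF right] by auto
qed

lemma bialgebraD:
  assumes "bialgebra B"
  shows bialgebra_algebra: "algebra B" and bialgebra_coalgebra: "coalgebra B"
    and counit_mult: "x \<in> vecs B \<Longrightarrow> y \<in> vecs B \<Longrightarrow> counit B (x \<odot>\<^bsub>B\<^esub> y) = counit B x * counit B y"
    and counit_unit: "counit B \<one>\<^bsub>B\<^esub> = 1"
    and comult_unit: "comult B \<one>\<^bsub>B\<^esub> = \<one>\<^bsub>B\<^esub> \<otimes>\<^bsub>B,B\<^esub> \<one>\<^bsub>B\<^esub>"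
  using assms by (simp_all add: bialgebra_def)

lemma
  assumes B: "bialgebra B" and U: "kspace U"
    and g: "\<And>y. y \<in> vecs B \<Longrightarrow> lin B U (\<lambda>x. g x y)" "\<And>x. x \<in> vecs B \<Longrightarrow> lin B U (g x)"
  shows sw_unit: "sw B \<one>\<^bsub>B\<^esub> g = g \<one>\<^bsub>B\<^esub> \<one>\<^bsub>B\<^esub>"
    and sw_mult: "x \<in> vecs B \<Longrightarrow> y \<in> vecs B \<Longrightarrow> sw B (x \<odot>\<^bsub>B\<^esub> y) g =
      sw B x (\<lambda>x1 x2. sw B y (\<lambda>y1 y2. g (x1 \<odot>\<^bsub>B\<^esub> y1) (x2 \<odot>\<^bsub>B\<^esub> y2)))"
proof -
  note alg = bialgebra_algebra[OF B] and coalg = bialgebra_coalgebra[OF B]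
  note [simp] = linear_intros coalgebraD[OF coalg] algebraD[OF alg] U g
  have L: "lin (B \<Otimes> B) U (tlift B B U g)"
    "\<And>x y. x \<in> vecs B \<Longrightarrow> y \<in> vecs B \<Longrightarrow> tlift B B U g (x \<otimes>\<^bsub>B,B\<^esub> y) = g x y"
    by (auto intro!: lin_tlift)
  show "sw B \<one>\<^bsub>B\<^esub> g = g \<one>\<^bsub>B\<^esub> \<one>\<^bsub>B\<^esub>"
    by (simp add: tlift_comult_eq_sw[where U=U, symmetric] comult_unit[OF B] L)
  assume [simp]: "x \<in> vecs B" "y \<in> vecs B"
  have "comult B (x \<odot>\<^bsub>B\<^esub> y) =
      sw B x (\<lambda>x1 x2. sw B y (\<lambda>y1 y2. (x1 \<odot>\<^bsub>B\<^esub> y1) \<otimes>\<^bsub>B,B\<^esub> (x2 \<odot>\<^bsub>B\<^esub> y2)))"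
    using B by (simp add: bialgebra_def sweedler_eq_sw cong: sweedler_cong)
  then show "sw B (x \<odot>\<^bsub>B\<^esub> y) g =
      sw B x (\<lambda>x1 x2. sw B y (\<lambda>y1 y2. g (x1 \<odot>\<^bsub>B\<^esub> y1) (x2 \<odot>\<^bsub>B\<^esub> y2)))"
    by (simp add: tlift_comult_eq_sw[where U=U, symmetric] L lin_sw[OF L(1)] cong: sw_cong)
qed

definition convolution where
  "convolution C B f g = (\<lambda>c. sw C c (\<lambda>x y. f x \<odot>\<^bsub>B\<^esub> g y))"

definition conv_unit where
  "conv_unit C B = (\<lambda>c. counit C c \<star>\<^bsub>B\<^esub> \<one>\<^bsub>B\<^esub>)"

context
  fixes C :: "('k::field, 'v::ab_group_add, 'y) coalg_scheme"
    and B :: "('k, 'w::ab_group_add, 'z) bialg_scheme"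
  assumes C: "coalgebra C" and B: "algebra B"
begin

context
  notes [simp] = linear_intros coalgebraD[OF C] algebraD[OF B] lin_compose[OF lin_counit[OF C]]
begin

lemma convolution_cong:
  "(\<And>c. c \<in> vecs C \<Longrightarrow> f c = f' c) \<Longrightarrow> (\<And>c. c \<in> vecs C \<Longrightarrow> g c = g' c) \<Longrightarrow> c \<in> vecs C \<Longrightarrow>
    convolution C B f g c = convolution C B f' g' c"
  by (simp add: convolution_def cong: sw_cong)

lemma lin_convolution:
  assumes "lin C B f" "lin C B g"
  shows "lin C B (convolution C B f g)"
proof -
  note [simp] = lin_compose[OF assms(1)] lin_compose[OF assms(2)] lin_mem[OF assms(1)] lin_mem[OF assms(2)]
  show ?thesis by (simp add: convolution_def)
qed

lemma convolution_assoc: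
  assumes "lin C B f" "lin C B g" "lin C B h" "c \<in> vecs C"
  shows "convolution C B (convolution C B f g) h c = convolution C B f (convolution C B g h) c"
proof -
  note [simp] = lin_compose[OF assms(1)] lin_compose[OF assms(2)] lin_compose[OF assms(3)]
    lin_mem[OF assms(1)] lin_mem[OF assms(2)] lin_mem[OF assms(3)] assms(4)
  have "convolution C B (convolution C B f g) h c = sw C c (\<lambda>x z. sw C x (\<lambda>x y. f x \<odot>\<^bsub>B\<^esub> (g y \<odot>\<^bsub>B\<^esub> h z)))"
    by (simp add: convolution_def lin_sw[OF lin_mult_left[OF B lin_id]] mult_assoc[OF B] cong: sw_cong)
  also have "\<dots> = sw C c (\<lambda>x y. sw C y (\<lambda>y z. f x \<odot>\<^bsub>B\<^esub> (g y \<odot>\<^bsub>B\<^esub> h z)))"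
    by (rule sw_coassoc[OF C, where U=B]) simp_all
  also have "\<dots> = convolution C B f (convolution C B g h) c"
    by (simp add: convolution_def lin_sw[OF lin_mult_right[OF B lin_id]] cong: sw_cong)
  finally show ?thesis .
qed

lemma convolution_unit:
  assumes "lin C B f" "c \<in> vecs C"
  shows "convolution C B (conv_unit C B) f c = f c" "convolution C B f (conv_unit C B) c = f c"
proof -
  note [simp] = lin_compose[OF assms(1)] lin_mem[OF assms(1)] assms
  show "convolution C B (conv_unit C B) f c = f c" "convolution C B f (conv_unit C B) c = f c"
    by (simp_all add: convolution_def conv_unit_def scale_mult[OF B] mult_scale[OF B] mult_unit[OF B]
      sw_counit_left[OF C] sw_counit_right[OF C] cong: sw_cong)
qed

text \<open>
  Right multiplication by a convolution inverse solves the equation \<open>f * g = k\<close> for \<open>f\<close>. It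
  yields the uniqueness of the antipode, and it converts the two
  forms of the condition on the left actions into each other.
\<close>

lemma convolution_cancel:
  assumes "lin C B f" "lin C B g" "lin C B h" "c \<in> vecs C"
    and "\<And>c. c \<in> vecs C \<Longrightarrow> convolution C B g h c = conv_unit C B c"
  shows "convolution C B (convolution C B f g) h c = f c"
proof -
  have "convolution C B (convolution C B f g) h c = convolution C B f (conv_unit C B) c"
    using assms by (simp add: convolution_assoc assms cong: convolution_cong)
  then show ?thesis by (simp add: convolution_unit assms)
qed

lemma convolution_inverse_unique:
  assumes "lin C B f" "lin C B g" "lin C B h" "c \<in> vecs C"
    and fg: "\<And>c. c \<in> vecs C \<Longrightarrow> convolution C B f g c = conv_unit C B c"
    and gh: "\<And>c. c \<in> vecs C \<Longrightarrow> convolution C B g h c = conv_unit C B c"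
  shows "f c = h c"
proof -
  have "f c = convolution C B (convolution C B f g) h c"
    using convolution_cancel[OF assms(1-4) gh] by simp
  also have "\<dots> = convolution C B (conv_unit C B) h c"
    using assms by (simp cong: convolution_cong)
  finally show ?thesis by (simp add: convolution_unit assms)
qed

end
end

text \<open>
  The definite description in \<open>antipode\<close> is meaningful since antipodes are convolution inverses of the
  identity, and linear maps are extensional.
\<close>

lemma is_antipode_antipode:
  assumes "hopf_algebra B"
  shows "is_antipode B (antipode B)"
proof -
  have B: "bialgebra B" using assms by (simp add: hopf_algebra_def)
  note alg = bialgebra_algebra[OF B] and coalg = bialgebra_coalgebra[OF B]
  note [simp] = linear_intros coalgebraD[OF coalg] algebraD[OF alg]
  have conv: "convolution B B S (\<lambda>x. x) c = conv_unit B B c" "convolution B B (\<lambda>x. x) S c = conv_unit B B c"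
    if S: "is_antipode B S" and c: "c \<in> vecs B" for S c
  proof -
    have L: "lin B B S" using S by (simp add: is_antipode_def linear_map_lin)
    note [simp] = lin_compose[OF L] lin_mem[OF L] c
    show "convolution B B S (\<lambda>x. x) c = conv_unit B B c" "convolution B B (\<lambda>x. x) S c = conv_unit B B c"
      using S by (simp_all add: is_antipode_def sweedler_eq_sw convolution_def conv_unit_def)
  qed
  obtain S where S: "is_antipode B S" using assms by (auto simp: hopf_algebra_def)
  have "S' = S" if S': "is_antipode B S'" for S'
  proof (rule linear_map_ext[of B B])
    show L: "linear_map B B S'" "linear_map B B S" using S S' by (auto simp: is_antipode_def)
    show "S' x = S x" if "x \<in> vecs B" for x
      using convolution_inverse_unique[OF coalg alg linear_map_lin[OF L(1)] lin_id linear_map_lin[OF L(2)] that]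
        conv S S' by simp
  qed
  with S show ?thesis unfolding antipode_def by (metis theI)
qed

lemma
  assumes "hopf_algebra B"
  shows lin_antipode: "lin B B (antipode B)"
    and antipode_left: "x \<in> vecs B \<Longrightarrow> sw B x (\<lambda>x1 x2. antipode B x1 \<odot>\<^bsub>B\<^esub> x2) = counit B x \<star>\<^bsub>B\<^esub> \<one>\<^bsub>B\<^esub>"
    and antipode_right: "x \<in> vecs B \<Longrightarrow> sw B x (\<lambda>x1 x2. x1 \<odot>\<^bsub>B\<^esub> antipode B x2) = counit B x \<star>\<^bsub>B\<^esub> \<one>\<^bsub>B\<^esub>"
proof -
  note S = is_antipode_antipode[OF assms]
  show L: "lin B B (antipode B)" using S by (simp add: is_antipode_def linear_map_lin)
  have B: "bialgebra B" using assms by (simp add: hopf_algebra_def)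
  note alg = bialgebra_algebra[OF B] and coalg = bialgebra_coalgebra[OF B]
  note [simp] = linear_intros coalgebraD[OF coalg] algebraD[OF alg] lin_compose[OF L] lin_mem[OF L]
  show "x \<in> vecs B \<Longrightarrow> sw B x (\<lambda>x1 x2. antipode B x1 \<odot>\<^bsub>B\<^esub> x2) = counit B x \<star>\<^bsub>B\<^esub> \<one>\<^bsub>B\<^esub>"
    "x \<in> vecs B \<Longrightarrow> sw B x (\<lambda>x1 x2. x1 \<odot>\<^bsub>B\<^esub> antipode B x2) = counit B x \<star>\<^bsub>B\<^esub> \<one>\<^bsub>B\<^esub>"
    using S by (simp_all add: is_antipode_def sweedler_eq_sw)
qed

text \<open>
  Pulling the antipode axioms back along a coalgebra map \<open>f\<close> makes \<open>S \<circ> f\<close> a two-sided convolution inverse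
  of \<open>f\<close>.
\<close>

lemma
  assumes C: "coalgebra C" and B: "hopf_algebra B" and f: "coalgebra_map C B f" and c: "c \<in> vecs C"
  shows convolution_antipode_left: "convolution C B (\<lambda>x. antipode B (f x)) f c = conv_unit C B c"
    and convolution_antipode_right: "convolution C B f (\<lambda>x. antipode B (f x)) c = conv_unit C B c"
proof -
  have "bialgebra B" using B by (simp add: hopf_algebra_def)
  note alg = bialgebra_algebra[OF this] and coalg = bialgebra_coalgebra[OF this]
  note L = lin_coalgebra_map[OF f] and S = lin_antipode[OF B]
  note [simp] = linear_intros coalgebraD[OF coalg] coalgebraD[OF C] algebraD[OF alg] lin_compose[OF L] lin_mem[OF L]
    lin_compose[OF S] lin_mem[OF S] c
  show "convolution C B (\<lambda>x. antipode B (f x)) f c = conv_unit C B c"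
    using sw_coalgebra_map[OF f _ _ _ c, of B "\<lambda>x y. antipode B x \<odot>\<^bsub>B\<^esub> y"] antipode_left[OF B, of "f c"]
    by (simp add: convolution_def conv_unit_def counit_coalgebra_map[OF f])
  show "convolution C B f (\<lambda>x. antipode B (f x)) c = conv_unit C B c"
    using sw_coalgebra_map[OF f _ _ _ c, of B "\<lambda>x y. x \<odot>\<^bsub>B\<^esub> antipode B y"] antipode_right[OF B, of "f c"]
    by (simp add: convolution_def conv_unit_def counit_coalgebra_map[OF f])
qed

section \<open>Matched pairs and bicrossed products\<close>

locale hopf_algebra_pair = hopf_pair A H
  for A :: "('k::field, 'a::ab_group_add) bialg" and H :: "('k, 'h::ab_group_add) bialg" +
  assumes A: "hopf_algebra A" and H: "hopf_algebra H"
begin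

lemma bialgebras: "bialgebra A" "bialgebra H"
  using A H by (simp_all add: hopf_algebra_def)

lemmas algebras = bialgebras[THEN bialgebra_algebra]
lemmas coalgebras = bialgebras[THEN bialgebra_coalgebra]

lemmas [simp] = coalgebras precoalgebra_tensor
lemmas [simp] = coalgebras[THEN coalgebra_kspace] coalgebras[THEN coalgebra_precoalgebra]
lemmas [simp] = algebras[THEN mult_mem] algebras[THEN unit_mem]
lemmas [simp] = algebras[THEN mult_unit(1)] algebras[THEN mult_unit(2)]
lemmas [simp] = bialgebras[THEN counit_unit]
lemmas [simp] = linear_intros
lemmas [simp] = algebras[THEN lin_mult_left] algebras[THEN lin_mult_right]
  algebras[THEN scale_mult] algebras[THEN mult_scale]
lemmas [simp] = lin_compose[OF coalgebras(1)[THEN lin_counit]] lin_compose[OF coalgebras(2)[THEN lin_counit]]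
  lin_compose[OF lin_antipode[OF A]] lin_mem[OF lin_antipode[OF A]]
lemmas [simp] = tens_scale_left tens_scale_right sw_scale
lemmas [simp] = coalgebras[THEN sw_counit_left] coalgebras[THEN sw_counit_right]

text \<open>
  With the trivial actions every axiom collapses to counit laws. The trivial object is thus an object of
  the category, and \<open>H\<^sup>2\<close> is pointed.
\<close>

lemma matched_pair_trivial: "matched_pair trivial_object"
proof -
  have [simp]: "h \<in> vecs H \<Longrightarrow> a \<in> vecs A \<Longrightarrow> h \<triangleleft>\<^bsub>trivial_object\<^esub> a = counit A a \<star>\<^bsub>H\<^esub> h"
    "h \<in> vecs H \<Longrightarrow> a \<in> vecs A \<Longrightarrow> h \<triangleright>\<^bsub>trivial_object\<^esub> a = counit H h \<star>\<^bsub>A\<^esub> a" for h a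
    by (simp_all add: trivial_object_def tlift_tens bilinear_map_iff)
  have L: "linear_map (H \<Otimes> A) H (fst trivial_object)" "linear_map (H \<Otimes> A) A (snd trivial_object)"
    by (simp_all add: trivial_object_def linear_map_tlift bilinear_map_iff)
  note [simp] = L[THEN linear_map_lin, THEN lin_scale] L[THEN linear_map_lin, THEN lin_compose]
    L[THEN linear_map_lin, THEN lin_mem] kspace_scale_scale[symmetric] kspace_scale_one
    lin_scale[OF lin_comult] lin_mem[OF lin_comult] bialgebras[THEN counit_mult]
    coalgebras(1)[THEN lin_counit, THEN lin_scale] coalgebras(2)[THEN lin_counit, THEN lin_scale]
  have "coalgebra_map (H \<Otimes>\<^sub>c A) H (fst trivial_object)" "coalgebra_map (H \<Otimes>\<^sub>c A) A (snd trivial_object)"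
    by (rule coalgebra_map_tensorI; simp add: L comult_eq_sw[symmetric] cong: sw_cong)+
  moreover have "counit H g \<star>\<^bsub>A\<^esub> counit H h \<star>\<^bsub>A\<^esub> a = counit H h \<star>\<^bsub>A\<^esub> counit H g \<star>\<^bsub>A\<^esub> a" for g h a
    by (simp add: kspace_scale_scale mult.commute del: kspace_scale_scale[symmetric])
  ultimately show ?thesis
    by (simp add: matched_pair_def sweedler_eq_sw cong: sweedler_cong sw_cong)
qed

lemma bicrossed_simps [simp]:
  "vecs (bicrossed X) = vecs (A \<Otimes> H)" "scl (bicrossed X) = scl (A \<Otimes> H)"
  "comult (bicrossed X) = comult (A \<Otimes>\<^sub>c H)" "counit (bicrossed X) = counit (A \<Otimes>\<^sub>c H)"
  "\<one>\<^bsub>bicrossed X\<^esub> = \<one>\<^bsub>A\<^esub> \<otimes>\<^bsub>A,H\<^esub> \<one>\<^bsub>H\<^esub>"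
  by (simp_all add: bicrossed_def)

lemmas bicrossed_carrier [simp] = carrier_cong[OF bicrossed_simps(1,2)]

text \<open>
  All bicrossed products share the unit and the coalgebra structure of \<open>A \<Otimes>\<^sub>c H\<close>; only the multiplication
  depends on the actions.
\<close>

lemma hopf_map_bicrossed:
  "hopf_map (bicrossed X) (bicrossed Y) \<psi> \<longleftrightarrow> coalgebra_map (A \<Otimes>\<^sub>c H) (A \<Otimes>\<^sub>c H) \<psi> \<and>
    \<psi> (\<one>\<^bsub>A\<^esub> \<otimes>\<^bsub>A,H\<^esub> \<one>\<^bsub>H\<^esub>) = \<one>\<^bsub>A\<^esub> \<otimes>\<^bsub>A,H\<^esub> \<one>\<^bsub>H\<^esub> \<and>
    (\<forall>x\<in>vecs (A \<Otimes> H). \<forall>y\<in>vecs (A \<Otimes> H). \<psi> (x \<odot>\<^bsub>bicrossed X\<^esub> y) = \<psi> x \<odot>\<^bsub>bicrossed Y\<^esub> \<psi> y)"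
  using coalgebra_map_carrier_cong(1)[of "bicrossed X" "A \<Otimes>\<^sub>c H" "bicrossed Y" \<psi>]
    coalgebra_map_carrier_cong(2)[of "bicrossed Y" "A \<Otimes>\<^sub>c H" "A \<Otimes>\<^sub>c H" \<psi>]
  by (simp add: hopf_map_def)

context
  fixes X
  assumes X: "matched_pair X"
begin

lemma coalgebra_map_actions:
  "coalgebra_map (H \<Otimes>\<^sub>c A) H (fst X)" "coalgebra_map (H \<Otimes>\<^sub>c A) A (snd X)"
  using X by (simp_all add: matched_pair_def)

lemma lin_actions: "lin (H \<Otimes> A) H (fst X)" "lin (H \<Otimes> A) A (snd X)"
  using coalgebra_map_actions[THEN lin_coalgebra_map] by simp_all

lemmas action_rules = lin_actions[THEN lin_compose] lin_actions[THEN lin_mem] lin_actions[THEN lin_scale]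

lemma counit_actions:
  assumes "h \<in> vecs H" "a \<in> vecs A"
  shows "counit H (h \<triangleleft>\<^bsub>X\<^esub> a) = counit H h * counit A a" "counit A (h \<triangleright>\<^bsub>X\<^esub> a) = counit H h * counit A a"
  using coalgebra_map_actions[THEN counit_coalgebra_map, of "h \<otimes>\<^bsub>H,A\<^esub> a"] assms by (simp_all add: counit_tens)

lemma sw_ract:
  assumes [simp]: "kspace U" "h \<in> vecs H" "a \<in> vecs A"
    and g: "\<And>y. y \<in> vecs H \<Longrightarrow> lin H U (\<lambda>x. g x y)" "\<And>x. x \<in> vecs H \<Longrightarrow> lin H U (g x)"
  shows "sw H (h \<triangleleft>\<^bsub>X\<^esub> a) g = sw H h (\<lambda>h1 h2. sw A a (\<lambda>a1 a2. g (h1 \<triangleleft>\<^bsub>X\<^esub> a1) (h2 \<triangleleft>\<^bsub>X\<^esub> a2)))"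
proof -
  note [simp] = action_rules lin_compose[OF g(1)] lin_compose[OF g(2)]
  show ?thesis
    using sw_coalgebra_map[OF coalgebra_map_actions(1) _ _ _ _ g, of "h \<otimes>\<^bsub>H,A\<^esub> a"]
    by (simp add: sw_tens[where U=U])
qed

lemma action_units:
  "a \<in> vecs A \<Longrightarrow> \<one>\<^bsub>H\<^esub> \<triangleright>\<^bsub>X\<^esub> a = a" "h \<in> vecs H \<Longrightarrow> h \<triangleleft>\<^bsub>X\<^esub> \<one>\<^bsub>A\<^esub> = h"
  "h \<in> vecs H \<Longrightarrow> h \<triangleright>\<^bsub>X\<^esub> \<one>\<^bsub>A\<^esub> = counit H h \<star>\<^bsub>A\<^esub> \<one>\<^bsub>A\<^esub>"
  "a \<in> vecs A \<Longrightarrow> \<one>\<^bsub>H\<^esub> \<triangleleft>\<^bsub>X\<^esub> a = counit A a \<star>\<^bsub>H\<^esub> \<one>\<^bsub>H\<^esub>"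
  using X by (simp_all add: matched_pair_def)

lemma ract_ract:
  "h \<in> vecs H \<Longrightarrow> a \<in> vecs A \<Longrightarrow> b \<in> vecs A \<Longrightarrow> h \<triangleleft>\<^bsub>X\<^esub> (a \<odot>\<^bsub>A\<^esub> b) = (h \<triangleleft>\<^bsub>X\<^esub> a) \<triangleleft>\<^bsub>X\<^esub> b"
  using X by (simp add: matched_pair_def)

lemma lact_mult:
  assumes [simp]: "g \<in> vecs H" "a \<in> vecs A" "b \<in> vecs A"
  shows "g \<triangleright>\<^bsub>X\<^esub> (a \<odot>\<^bsub>A\<^esub> b) = sw H g (\<lambda>g1 g2. sw A a (\<lambda>a1 a2.
    (g1 \<triangleright>\<^bsub>X\<^esub> a1) \<odot>\<^bsub>A\<^esub> ((g2 \<triangleleft>\<^bsub>X\<^esub> a2) \<triangleright>\<^bsub>X\<^esub> b)))"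
proof -
  note [simp] = action_rules
  show ?thesis using X by (simp add: matched_pair_def sweedler_eq_sw cong: sweedler_cong)
qed

lemma
  shows lin_bicrossed_left: "y \<in> vecs (A \<Otimes> H) \<Longrightarrow> lin V (A \<Otimes> H) f \<Longrightarrow> lin V (A \<Otimes> H) (\<lambda>x. f x \<odot>\<^bsub>bicrossed X\<^esub> y)"
    and lin_bicrossed_right: "x \<in> vecs (A \<Otimes> H) \<Longrightarrow> lin V (A \<Otimes> H) f \<Longrightarrow> lin V (A \<Otimes> H) (\<lambda>y. x \<odot>\<^bsub>bicrossed X\<^esub> f y)"
    and bicrossed_mult_mem: "x \<in> vecs (A \<Otimes> H) \<Longrightarrow> y \<in> vecs (A \<Otimes> H) \<Longrightarrow> x \<odot>\<^bsub>bicrossed X\<^esub> y \<in> vecs (A \<Otimes> H)"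
    and bicrossed_mult: "a \<in> vecs A \<Longrightarrow> h \<in> vecs H \<Longrightarrow> c \<in> vecs A \<Longrightarrow> g \<in> vecs H \<Longrightarrow>
      (a \<otimes>\<^bsub>A,H\<^esub> h) \<odot>\<^bsub>bicrossed X\<^esub> (c \<otimes>\<^bsub>A,H\<^esub> g) = sw H h (\<lambda>h1 h2. sw A c (\<lambda>c1 c2.
        (a \<odot>\<^bsub>A\<^esub> (h1 \<triangleright>\<^bsub>X\<^esub> c1)) \<otimes>\<^bsub>A,H\<^esub> ((h2 \<triangleleft>\<^bsub>X\<^esub> c2) \<odot>\<^bsub>H\<^esub> g)))"
proof -
  note [simp] = action_rules
  define \<mu> where "\<mu> = (\<lambda>a h c g. sw H h (\<lambda>h1 h2. sw A c (\<lambda>c1 c2.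
        (a \<odot>\<^bsub>A\<^esub> (h1 \<triangleright>\<^bsub>X\<^esub> c1)) \<otimes>\<^bsub>A,H\<^esub> ((h2 \<triangleleft>\<^bsub>X\<^esub> c2) \<odot>\<^bsub>H\<^esub> g))))"
  define M where "M = (\<lambda>a h. tlift A H (A \<Otimes> H) (\<mu> a h))"
  have \<mu>: "h \<in> vecs H \<Longrightarrow> c \<in> vecs A \<Longrightarrow> g \<in> vecs H \<Longrightarrow> lin A (A \<Otimes> H) (\<lambda>a. \<mu> a h c g)"
    "a \<in> vecs A \<Longrightarrow> c \<in> vecs A \<Longrightarrow> g \<in> vecs H \<Longrightarrow> lin H (A \<Otimes> H) (\<lambda>h. \<mu> a h c g)"
    "a \<in> vecs A \<Longrightarrow> h \<in> vecs H \<Longrightarrow> g \<in> vecs H \<Longrightarrow> lin A (A \<Otimes> H) (\<lambda>c. \<mu> a h c g)"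
    "a \<in> vecs A \<Longrightarrow> h \<in> vecs H \<Longrightarrow> c \<in> vecs A \<Longrightarrow> lin H (A \<Otimes> H) (\<lambda>g. \<mu> a h c g)" for a h c g
    by (simp_all add: \<mu>_def)
  have M: "lin (A \<Otimes> H) (A \<Otimes> H) (M a h)"
    "\<And>c g. c \<in> vecs A \<Longrightarrow> g \<in> vecs H \<Longrightarrow> M a h (c \<otimes>\<^bsub>A,H\<^esub> g) = \<mu> a h c g"
    if "a \<in> vecs A" "h \<in> vecs H" for a h
    unfolding M_def using \<mu> that by (simp_all add: lin_tlift)
  have M': "h \<in> vecs H \<Longrightarrow> lin A (A \<Otimes> H) (\<lambda>a. M a h t)" "a \<in> vecs A \<Longrightarrow> lin H (A \<Otimes> H) (\<lambda>h. M a h t)"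
    if "t \<in> vecs (A \<Otimes> H)" for a h t
    unfolding M_def using that \<mu> by (simp_all add: lin_tlift_body)
  have mult: "x \<odot>\<^bsub>bicrossed X\<^esub> y = tlift A H (A \<Otimes> H) (\<lambda>a h. M a h y) x" for x y
    by (simp add: bicrossed_def M_def \<mu>_def sweedler_eq_sw cong: tlift_cong sweedler_cong)
  have left: "lin (A \<Otimes> H) (A \<Otimes> H) (\<lambda>x. x \<odot>\<^bsub>bicrossed X\<^esub> y)" if "y \<in> vecs (A \<Otimes> H)" for y
    unfolding mult using that M' by (simp add: lin_tlift)
  have right: "lin (A \<Otimes> H) (A \<Otimes> H) (\<lambda>y. x \<odot>\<^bsub>bicrossed X\<^esub> y)" if "x \<in> vecs (A \<Otimes> H)" for x
    unfolding mult using that M M' by (simp add: lin_tlift_body)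
  show "y \<in> vecs (A \<Otimes> H) \<Longrightarrow> lin V (A \<Otimes> H) f \<Longrightarrow> lin V (A \<Otimes> H) (\<lambda>x. f x \<odot>\<^bsub>bicrossed X\<^esub> y)"
    "x \<in> vecs (A \<Otimes> H) \<Longrightarrow> lin V (A \<Otimes> H) f \<Longrightarrow> lin V (A \<Otimes> H) (\<lambda>y. x \<odot>\<^bsub>bicrossed X\<^esub> f y)"
    "x \<in> vecs (A \<Otimes> H) \<Longrightarrow> y \<in> vecs (A \<Otimes> H) \<Longrightarrow> x \<odot>\<^bsub>bicrossed X\<^esub> y \<in> vecs (A \<Otimes> H)"
    using lin_compose[OF left] lin_compose[OF right] lin_mem[OF left] by auto
  show "(a \<otimes>\<^bsub>A,H\<^esub> h) \<odot>\<^bsub>bicrossed X\<^esub> (c \<otimes>\<^bsub>A,H\<^esub> g) = sw H h (\<lambda>h1 h2. sw A c (\<lambda>c1 c2.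
        (a \<odot>\<^bsub>A\<^esub> (h1 \<triangleright>\<^bsub>X\<^esub> c1)) \<otimes>\<^bsub>A,H\<^esub> ((h2 \<triangleleft>\<^bsub>X\<^esub> c2) \<odot>\<^bsub>H\<^esub> g)))"
    if "a \<in> vecs A" "h \<in> vecs H" "c \<in> vecs A" "g \<in> vecs H"
    unfolding mult using that M M' \<mu> by (simp add: lin_tlift \<mu>_def)
qed

end

section \<open>The twist by a pair of maps\<close>

text \<open>
  The map \<open>a \<bowtie> h \<mapsto> a r(h\<^sub>1) \<bowtie> v(h\<^sub>2)\<close>, the general form of a stabilizing morphism.
\<close>

definition twist :: "('h \<Rightarrow> 'a) \<Rightarrow> ('h \<Rightarrow> 'h) \<Rightarrow> ('a, 'h, 'k) tensor \<Rightarrow> ('a, 'h, 'k) tensor" where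
  "twist r v = tlift A H (A \<Otimes> H) (\<lambda>a h. sw H h (\<lambda>h1 h2. (a \<odot>\<^bsub>A\<^esub> r h1) \<otimes>\<^bsub>A,H\<^esub> v h2))"

lemma
  assumes r: "lin H A r" and v: "lin H H v"
  shows linear_map_twist: "linear_map (A \<Otimes> H) (A \<Otimes> H) (twist r v)"
    and twist_tens: "a \<in> vecs A \<Longrightarrow> h \<in> vecs H \<Longrightarrow>
      twist r v (a \<otimes>\<^bsub>A,H\<^esub> h) = sw H h (\<lambda>h1 h2. (a \<odot>\<^bsub>A\<^esub> r h1) \<otimes>\<^bsub>A,H\<^esub> v h2)"
proof -
  note [simp] = r[THEN lin_compose] v[THEN lin_compose] r[THEN lin_mem] v[THEN lin_mem]
  show "linear_map (A \<Otimes> H) (A \<Otimes> H) (twist r v)"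
    "a \<in> vecs A \<Longrightarrow> h \<in> vecs H \<Longrightarrow>
      twist r v (a \<otimes>\<^bsub>A,H\<^esub> h) = sw H h (\<lambda>h1 h2. (a \<odot>\<^bsub>A\<^esub> r h1) \<otimes>\<^bsub>A,H\<^esub> v h2)"
    by (simp_all add: twist_def linear_map_tlift tlift_tens bilinear_map_iff)
qed

text \<open>
  The composite sends \<open>a \<otimes> h\<close> to \<open>a r'(h\<^sub>1) r(v'(h\<^sub>2)) \<otimes> v(v'(h\<^sub>3))\<close>, so the factors in \<open>A\<close> cancel as soon as \<open>r'\<close>
  and \<open>r \<circ> v'\<close> are convolution inverse. Used twice, this inverts \<open>twist r v\<close> on both sides.
\<close>

lemma twist_twist:
  assumes r: "lin H A r" and v: "lin H H v" and r': "lin H A r'" and v': "coalgebra_map H H v'"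
    and inv: "\<And>h. h \<in> vecs H \<Longrightarrow> convolution H A r' (\<lambda>h. r (v' h)) h = conv_unit H A h"
    and vv': "\<And>h. h \<in> vecs H \<Longrightarrow> v (v' h) = h"
    and t: "t \<in> vecs (A \<Otimes> H)"
  shows "twist r v (twist r' v' t) = t"
proof -
  note lv' = lin_coalgebra_map[OF v']
  note tw = linear_map_lin[OF linear_map_twist[OF r v]] linear_map_lin[OF linear_map_twist[OF r' lv']]
  note [simp] = r[THEN lin_compose] v[THEN lin_compose] r[THEN lin_mem] v[THEN lin_mem]
    r'[THEN lin_compose] lv'[THEN lin_compose] r'[THEN lin_mem] lv'[THEN lin_mem] vv'
    tw[THEN lin_compose] tw[THEN lin_mem]
  have "twist r v (twist r' v' (a \<otimes>\<^bsub>A,H\<^esub> h)) = a \<otimes>\<^bsub>A,H\<^esub> h" if [simp]: "a \<in> vecs A" "h \<in> vecs H" for a h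
  proof -
    have "twist r v (twist r' v' (a \<otimes>\<^bsub>A,H\<^esub> h)) =
      sw H h (\<lambda>h1 h2. sw H h2 (\<lambda>h2 h3. ((a \<odot>\<^bsub>A\<^esub> r' h1) \<odot>\<^bsub>A\<^esub> r (v' h2)) \<otimes>\<^bsub>A,H\<^esub> h3))"
      by (simp add: twist_tens[OF r' lv'] twist_tens[OF r v] lin_sw[OF tw(1)]
        sw_coalgebra_map[OF v', where U="A \<Otimes> H"] cong: sw_cong)
    also have "\<dots> = sw H h (\<lambda>m h3. sw H m (\<lambda>h1 h2. ((a \<odot>\<^bsub>A\<^esub> r' h1) \<odot>\<^bsub>A\<^esub> r (v' h2)) \<otimes>\<^bsub>A,H\<^esub> h3))"
      by (rule sw_coassoc[symmetric, where U="A \<Otimes> H"]) simp_all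
    also have "\<dots> = sw H h (\<lambda>m h3. (a \<odot>\<^bsub>A\<^esub> convolution H A r' (\<lambda>h. r (v' h)) m) \<otimes>\<^bsub>A,H\<^esub> h3)"
      by (simp add: convolution_def lin_sw[OF lin_tens_left[OF _ _ lin_id]] lin_sw[OF lin_mult_right[OF algebras(1) lin_id]]
         mult_assoc[OF algebras(1)] cong: sw_cong)
    also have "\<dots> = a \<otimes>\<^bsub>A,H\<^esub> h"
      by (simp add: inv conv_unit_def cong: sw_cong)
    finally show ?thesis .
  qed
  then show ?thesis
    using t by (intro lin_tensor_eq[where V=A and W=H and U="A \<Otimes> H" and T=t and g="\<lambda>t. t"
          and f="\<lambda>t. twist r v (twist r' v' t)"]) simp_all
qed

text \<open>
  For \<open>\<psi> = twist r v\<close> the tensor \<open>\<Delta>(\<psi>(a \<otimes> h))\<close> contains \<open>r(h\<^sub>1), r(h\<^sub>2)\<close> and \<open>v(h\<^sub>3), v(h\<^sub>4)\<close>, whereas \<open>(\<psi> \<otimes> \<psi>)(\<Delta>(a \<otimes> h))\<close> contains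
  \<open>r(h\<^sub>1), r(h\<^sub>3)\<close> and \<open>v(h\<^sub>2), v(h\<^sub>4)\<close>. Cocentrality exchanges \<open>h\<^sub>2\<close> and \<open>h\<^sub>3\<close>.
\<close>

lemma coalgebra_map_twist:
  assumes r: "cocentral H A r" and v: "coalgebra_map H H v"
  shows "coalgebra_map (A \<Otimes>\<^sub>c H) (A \<Otimes>\<^sub>c H) (twist r v)"
proof (rule coalgebra_map_tensorI)
  have cr: "coalgebra_map H A r" using r by (simp add: cocentral_def)
  note lr = lin_coalgebra_map[OF cr] and lv = lin_coalgebra_map[OF v]
  note tw = linear_map_lin[OF linear_map_twist[OF lr lv]]
  note [simp] = lr[THEN lin_compose] lv[THEN lin_compose] lr[THEN lin_mem] lv[THEN lin_mem] tw[THEN lin_compose] tw[THEN lin_mem]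
  show "coalgebra A" "coalgebra H" "coalgebra (A \<Otimes>\<^sub>c H)" by (simp_all add: coalgebra_tensor)
  show "linear_map (A \<Otimes> H) (A \<Otimes>\<^sub>c H) (twist r v)" by (simp add: linear_map_twist[OF lr lv])
  note counitL = linear_map_lin[OF linear_map_counit_tensor[OF coalgebras]]
  have comultL: "lin (A \<Otimes> H) ((A \<Otimes> H) \<Otimes> (A \<Otimes> H)) (comult (A \<Otimes>\<^sub>c H))"
    by (simp add: linear_map_comult_tensor linear_map_lin)
  fix a h assume [simp]: "a \<in> vecs A" "h \<in> vecs H"
  have "counit (A \<Otimes>\<^sub>c H) (twist r v (a \<otimes>\<^bsub>A,H\<^esub> h)) = sw H h (\<lambda>h1 h2. counit A a \<star>\<^bsub>ground\<^esub> (counit H h1 \<star>\<^bsub>ground\<^esub> counit H h2))"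
    by (simp add: twist_tens[OF lr lv] lin_sw[OF counitL] counit_tens counit_mult bialgebras counit_coalgebra_map[OF cr]
      counit_coalgebra_map[OF v] mult.assoc cong: sw_cong)
  also have "\<dots> = counit A a * counit H h"
    by (simp del: ground_simps(2) add: coalgebras[THEN lin_counit]) simp
  finally show "counit (A \<Otimes>\<^sub>c H) (twist r v (a \<otimes>\<^bsub>A,H\<^esub> h)) = counit A a * counit H h" .
  let ?T = "A \<Otimes> H"
  let ?F = "\<lambda>a1 a2 x y z w. ((a1 \<odot>\<^bsub>A\<^esub> r x) \<otimes>\<^bsub>A,H\<^esub> v z) \<otimes>\<^bsub>?T,?T\<^esub> ((a2 \<odot>\<^bsub>A\<^esub> r y) \<otimes>\<^bsub>A,H\<^esub> v w)"
  have "comult (A \<Otimes>\<^sub>c H) (twist r v (a \<otimes>\<^bsub>A,H\<^esub> h)) =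
    sw H h (\<lambda>h1 h2. sw A a (\<lambda>a1 a2. sw H h1 (\<lambda>x y. sw H h2 (\<lambda>z w. ?F a1 a2 x y z w))))"
    by (simp add: twist_tens[OF lr lv] lin_sw[OF comultL] comult_tens sw_mult[OF bialgebras(1), where U="?T \<Otimes> ?T"]
      sw_coalgebra_map[OF cr, where U="?T \<Otimes> ?T"] sw_coalgebra_map[OF v, where U="?T \<Otimes> ?T"] cong: sw_cong)
  also have "\<dots> = sw A a (\<lambda>a1 a2. sw H h (\<lambda>h1 h2. sw H h1 (\<lambda>x y. sw H h2 (\<lambda>z w. ?F a1 a2 x y z w))))"
    by (rule sw_swap)
  also have "\<dots> = sw A a (\<lambda>a1 a2. sw H h (\<lambda>h1 h2. sw H h1 (\<lambda>x y. sw H h2 (\<lambda>z w. ?F a1 a2 x z y w))))"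
  proof (rule sw_cong)
    fix a1 a2 assume [simp]: "a1 \<in> vecs A" "a2 \<in> vecs A"
    have "sw H h (\<lambda>h1 h2. sw H h1 (\<lambda>x y. sw H h2 (\<lambda>z w. ?F a1 a2 x y z w)))
      = sw H h (\<lambda>x t. sw H t (\<lambda>m w. sw H m (\<lambda>y z. ?F a1 a2 x y z w)))"
      by (rule sw_middle[where U="?T \<Otimes> ?T"]) simp_all
    also have "\<dots> = sw H h (\<lambda>x t. sw H t (\<lambda>m w. sw H m (\<lambda>y z. ?F a1 a2 x z y w)))"
    proof (rule sw_cong, simp, simp, rule sw_cong)
      fix x t m w assume [simp]: "x \<in> vecs H" "t \<in> vecs H" "m \<in> vecs H" "w \<in> vecs H"
      show "sw H m (\<lambda>y z. ?F a1 a2 x y z w) = sw H m (\<lambda>y z. ?F a1 a2 x z y w)"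
        by (rule sw_cocentral[OF r, where U="?T \<Otimes> ?T"
          and G="\<lambda>\<alpha> z. ((a1 \<odot>\<^bsub>A\<^esub> r x) \<otimes>\<^bsub>A,H\<^esub> v z) \<otimes>\<^bsub>?T,?T\<^esub> ((a2 \<odot>\<^bsub>A\<^esub> \<alpha>) \<otimes>\<^bsub>A,H\<^esub> v w)"]) simp_all
    qed simp_all
    also have "\<dots> = sw H h (\<lambda>h1 h2. sw H h1 (\<lambda>x y. sw H h2 (\<lambda>z w. ?F a1 a2 x z y w)))"
      by (rule sw_middle[where U="?T \<Otimes> ?T", symmetric]) simp_all
    finally show "sw H h (\<lambda>h1 h2. sw H h1 (\<lambda>x y. sw H h2 (\<lambda>z w. ?F a1 a2 x y z w))) =
      sw H h (\<lambda>h1 h2. sw H h1 (\<lambda>x y. sw H h2 (\<lambda>z w. ?F a1 a2 x z y w)))" .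
  qed simp_all
  also have "\<dots> = sw A a (\<lambda>a1 a2. sw H h (\<lambda>h1 h2. sw H h2 (\<lambda>z w. sw H h1 (\<lambda>x y. ?F a1 a2 x z y w))))"
    by (rule sw_cong, simp, simp, rule sw_cong, simp, simp, rule sw_swap)
  also have "\<dots> = sw A a (\<lambda>a1 a2. sw H h (\<lambda>h1 h2.
      twist r v (a1 \<otimes>\<^bsub>A,H\<^esub> h1) \<otimes>\<^bsub>A \<Otimes>\<^sub>c H,A \<Otimes>\<^sub>c H\<^esub> twist r v (a2 \<otimes>\<^bsub>A,H\<^esub> h2)))"
    by (simp add: twist_tens[OF lr lv] lin_sw[OF lin_tens_left[OF _ _ lin_id]] lin_sw[OF lin_tens_right[OF _ _ lin_id]] cong: sw_cong)
  finally show "comult (A \<Otimes>\<^sub>c H) (twist r v (a \<otimes>\<^bsub>A,H\<^esub> h)) = sw A a (\<lambda>a1 a2. sw H h (\<lambda>h1 h2.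
      twist r v (a1 \<otimes>\<^bsub>A,H\<^esub> h1) \<otimes>\<^bsub>A \<Otimes>\<^sub>c H,A \<Otimes>\<^sub>c H\<^esub> twist r v (a2 \<otimes>\<^bsub>A,H\<^esub> h2)))" .
qed

text \<open>
  The instance of associativity of the bicrossed product in which the middle factor lies in \<open>A\<close>. It
  rests on the formula for \<open>h \<triangleright> (c b)\<close> and on \<open>\<triangleleft>\<close> being a right action.
\<close>

lemma bicrossed_mult_assoc_A:
  assumes Y: "matched_pair Y"
    and s: "s \<in> vecs (A \<Otimes> H)" and [simp]: "c \<in> vecs A" "b \<in> vecs A" "g \<in> vecs H"
  shows "s \<odot>\<^bsub>bicrossed Y\<^esub> ((c \<odot>\<^bsub>A\<^esub> b) \<otimes>\<^bsub>A,H\<^esub> g)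
    = (s \<odot>\<^bsub>bicrossed Y\<^esub> (c \<otimes>\<^bsub>A,H\<^esub> \<one>\<^bsub>H\<^esub>)) \<odot>\<^bsub>bicrossed Y\<^esub> (b \<otimes>\<^bsub>A,H\<^esub> g)"
proof -
  note [simp] = action_rules[OF Y] lin_bicrossed_left[OF Y] lin_bicrossed_right[OF Y] bicrossed_mult_mem[OF Y]
  let ?T = "A \<Otimes> H"
  have "(a \<otimes>\<^bsub>A,H\<^esub> h) \<odot>\<^bsub>bicrossed Y\<^esub> ((c \<odot>\<^bsub>A\<^esub> b) \<otimes>\<^bsub>A,H\<^esub> g)
    = ((a \<otimes>\<^bsub>A,H\<^esub> h) \<odot>\<^bsub>bicrossed Y\<^esub> (c \<otimes>\<^bsub>A,H\<^esub> \<one>\<^bsub>H\<^esub>)) \<odot>\<^bsub>bicrossed Y\<^esub> (b \<otimes>\<^bsub>A,H\<^esub> g)"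
    if [simp]: "a \<in> vecs A" "h \<in> vecs H" for a h
  proof -
    let ?F = "\<lambda>h1 h2 h3 c1 c2 c3 b1 b2. (a \<odot>\<^bsub>A\<^esub> ((h1 \<triangleright>\<^bsub>Y\<^esub> c1) \<odot>\<^bsub>A\<^esub> ((h2 \<triangleleft>\<^bsub>Y\<^esub> c2) \<triangleright>\<^bsub>Y\<^esub> b1)))
      \<otimes>\<^bsub>A,H\<^esub> (((h3 \<triangleleft>\<^bsub>Y\<^esub> c3) \<triangleleft>\<^bsub>Y\<^esub> b2) \<odot>\<^bsub>H\<^esub> g)"
    have "(a \<otimes>\<^bsub>A,H\<^esub> h) \<odot>\<^bsub>bicrossed Y\<^esub> ((c \<odot>\<^bsub>A\<^esub> b) \<otimes>\<^bsub>A,H\<^esub> g)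
      = sw H h (\<lambda>m h3. sw A c (\<lambda>n c3. sw A b (\<lambda>b1 b2. sw H m (\<lambda>h1 h2. sw A n (\<lambda>c1 c2.
          ?F h1 h2 h3 c1 c2 c3 b1 b2)))))"
      by (simp add: bicrossed_mult[OF Y] sw_mult[OF bialgebras(1), where U="?T"] lact_mult[OF Y] ract_ract[OF Y]
        lin_sw[OF lin_tens_left[OF _ _ lin_id]] lin_sw[OF lin_mult_right[OF algebras(1) lin_id]] cong: sw_cong)
    also have "\<dots> = sw H h (\<lambda>m h3. sw A c (\<lambda>n c3. sw H m (\<lambda>h1 h2. sw A n (\<lambda>c1 c2. sw A b (\<lambda>b1 b2.
          ?F h1 h2 h3 c1 c2 c3 b1 b2)))))"
      by (simp only: sw_swap_inner[of H _ A _ A b, symmetric])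
    also have "\<dots> = sw H h (\<lambda>h1 m. sw A c (\<lambda>c1 n. sw H m (\<lambda>h2 h3. sw A n (\<lambda>c2 c3. sw A b (\<lambda>b1 b2.
          ?F h1 h2 h3 c1 c2 c3 b1 b2)))))"
      by (rule sw_coassoc_pair[where U="?T"]) simp_all
    also have "\<dots> = ((a \<otimes>\<^bsub>A,H\<^esub> h) \<odot>\<^bsub>bicrossed Y\<^esub> (c \<otimes>\<^bsub>A,H\<^esub> \<one>\<^bsub>H\<^esub>)) \<odot>\<^bsub>bicrossed Y\<^esub> (b \<otimes>\<^bsub>A,H\<^esub> g)"
      by (simp add: bicrossed_mult[OF Y] sw_ract[OF Y, where U="?T"] mult_assoc[OF algebras(1)]
        lin_sw[OF lin_bicrossed_left[OF Y _ lin_id]] cong: sw_cong)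
    finally show ?thesis .
  qed
  then show ?thesis
    using s by (intro lin_tensor_eq[where V=A and W=H and U="?T" and T=s
      and f="\<lambda>s. s \<odot>\<^bsub>bicrossed Y\<^esub> ((c \<odot>\<^bsub>A\<^esub> b) \<otimes>\<^bsub>A,H\<^esub> g)"]) simp_all
qed

text \<open>
  Let \<open>\<psi> = twist r v\<close>. For \<open>s = a \<otimes> h\<close> and \<open>t = c \<otimes> g\<close> the product \<open>s t\<close> is \<open>a (h\<^sub>1 \<triangleright> c\<^sub>1) \<otimes> (h\<^sub>2 \<triangleleft> c\<^sub>2) g\<close>. The formulas for
  \<open>r(hg)\<close> and \<open>v(hg)\<close> split off \<open>\<psi>(1 \<otimes> g)\<close> on the right (\<open>split_H\<close>), the conditions on the two actions identify
  what remains with \<open>\<psi>(a \<otimes> h)(c \<otimes> 1)\<close> (\<open>move_A\<close>), and associativity with middle factor \<open>c\<close> reassembles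
  \<open>\<psi>(c \<otimes> g)\<close>.
\<close>

lemma twist_mult:
  assumes X: "matched_pair X" and Y: "matched_pair Y"
    and r: "coalgebra_map H A r" and v: "coalgebra_map H H v"
    and r_mult: "\<And>h g. h \<in> vecs H \<Longrightarrow> g \<in> vecs H \<Longrightarrow>
      r (h \<odot>\<^bsub>H\<^esub> g) = sw H h (\<lambda>h1 h2. r h1 \<odot>\<^bsub>A\<^esub> (v h2 \<triangleright>\<^bsub>Y\<^esub> r g))"
    and v_mult: "\<And>h g. h \<in> vecs H \<Longrightarrow> g \<in> vecs H \<Longrightarrow>
      v (h \<odot>\<^bsub>H\<^esub> g) = sw H g (\<lambda>g1 g2. (v h \<triangleleft>\<^bsub>Y\<^esub> r g1) \<odot>\<^bsub>H\<^esub> v g2)"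
    and lact: "\<And>h a. h \<in> vecs H \<Longrightarrow> a \<in> vecs A \<Longrightarrow>
      sw H h (\<lambda>h1 h2. sw A a (\<lambda>a1 a2. (h1 \<triangleright>\<^bsub>X\<^esub> a1) \<odot>\<^bsub>A\<^esub> r (h2 \<triangleleft>\<^bsub>X\<^esub> a2))) =
      sw H h (\<lambda>h1 h2. r h1 \<odot>\<^bsub>A\<^esub> (v h2 \<triangleright>\<^bsub>Y\<^esub> a))"
    and ract: "\<And>h a. h \<in> vecs H \<Longrightarrow> a \<in> vecs A \<Longrightarrow> v (h \<triangleleft>\<^bsub>X\<^esub> a) = v h \<triangleleft>\<^bsub>Y\<^esub> a"
    and s: "s \<in> vecs (A \<Otimes> H)" and t: "t \<in> vecs (A \<Otimes> H)"
  shows "twist r v (s \<odot>\<^bsub>bicrossed X\<^esub> t) = twist r v s \<odot>\<^bsub>bicrossed Y\<^esub> twist r v t"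
proof -
  let ?T = "A \<Otimes> H"
  note lr = lin_coalgebra_map[OF r] and lv = lin_coalgebra_map[OF v]
  note tw = linear_map_lin[OF linear_map_twist[OF lr lv]] and twt = twist_tens[OF lr lv]
  note [simp] = lr[THEN lin_compose] lv[THEN lin_compose] lr[THEN lin_mem] lv[THEN lin_mem] tw[THEN lin_compose] tw[THEN lin_mem]
    action_rules[OF X] lin_bicrossed_left[OF X] lin_bicrossed_right[OF X] bicrossed_mult_mem[OF X]
    action_rules[OF Y] lin_bicrossed_left[OF Y] lin_bicrossed_right[OF Y] bicrossed_mult_mem[OF Y]
  note pull = lin_sw[OF lin_tens_left[OF _ _ lin_id]] lin_sw[OF lin_tens_right[OF _ _ lin_id]]
    lin_sw[OF lin_mult_right[OF algebras(1) lin_id]] lin_sw[OF lin_bicrossed_left[OF Y _ lin_id]]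
    lin_sw[OF lin_bicrossed_right[OF Y _ lin_id]]

  have move_A: "sw H h (\<lambda>h1 h2. sw A c (\<lambda>c1 c2. twist r v ((a \<odot>\<^bsub>A\<^esub> (h1 \<triangleright>\<^bsub>X\<^esub> c1)) \<otimes>\<^bsub>A,H\<^esub> (h2 \<triangleleft>\<^bsub>X\<^esub> c2))))
    = twist r v (a \<otimes>\<^bsub>A,H\<^esub> h) \<odot>\<^bsub>bicrossed Y\<^esub> (c \<otimes>\<^bsub>A,H\<^esub> \<one>\<^bsub>H\<^esub>)"
    if [simp]: "a \<in> vecs A" "h \<in> vecs H" "c \<in> vecs A" for a h c
  proof -
    have "sw H h (\<lambda>h1 h2. sw A c (\<lambda>c1 c2. twist r v ((a \<odot>\<^bsub>A\<^esub> (h1 \<triangleright>\<^bsub>X\<^esub> c1)) \<otimes>\<^bsub>A,H\<^esub> (h2 \<triangleleft>\<^bsub>X\<^esub> c2))))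
      = sw H h (\<lambda>h1 m. sw A c (\<lambda>c1 n. sw H m (\<lambda>h2 h3. sw A n (\<lambda>c2 c3.
          (a \<odot>\<^bsub>A\<^esub> ((h1 \<triangleright>\<^bsub>X\<^esub> c1) \<odot>\<^bsub>A\<^esub> r (h2 \<triangleleft>\<^bsub>X\<^esub> c2))) \<otimes>\<^bsub>A,H\<^esub> v (h3 \<triangleleft>\<^bsub>X\<^esub> c3)))))"
      by (simp add: twt sw_ract[OF X, where U="?T"] mult_assoc[OF algebras(1)] cong: sw_cong)
    also have "\<dots> = sw H h (\<lambda>m h3. sw A c (\<lambda>n c3. sw H m (\<lambda>h1 h2. sw A n (\<lambda>c1 c2.
          (a \<odot>\<^bsub>A\<^esub> ((h1 \<triangleright>\<^bsub>X\<^esub> c1) \<odot>\<^bsub>A\<^esub> r (h2 \<triangleleft>\<^bsub>X\<^esub> c2))) \<otimes>\<^bsub>A,H\<^esub> v (h3 \<triangleleft>\<^bsub>X\<^esub> c3)))))"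
      by (rule sw_coassoc_pair[where U="?T", symmetric]) simp_all
    also have "\<dots> = sw H h (\<lambda>m h3. sw A c (\<lambda>n c3. (a \<odot>\<^bsub>A\<^esub> (sw H m (\<lambda>h1 h2. sw A n (\<lambda>c1 c2.
          (h1 \<triangleright>\<^bsub>X\<^esub> c1) \<odot>\<^bsub>A\<^esub> r (h2 \<triangleleft>\<^bsub>X\<^esub> c2))))) \<otimes>\<^bsub>A,H\<^esub> v (h3 \<triangleleft>\<^bsub>X\<^esub> c3)))"
      by (simp add: pull cong: sw_cong)
    also have "\<dots> = sw H h (\<lambda>m h3. sw A c (\<lambda>n c3. sw H m (\<lambda>h1 h2.
          (a \<odot>\<^bsub>A\<^esub> (r h1 \<odot>\<^bsub>A\<^esub> (v h2 \<triangleright>\<^bsub>Y\<^esub> n))) \<otimes>\<^bsub>A,H\<^esub> (v h3 \<triangleleft>\<^bsub>Y\<^esub> c3))))"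
      by (simp add: lact ract pull cong: sw_cong)
    also have "\<dots> = sw H h (\<lambda>m h3. sw H m (\<lambda>h1 h2. sw A c (\<lambda>n c3.
          (a \<odot>\<^bsub>A\<^esub> (r h1 \<odot>\<^bsub>A\<^esub> (v h2 \<triangleright>\<^bsub>Y\<^esub> n))) \<otimes>\<^bsub>A,H\<^esub> (v h3 \<triangleleft>\<^bsub>Y\<^esub> c3))))"
      by (simp only: sw_swap[of A c H])
    also have "\<dots> = sw H h (\<lambda>h1 m. sw H m (\<lambda>h2 h3. sw A c (\<lambda>n c3.
          (a \<odot>\<^bsub>A\<^esub> (r h1 \<odot>\<^bsub>A\<^esub> (v h2 \<triangleright>\<^bsub>Y\<^esub> n))) \<otimes>\<^bsub>A,H\<^esub> (v h3 \<triangleleft>\<^bsub>Y\<^esub> c3))))"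
      by (rule sw_coassoc[where U="?T"]) simp_all
    also have "\<dots> = twist r v (a \<otimes>\<^bsub>A,H\<^esub> h) \<odot>\<^bsub>bicrossed Y\<^esub> (c \<otimes>\<^bsub>A,H\<^esub> \<one>\<^bsub>H\<^esub>)"
      by (simp add: twt pull bicrossed_mult[OF Y] sw_coalgebra_map[OF v, where U="?T"] mult_assoc[OF algebras(1)] cong: sw_cong)
    finally show ?thesis .
  qed

  have split_H: "twist r v (b \<otimes>\<^bsub>A,H\<^esub> (h \<odot>\<^bsub>H\<^esub> g)) = twist r v (b \<otimes>\<^bsub>A,H\<^esub> h) \<odot>\<^bsub>bicrossed Y\<^esub> twist r v (\<one>\<^bsub>A\<^esub> \<otimes>\<^bsub>A,H\<^esub> g)"
    if [simp]: "b \<in> vecs A" "h \<in> vecs H" "g \<in> vecs H" for b h g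
  proof -
    let ?F = "\<lambda>h1 h2 h3 g1 g2 g3. (b \<odot>\<^bsub>A\<^esub> (r h1 \<odot>\<^bsub>A\<^esub> (v h2 \<triangleright>\<^bsub>Y\<^esub> r g1))) \<otimes>\<^bsub>A,H\<^esub> ((v h3 \<triangleleft>\<^bsub>Y\<^esub> r g2) \<odot>\<^bsub>H\<^esub> v g3)"
    have "twist r v (b \<otimes>\<^bsub>A,H\<^esub> (h \<odot>\<^bsub>H\<^esub> g)) =
      sw H h (\<lambda>m h3. sw H g (\<lambda>g1 n. sw H n (\<lambda>g2 g3. sw H m (\<lambda>h1 h2. ?F h1 h2 h3 g1 g2 g3))))"
      by (simp add: twt sw_mult[OF bialgebras(2), where U="?T"] r_mult v_mult pull cong: sw_cong)
    also have "\<dots> = sw H h (\<lambda>m h3. sw H m (\<lambda>h1 h2. sw H g (\<lambda>g1 n. sw H n (\<lambda>g2 g3. ?F h1 h2 h3 g1 g2 g3))))"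
      by (rule sw_cong, simp, simp, rule sw_swap_inner)
    also have "\<dots> = sw H h (\<lambda>h1 m. sw H m (\<lambda>h2 h3. sw H g (\<lambda>g1 n. sw H n (\<lambda>g2 g3. ?F h1 h2 h3 g1 g2 g3))))"
      by (rule sw_coassoc[where U="?T"]) simp_all
    also have "\<dots> = sw H h (\<lambda>h1 m. sw H m (\<lambda>h2 h3. sw H g (\<lambda>n g3. sw H n (\<lambda>g1 g2. ?F h1 h2 h3 g1 g2 g3))))"
      by (simp add: sw_coassoc[where C=H and U="?T"] cong: sw_cong)
    also have "\<dots> = sw H h (\<lambda>h1 m. sw H g (\<lambda>n g3. sw H m (\<lambda>h2 h3. sw H n (\<lambda>g1 g2. ?F h1 h2 h3 g1 g2 g3))))"
      by (rule sw_cong, simp, simp, rule sw_swap)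
    also have "\<dots> = sw H g (\<lambda>n g3. sw H h (\<lambda>h1 m. sw H m (\<lambda>h2 h3. sw H n (\<lambda>g1 g2. ?F h1 h2 h3 g1 g2 g3))))"
      by (rule sw_swap)
    also have "\<dots> = twist r v (b \<otimes>\<^bsub>A,H\<^esub> h) \<odot>\<^bsub>bicrossed Y\<^esub> twist r v (\<one>\<^bsub>A\<^esub> \<otimes>\<^bsub>A,H\<^esub> g)"
      by (simp add: twt pull bicrossed_mult[OF Y] sw_coalgebra_map[OF v, where U="?T"] sw_coalgebra_map[OF r, where U="?T"]
        mult_assoc[OF algebras(1)] cong: sw_cong)
    finally show ?thesis .
  qed

  have "twist r v ((a \<otimes>\<^bsub>A,H\<^esub> h) \<odot>\<^bsub>bicrossed X\<^esub> (c \<otimes>\<^bsub>A,H\<^esub> g)) =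
     twist r v (a \<otimes>\<^bsub>A,H\<^esub> h) \<odot>\<^bsub>bicrossed Y\<^esub> twist r v (c \<otimes>\<^bsub>A,H\<^esub> g)"
    if [simp]: "a \<in> vecs A" "h \<in> vecs H" "c \<in> vecs A" "g \<in> vecs H" for a h c g
  proof -
    have "twist r v ((a \<otimes>\<^bsub>A,H\<^esub> h) \<odot>\<^bsub>bicrossed X\<^esub> (c \<otimes>\<^bsub>A,H\<^esub> g)) =
      sw H h (\<lambda>h1 h2. sw A c (\<lambda>c1 c2. twist r v ((a \<odot>\<^bsub>A\<^esub> (h1 \<triangleright>\<^bsub>X\<^esub> c1)) \<otimes>\<^bsub>A,H\<^esub> (h2 \<triangleleft>\<^bsub>X\<^esub> c2))))
        \<odot>\<^bsub>bicrossed Y\<^esub> twist r v (\<one>\<^bsub>A\<^esub> \<otimes>\<^bsub>A,H\<^esub> g)"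
      by (simp add: bicrossed_mult[OF X] lin_sw[OF tw] split_H lin_sw[OF lin_bicrossed_left[OF Y _ lin_id]] cong: sw_cong)
    also have "\<dots> = (twist r v (a \<otimes>\<^bsub>A,H\<^esub> h) \<odot>\<^bsub>bicrossed Y\<^esub> (c \<otimes>\<^bsub>A,H\<^esub> \<one>\<^bsub>H\<^esub>)) \<odot>\<^bsub>bicrossed Y\<^esub> twist r v (\<one>\<^bsub>A\<^esub> \<otimes>\<^bsub>A,H\<^esub> g)"
      by (simp add: move_A)
    also have "\<dots> = twist r v (a \<otimes>\<^bsub>A,H\<^esub> h) \<odot>\<^bsub>bicrossed Y\<^esub> sw H g (\<lambda>g1 g2. (c \<odot>\<^bsub>A\<^esub> r g1) \<otimes>\<^bsub>A,H\<^esub> v g2)"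
      by (simp add: twt[of "\<one>\<^bsub>A\<^esub>"] lin_sw[OF lin_bicrossed_right[OF Y _ lin_id]] bicrossed_mult_assoc_A[OF Y] cong: sw_cong)
    finally show ?thesis by (simp add: twt[of c])
  qed
  then have "twist r v ((a \<otimes>\<^bsub>A,H\<^esub> h) \<odot>\<^bsub>bicrossed X\<^esub> t) = twist r v (a \<otimes>\<^bsub>A,H\<^esub> h) \<odot>\<^bsub>bicrossed Y\<^esub> twist r v t"
    if [simp]: "a \<in> vecs A" "h \<in> vecs H" for a h
    using t by (intro lin_tensor_eq[where V=A and W=H and U="?T" and T=t
      and f="\<lambda>t. twist r v ((a \<otimes>\<^bsub>A,H\<^esub> h) \<odot>\<^bsub>bicrossed X\<^esub> t)"]) simp_all
  then show ?thesis
    using s t by (intro lin_tensor_eq[where V=A and W=H and U="?T" and T=s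
      and f="\<lambda>s. twist r v (s \<odot>\<^bsub>bicrossed X\<^esub> t)"]) simp_all
qed

section \<open>Cohomologous objects are isomorphic\<close>

text \<open>
  In \<open>Hom(H \<otimes> A, A)\<close> let \<open>G(h \<otimes> a) = r(h \<triangleleft> a)\<close> and \<open>K(h \<otimes> a) = r(h\<^sub>1)(v(h\<^sub>2) \<triangleright>' a)\<close>. The two sides say
  \<open>\<triangleright> = K * (S \<circ> G)\<close> and \<open>\<triangleright> * G = K\<close>, which are equivalent because \<open>G\<close>, a composite of coalgebra maps, has
  the convolution inverse \<open>S \<circ> G\<close>.
\<close>

lemma lact_iff:
  assumes X: "matched_pair X" and Y: "matched_pair Y"
    and r: "coalgebra_map H A r" and lv: "lin H H v"
  shows "(\<forall>h\<in>vecs H. \<forall>a\<in>vecs A. h \<triangleright>\<^bsub>X\<^esub> a = sw H h (\<lambda>h1 h'. sw H h' (\<lambda>h2 h3. sw A a (\<lambda>a1 a2.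
      r h1 \<odot>\<^bsub>A\<^esub> (v h2 \<triangleright>\<^bsub>Y\<^esub> a1) \<odot>\<^bsub>A\<^esub> antipode A (r (h3 \<triangleleft>\<^bsub>X\<^esub> a2)))))) \<longleftrightarrow>
    (\<forall>h\<in>vecs H. \<forall>a\<in>vecs A. sw H h (\<lambda>h1 h2. sw A a (\<lambda>a1 a2. (h1 \<triangleright>\<^bsub>X\<^esub> a1) \<odot>\<^bsub>A\<^esub> r (h2 \<triangleleft>\<^bsub>X\<^esub> a2))) =
      sw H h (\<lambda>h1 h2. r h1 \<odot>\<^bsub>A\<^esub> (v h2 \<triangleright>\<^bsub>Y\<^esub> a)))"
    (is "?P \<longleftrightarrow> ?Q")
proof -
  let ?HA = "H \<Otimes>\<^sub>c A"
  note lr = lin_coalgebra_map[OF r]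
  note [simp] = lr[THEN lin_compose] lv[THEN lin_compose] lr[THEN lin_mem] lv[THEN lin_mem]
    action_rules[OF X] action_rules[OF Y]
  have HA: "coalgebra ?HA" by (simp add: coalgebra_tensor)
  define G where "G = (\<lambda>t\<in>vecs ?HA. r (fst X t))"
  define SG where "SG = (\<lambda>t. antipode A (G t))"
  define K where "K = tlift H A A (\<lambda>h a. sw H h (\<lambda>h1 h2. r h1 \<odot>\<^bsub>A\<^esub> (v h2 \<triangleright>\<^bsub>Y\<^esub> a)))"
  have G: "coalgebra_map ?HA A G"
    unfolding G_def by (rule coalgebra_map_compose[OF coalgebra_map_actions(1)[OF X] r]) simp_all
  note lG = lin_coalgebra_map[OF G]
  have lSG: "lin ?HA A SG" unfolding SG_def using lin_compose[OF lin_antipode[OF A] lG] .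
  have K: "lin ?HA A K" "\<And>h a. h \<in> vecs H \<Longrightarrow> a \<in> vecs A \<Longrightarrow>
      K (h \<otimes>\<^bsub>H,A\<^esub> a) = sw H h (\<lambda>h1 h2. r h1 \<odot>\<^bsub>A\<^esub> (v h2 \<triangleright>\<^bsub>Y\<^esub> a))"
    by (simp_all add: K_def lin_tlift)
  have lX: "lin ?HA A (snd X)" using lin_actions(2)[OF X] by simp
  note L = lX[unfolded tensor_coalg_carrier] lG[unfolded tensor_coalg_carrier] lSG[unfolded tensor_coalg_carrier]
    K(1)[unfolded tensor_coalg_carrier]
  note [simp] = L L[THEN lin_compose] L[THEN lin_mem] K(2)
  have inv: "convolution ?HA A SG G t = conv_unit ?HA A t" "convolution ?HA A G SG t = conv_unit ?HA A t"
    if "t \<in> vecs ?HA" for t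
    unfolding SG_def using convolution_antipode_left[OF HA A G that] convolution_antipode_right[OF HA A G that] by auto
  have XG: "convolution ?HA A (snd X) G (h \<otimes>\<^bsub>H,A\<^esub> a) =
      sw H h (\<lambda>h1 h2. sw A a (\<lambda>a1 a2. (h1 \<triangleright>\<^bsub>X\<^esub> a1) \<odot>\<^bsub>A\<^esub> r (h2 \<triangleleft>\<^bsub>X\<^esub> a2)))"
    if [simp]: "h \<in> vecs H" "a \<in> vecs A" for h a
    by (simp add: convolution_def sw_tens[where U=A] cong: sw_cong) (simp add: G_def cong: sw_cong)
  have KSG: "convolution ?HA A K SG (h \<otimes>\<^bsub>H,A\<^esub> a) =
     sw H h (\<lambda>h1 h'. sw H h' (\<lambda>h2 h3. sw A a (\<lambda>a1 a2.
      r h1 \<odot>\<^bsub>A\<^esub> (v h2 \<triangleright>\<^bsub>Y\<^esub> a1) \<odot>\<^bsub>A\<^esub> antipode A (r (h3 \<triangleleft>\<^bsub>X\<^esub> a2)))))"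
    if [simp]: "h \<in> vecs H" "a \<in> vecs A" for h a
  proof -
    have "convolution ?HA A K SG (h \<otimes>\<^bsub>H,A\<^esub> a) = sw H h (\<lambda>m h3. sw A a (\<lambda>a1 a2. sw H m (\<lambda>h1 h2.
      r h1 \<odot>\<^bsub>A\<^esub> (v h2 \<triangleright>\<^bsub>Y\<^esub> a1) \<odot>\<^bsub>A\<^esub> SG (h3 \<otimes>\<^bsub>H,A\<^esub> a2))))"
      by (simp add: convolution_def sw_tens[where U=A] lin_sw[OF lin_mult_left[OF algebras(1) lin_id]] cong: sw_cong)
    also have "\<dots> = sw H h (\<lambda>m h3. sw H m (\<lambda>h1 h2. sw A a (\<lambda>a1 a2.
      r h1 \<odot>\<^bsub>A\<^esub> (v h2 \<triangleright>\<^bsub>Y\<^esub> a1) \<odot>\<^bsub>A\<^esub> SG (h3 \<otimes>\<^bsub>H,A\<^esub> a2))))"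
      by (simp only: sw_swap[of A a H])
    also have "\<dots> = sw H h (\<lambda>h1 m. sw H m (\<lambda>h2 h3. sw A a (\<lambda>a1 a2.
      r h1 \<odot>\<^bsub>A\<^esub> (v h2 \<triangleright>\<^bsub>Y\<^esub> a1) \<odot>\<^bsub>A\<^esub> SG (h3 \<otimes>\<^bsub>H,A\<^esub> a2))))"
      by (rule sw_coassoc[where U=A]) simp_all
    finally show ?thesis by (simp add: SG_def G_def cong: sw_cong)
  qed
  show ?thesis
  proof
    assume P: ?P
    have snd_eq: "snd X t = convolution ?HA A K SG t" if "t \<in> vecs ?HA" for t
      using that lin_convolution[OF HA algebras(1) K(1) lSG] P KSG
      by (intro lin_tensor_eq[where V=H and W=A and U=A and T=t and f="snd X"]) simp_all
    show ?Q
    proof (intro ballI)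
      fix h a assume [simp]: "h \<in> vecs H" "a \<in> vecs A"
      have "convolution ?HA A (snd X) G (h \<otimes>\<^bsub>H,A\<^esub> a) = convolution ?HA A (convolution ?HA A K SG) G (h \<otimes>\<^bsub>H,A\<^esub> a)"
        by (rule convolution_cong[OF HA algebras(1)]) (use snd_eq in simp_all)
      also have "\<dots> = K (h \<otimes>\<^bsub>H,A\<^esub> a)"
        by (rule convolution_cancel[OF HA algebras(1) K(1) lSG lG _ inv(1)]) simp_all
      finally show "sw H h (\<lambda>h1 h2. sw A a (\<lambda>a1 a2. (h1 \<triangleright>\<^bsub>X\<^esub> a1) \<odot>\<^bsub>A\<^esub> r (h2 \<triangleleft>\<^bsub>X\<^esub> a2))) =
        sw H h (\<lambda>h1 h2. r h1 \<odot>\<^bsub>A\<^esub> (v h2 \<triangleright>\<^bsub>Y\<^esub> a))" by (simp add: XG)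
    qed
  next
    assume Q: ?Q
    have K_eq: "convolution ?HA A (snd X) G t = K t" if "t \<in> vecs ?HA" for t
      using that lin_convolution[OF HA algebras(1) lX lG] Q XG
      by (intro lin_tensor_eq[where V=H and W=A and U=A and T=t and g="K"]) simp_all
    show ?P
    proof (intro ballI)
      fix h a assume [simp]: "h \<in> vecs H" "a \<in> vecs A"
      have "convolution ?HA A K SG (h \<otimes>\<^bsub>H,A\<^esub> a) = convolution ?HA A (convolution ?HA A (snd X) G) SG (h \<otimes>\<^bsub>H,A\<^esub> a)"
        by (rule convolution_cong[OF HA algebras(1)]) (use K_eq in simp_all)
      also have "\<dots> = h \<triangleright>\<^bsub>X\<^esub> a"
        by (rule convolution_cancel[OF HA algebras(1) lX lG lSG _ inv(2)]) simp_all
      finally show "h \<triangleright>\<^bsub>X\<^esub> a = sw H h (\<lambda>h1 h'. sw H h' (\<lambda>h2 h3. sw A a (\<lambda>a1 a2.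
        r h1 \<odot>\<^bsub>A\<^esub> (v h2 \<triangleright>\<^bsub>Y\<^esub> a1) \<odot>\<^bsub>A\<^esub> antipode A (r (h3 \<triangleleft>\<^bsub>X\<^esub> a2)))))" by (simp add: KSG)
    qed
  qed
qed

text \<open>
  The conditions on \<open>(r, v)\<close> in \<open>cohomologous\<close>, rid of the inverse of \<open>v\<close> and of the antipode. In this form they
  are the ones that make \<open>twist r v\<close> an isomorphism of Hopf algebras.
\<close>

definition twisting where
  "twisting X Y r v \<longleftrightarrow> cocentral H A r \<and> r \<one>\<^bsub>H\<^esub> = \<one>\<^bsub>A\<^esub> \<and> coalgebra_iso H H v \<and> v \<one>\<^bsub>H\<^esub> = \<one>\<^bsub>H\<^esub> \<and>
    (\<forall>h\<in>vecs H. \<forall>g\<in>vecs H. r (h \<odot>\<^bsub>H\<^esub> g) = sw H h (\<lambda>h1 h2. r h1 \<odot>\<^bsub>A\<^esub> (v h2 \<triangleright>\<^bsub>Y\<^esub> r g)) \<and>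
      v (h \<odot>\<^bsub>H\<^esub> g) = sw H g (\<lambda>g1 g2. (v h \<triangleleft>\<^bsub>Y\<^esub> r g1) \<odot>\<^bsub>H\<^esub> v g2)) \<and>
    (\<forall>h\<in>vecs H. \<forall>a\<in>vecs A. v (h \<triangleleft>\<^bsub>X\<^esub> a) = v h \<triangleleft>\<^bsub>Y\<^esub> a) \<and>
    (\<forall>h\<in>vecs H. \<forall>a\<in>vecs A. sw H h (\<lambda>h1 h2. sw A a (\<lambda>a1 a2. (h1 \<triangleright>\<^bsub>X\<^esub> a1) \<odot>\<^bsub>A\<^esub> r (h2 \<triangleleft>\<^bsub>X\<^esub> a2))) =
      sw H h (\<lambda>h1 h2. r h1 \<odot>\<^bsub>A\<^esub> (v h2 \<triangleright>\<^bsub>Y\<^esub> a)))"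

text \<open>
  The condition \<open>h \<triangleleft> a = v\<^sup>-\<^sup>1(v(h) \<triangleleft>' a)\<close> turns the last factor \<open>S(r(v\<^sup>-\<^sup>1(v(h\<^sub>3) \<triangleleft>' a\<^sub>2)))\<close> of the formula
  for \<open>h \<triangleright> a\<close> into \<open>S(r(h\<^sub>3 \<triangleleft> a\<^sub>2))\<close>, which makes \<open>lact_iff\<close> applicable.
\<close>

lemma cohomologous_iff_twisting:
  "(X, Y) \<in> cohomologous \<longleftrightarrow> matched_pair X \<and> matched_pair Y \<and> (\<exists>r v. twisting X Y r v)"
proof (cases "matched_pair X \<and> matched_pair Y")
  case True
  then have X: "matched_pair X" and Y: "matched_pair Y" by auto
  have core: "(\<forall>h\<in>vecs H. \<forall>g\<in>vecs H.
        r (h \<odot>\<^bsub>H\<^esub> g) = sweedler H A h (\<lambda>h1 h2. r h1 \<odot>\<^bsub>A\<^esub> (v h2 \<triangleright>\<^bsub>Y\<^esub> r g)) \<and>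
        v (h \<odot>\<^bsub>H\<^esub> g) = sweedler H H g (\<lambda>g1 g2. (v h \<triangleleft>\<^bsub>Y\<^esub> r g1) \<odot>\<^bsub>H\<^esub> v g2)) \<and>
     (let v_inv = inv_into (vecs H) v in
      \<forall>a\<in>vecs A. \<forall>h\<in>vecs H.
        h \<triangleleft>\<^bsub>X\<^esub> a = v_inv (v h \<triangleleft>\<^bsub>Y\<^esub> a) \<and>
        h \<triangleright>\<^bsub>X\<^esub> a =
          sweedler H A h (\<lambda>h1 h'. sweedler H A h' (\<lambda>h2 h3. sweedler A A a (\<lambda>a1 a2.
            r h1 \<odot>\<^bsub>A\<^esub> (v h2 \<triangleright>\<^bsub>Y\<^esub> a1) \<odot>\<^bsub>A\<^esub> antipode A (r (v_inv (v h3 \<triangleleft>\<^bsub>Y\<^esub> a2))))))) \<longleftrightarrow>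
    (\<forall>h\<in>vecs H. \<forall>g\<in>vecs H. r (h \<odot>\<^bsub>H\<^esub> g) = sw H h (\<lambda>h1 h2. r h1 \<odot>\<^bsub>A\<^esub> (v h2 \<triangleright>\<^bsub>Y\<^esub> r g)) \<and>
      v (h \<odot>\<^bsub>H\<^esub> g) = sw H g (\<lambda>g1 g2. (v h \<triangleleft>\<^bsub>Y\<^esub> r g1) \<odot>\<^bsub>H\<^esub> v g2)) \<and>
    (\<forall>h\<in>vecs H. \<forall>a\<in>vecs A. v (h \<triangleleft>\<^bsub>X\<^esub> a) = v h \<triangleleft>\<^bsub>Y\<^esub> a) \<and>
    (\<forall>h\<in>vecs H. \<forall>a\<in>vecs A. sw H h (\<lambda>h1 h2. sw A a (\<lambda>a1 a2. (h1 \<triangleright>\<^bsub>X\<^esub> a1) \<odot>\<^bsub>A\<^esub> r (h2 \<triangleleft>\<^bsub>X\<^esub> a2))) =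
      sw H h (\<lambda>h1 h2. r h1 \<odot>\<^bsub>A\<^esub> (v h2 \<triangleright>\<^bsub>Y\<^esub> a)))"
    (is "?M \<and> (let v_inv = _ in ?P v_inv) \<longleftrightarrow> ?M' \<and> ?R \<and> ?L")
    if r: "cocentral H A r" and v: "coalgebra_iso H H v" for r v
  proof -
    have cr: "coalgebra_map H A r" and cv: "coalgebra_map H H v"
      using r v by (auto simp: cocentral_def coalgebra_iso_def)
    note lr = lin_coalgebra_map[OF cr] and lv = lin_coalgebra_map[OF cv]
    note [simp] = lr[THEN lin_compose] lv[THEN lin_compose] lr[THEN lin_mem] lv[THEN lin_mem]
      action_rules[OF X] action_rules[OF Y]
    obtain w where w: "coalgebra_map H H w" and wv: "\<And>h. h \<in> vecs H \<Longrightarrow> w (v h) = h"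
      and vw: "\<And>h. h \<in> vecs H \<Longrightarrow> v (w h) = h"
      using v by (auto simp: coalgebra_iso_def)
    have inj: "inj_on v (vecs H)" by (rule inj_on_inverseI[of _ w]) (rule wv)
    have inv: "inv_into (vecs H) v h = w h" if "h \<in> vecs H" for h
      using inv_into_f_f[OF inj lin_mem[OF lin_coalgebra_map[OF w] that]] vw[OF that] by simp
    have M: "?M \<longleftrightarrow> ?M'" by (simp add: sweedler_eq_sw)
    have ract: "?R \<longleftrightarrow> (\<forall>h\<in>vecs H. \<forall>a\<in>vecs A. h \<triangleleft>\<^bsub>X\<^esub> a = w (v h \<triangleleft>\<^bsub>Y\<^esub> a))"
    proof -
      have "v (h \<triangleleft>\<^bsub>X\<^esub> a) = v h \<triangleleft>\<^bsub>Y\<^esub> a \<longleftrightarrow> h \<triangleleft>\<^bsub>X\<^esub> a = w (v h \<triangleleft>\<^bsub>Y\<^esub> a)"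
        if [simp]: "h \<in> vecs H" "a \<in> vecs A" for h a
      proof
        assume "v (h \<triangleleft>\<^bsub>X\<^esub> a) = v h \<triangleleft>\<^bsub>Y\<^esub> a"
        from this[symmetric] show "h \<triangleleft>\<^bsub>X\<^esub> a = w (v h \<triangleleft>\<^bsub>Y\<^esub> a)" by (simp add: wv)
      qed (simp add: vw)
      then show ?thesis by simp
    qed
    let ?P' = "\<forall>h\<in>vecs H. \<forall>a\<in>vecs A. h \<triangleright>\<^bsub>X\<^esub> a = sw H h (\<lambda>h1 h'. sw H h' (\<lambda>h2 h3. sw A a (\<lambda>a1 a2.
      r h1 \<odot>\<^bsub>A\<^esub> (v h2 \<triangleright>\<^bsub>Y\<^esub> a1) \<odot>\<^bsub>A\<^esub> antipode A (r (h3 \<triangleleft>\<^bsub>X\<^esub> a2)))))"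
    have P: "?P (inv_into (vecs H) v) \<longleftrightarrow> ?R \<and> ?P'"
    proof (cases ?R)
      case True
      then have R: "h \<in> vecs H \<Longrightarrow> a \<in> vecs A \<Longrightarrow> w (v h \<triangleleft>\<^bsub>Y\<^esub> a) = h \<triangleleft>\<^bsub>X\<^esub> a" for h a
        by (simp add: ract)
      show ?thesis using True by (simp add: inv R sweedler_eq_sw cong: sweedler_cong) blast
    next
      case False
      then show ?thesis unfolding ract by (auto simp: inv)
    qed
    show ?thesis
      unfolding Let_def M P lact_iff[OF X Y cr lv] ..
  qed
  have "(X, Y) \<in> cohomologous \<longleftrightarrow> (\<exists>r v. twisting X Y r v)"
    unfolding cohomologous_def MP_def twisting_def mem_Collect_eq prod.case
    apply (simp only: X Y simp_thms)
    apply (intro iff_exI)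
    subgoal for r v
      by (rule conj_cong[OF refl], rule conj_cong[OF refl], rule conj_cong[OF refl], rule conj_cong[OF refl],
        rule core[of r v]; assumption)
    done
  then show ?thesis using X Y by simp
qed (auto simp: cohomologous_def MP_def)


text \<open>
  The inverse of \<open>twist r v\<close> is \<open>twist (S \<circ> r \<circ> w) w\<close> with \<open>w\<close> inverse to \<open>v\<close>. It inherits
  the compatibility with the Hopf structures from \<open>twist r v\<close>, being the inverse of a bijection.
\<close>

lemma MP_iso_if_twisting:
  assumes X: "matched_pair X" and Y: "matched_pair Y" and tw: "twisting X Y r v"
  shows "(X, Y) \<in> MP_iso"
proof -
  let ?T = "A \<Otimes> H" let ?TC = "A \<Otimes>\<^sub>c H"
  have r: "cocentral H A r" and r1: "r \<one>\<^bsub>H\<^esub> = \<one>\<^bsub>A\<^esub>" and v: "coalgebra_iso H H v" and v1: "v \<one>\<^bsub>H\<^esub> = \<one>\<^bsub>H\<^esub>"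
    using tw by (simp_all add: twisting_def)
  have cr: "coalgebra_map H A r" and cv: "coalgebra_map H H v"
    using r v by (auto simp: cocentral_def coalgebra_iso_def)
  obtain w where w: "coalgebra_map H H w" and wv: "\<And>h. h \<in> vecs H \<Longrightarrow> w (v h) = h"
    and vw: "\<And>h. h \<in> vecs H \<Longrightarrow> v (w h) = h"
    using v by (auto simp: coalgebra_iso_def)
  note lr = lin_coalgebra_map[OF cr] and lv = lin_coalgebra_map[OF cv] and lw = lin_coalgebra_map[OF w]
  define r' where "r' = (\<lambda>h. antipode A (r (w h)))"
  have lr': "lin H A r'" unfolding r'_def using lin_compose[OF lin_antipode[OF A] lin_compose[OF lr lw]] .
  note [simp] = lr[THEN lin_compose] lv[THEN lin_compose] lr[THEN lin_mem] lv[THEN lin_mem] lw[THEN lin_mem]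
    lin_bicrossed_left[OF X] lin_bicrossed_right[OF X] bicrossed_mult_mem[OF X]
    lin_bicrossed_left[OF Y] lin_bicrossed_right[OF Y] bicrossed_mult_mem[OF Y]
  define \<psi> where "\<psi> = twist r v"
  define \<phi> where "\<phi> = twist r' w"
  have \<psi>: "linear_map ?T ?T \<psi>" and \<phi>: "linear_map ?T ?T \<phi>"
    unfolding \<psi>_def \<phi>_def by (rule linear_map_twist[OF lr lv] linear_map_twist[OF lr' lw])+
  note [simp] = \<psi>[THEN linear_map_lin, THEN lin_mem] \<phi>[THEN linear_map_lin, THEN lin_mem]
  have crw: "coalgebra_map H A (\<lambda>h\<in>vecs H. r (w h))"
    by (rule coalgebra_map_compose[OF w cr]) simp_all
  have \<psi>\<phi>: "\<psi> (\<phi> t) = t" if "t \<in> vecs ?T" for t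
    unfolding \<psi>_def \<phi>_def
  proof (rule twist_twist[OF lr lv lr' w _ vw that])
    fix h assume h: "h \<in> vecs H"
    show "convolution H A r' (\<lambda>h. r (w h)) h = conv_unit H A h"
      using convolution_antipode_left[OF coalgebras(2) A crw h]
        convolution_cong[OF coalgebras(2) algebras(1) _ _ h, of "\<lambda>x. antipode A ((\<lambda>h\<in>vecs H. r (w h)) x)" r'
          "\<lambda>h\<in>vecs H. r (w h)" "\<lambda>h. r (w h)"] by (simp add: r'_def)
  qed
  have \<phi>\<psi>: "\<phi> (\<psi> t) = t" if "t \<in> vecs ?T" for t
    unfolding \<psi>_def \<phi>_def
  proof (rule twist_twist[OF lr' lw lr cv _ wv that])
    fix h assume h: "h \<in> vecs H"
    show "convolution H A r (\<lambda>h. r' (v h)) h = conv_unit H A h"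
      using convolution_antipode_right[OF coalgebras(2) A cr h]
        convolution_cong[OF coalgebras(2) algebras(1) _ _ h, of r r "\<lambda>h. r' (v h)" "\<lambda>x. antipode A (r x)"]
      by (simp add: r'_def wv)
  qed
  have stab: "\<psi> (a \<otimes>\<^bsub>A,H\<^esub> \<one>\<^bsub>H\<^esub>) = a \<otimes>\<^bsub>A,H\<^esub> \<one>\<^bsub>H\<^esub>" if [simp]: "a \<in> vecs A" for a
    by (simp add: \<psi>_def twist_tens[OF lr lv] sw_unit[OF bialgebras(2), where U="?T"] r1 v1)
  then have stab': "\<phi> (a \<otimes>\<^bsub>A,H\<^esub> \<one>\<^bsub>H\<^esub>) = a \<otimes>\<^bsub>A,H\<^esub> \<one>\<^bsub>H\<^esub>" if [simp]: "a \<in> vecs A" for a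
    using \<phi>\<psi>[of "a \<otimes>\<^bsub>A,H\<^esub> \<one>\<^bsub>H\<^esub>"] by simp
  have c\<psi>: "coalgebra_map ?TC ?TC \<psi>" unfolding \<psi>_def by (rule coalgebra_map_twist[OF r cv])
  have c\<phi>: "coalgebra_map ?TC ?TC \<phi>"
    by (rule coalgebra_map_inverse[OF c\<psi>]) (use \<phi> \<psi>\<phi> \<phi>\<psi> in simp_all)
  have mult: "\<psi> (s \<odot>\<^bsub>bicrossed X\<^esub> t) = \<psi> s \<odot>\<^bsub>bicrossed Y\<^esub> \<psi> t" if "s \<in> vecs ?T" "t \<in> vecs ?T" for s t
    unfolding \<psi>_def by (rule twist_mult[OF X Y cr cv _ _ _ _ that]) (use tw in \<open>simp_all add: twisting_def\<close>)
  have mult': "\<phi> (s \<odot>\<^bsub>bicrossed Y\<^esub> t) = \<phi> s \<odot>\<^bsub>bicrossed X\<^esub> \<phi> t" if [simp]: "s \<in> vecs ?T" "t \<in> vecs ?T" for s t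
    using mult[of "\<phi> s" "\<phi> t"] \<phi>\<psi>[of "\<phi> s \<odot>\<^bsub>bicrossed X\<^esub> \<phi> t"] by (simp add: \<psi>\<phi>)
  have "\<psi> \<in> MP_hom X Y" "\<phi> \<in> MP_hom Y X"
    by (simp_all add: MP_hom_def hopf_map_bicrossed c\<psi> c\<phi> mult mult' stab stab')
  then show ?thesis
    unfolding MP_iso_def MP_def
    by (intro CollectI case_prodI conjI bexI[of _ \<psi>] bexI[of _ \<phi>]) (simp_all add: X Y \<phi>\<psi> \<psi>\<phi>)
qed

section \<open>Isomorphic objects are cohomologous\<close>

definition proj_A where "proj_A = tlift A H A (\<lambda>a h. counit H h \<star>\<^bsub>A\<^esub> a)"
definition proj_H where "proj_H = tlift A H H (\<lambda>a h. counit A a \<star>\<^bsub>H\<^esub> h)"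

lemma lin_proj: "lin (A \<Otimes> H) A proj_A" "lin (A \<Otimes> H) H proj_H"
  by (simp_all add: proj_A_def proj_H_def lin_tlift)

lemma proj_tens:
  "a \<in> vecs A \<Longrightarrow> h \<in> vecs H \<Longrightarrow> proj_A (a \<otimes>\<^bsub>A,H\<^esub> h) = counit H h \<star>\<^bsub>A\<^esub> a"
  "a \<in> vecs A \<Longrightarrow> h \<in> vecs H \<Longrightarrow> proj_H (a \<otimes>\<^bsub>A,H\<^esub> h) = counit A a \<star>\<^bsub>H\<^esub> h"
  by (simp_all add: proj_A_def proj_H_def tlift_tens bilinear_map_iff)

lemma coalgebra_map_proj:
  "coalgebra_map (A \<Otimes>\<^sub>c H) A proj_A" "coalgebra_map (A \<Otimes>\<^sub>c H) H proj_H"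
proof -
  have L: "linear_map (A \<Otimes> H) A proj_A" "linear_map (A \<Otimes> H) H proj_H"
    by (simp_all add: proj_A_def proj_H_def linear_map_tlift bilinear_map_iff)
  note [simp] = proj_tens lin_proj[THEN lin_compose] lin_proj[THEN lin_mem]
    lin_scale[OF lin_comult] lin_mem[OF lin_comult]
    coalgebras(1)[THEN lin_counit, THEN lin_scale] coalgebras(2)[THEN lin_counit, THEN lin_scale]
  show "coalgebra_map (A \<Otimes>\<^sub>c H) A proj_A"
    by (rule coalgebra_map_tensorI) (simp_all add: L comult_eq_sw[symmetric] cong: sw_cong)
  show "coalgebra_map (A \<Otimes>\<^sub>c H) H proj_H"
    by (rule coalgebra_map_tensorI) (simp_all add: L comult_eq_sw[symmetric] cong: sw_cong)
qed

text \<open>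
  On \<open>a \<otimes> h\<close> the counits cancel one half of each tensor factor: \<open>a\<^sub>1 \<epsilon>(h\<^sub>1) \<otimes> \<epsilon>(a\<^sub>2) h\<^sub>2 = a \<otimes> h\<close>. That both
  orders of \<open>t\<^sub>1\<close> and \<open>t\<^sub>2\<close> give the same tensor is the source of cocentrality.
\<close>

lemma proj_decomposition:
  assumes "t \<in> vecs (A \<Otimes> H)"
  shows "sw (A \<Otimes>\<^sub>c H) t (\<lambda>t1 t2. proj_A t1 \<otimes>\<^bsub>A,H\<^esub> proj_H t2) = t"
    and "sw (A \<Otimes>\<^sub>c H) t (\<lambda>t1 t2. proj_A t2 \<otimes>\<^bsub>A,H\<^esub> proj_H t1) = t"
proof -
  note [simp] = proj_tens lin_proj[THEN lin_compose] lin_proj[THEN lin_mem]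
  have "sw (A \<Otimes>\<^sub>c H) (a \<otimes>\<^bsub>A,H\<^esub> h) (\<lambda>t1 t2. proj_A t1 \<otimes>\<^bsub>A,H\<^esub> proj_H t2) = a \<otimes>\<^bsub>A,H\<^esub> h"
    "sw (A \<Otimes>\<^sub>c H) (a \<otimes>\<^bsub>A,H\<^esub> h) (\<lambda>t1 t2. proj_A t2 \<otimes>\<^bsub>A,H\<^esub> proj_H t1) = a \<otimes>\<^bsub>A,H\<^esub> h"
    if [simp]: "a \<in> vecs A" "h \<in> vecs H" for a h
    by (simp_all add: sw_tens[where U="A \<Otimes> H"] cong: sw_cong)
  note gens = this
  show "sw (A \<Otimes>\<^sub>c H) t (\<lambda>t1 t2. proj_A t1 \<otimes>\<^bsub>A,H\<^esub> proj_H t2) = t"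
    by (rule lin_tensor_eq[where V=A and W=H and U="A \<Otimes> H" and T=t and g="\<lambda>t. t"
      and f="\<lambda>t. sw (A \<Otimes>\<^sub>c H) t (\<lambda>t1 t2. proj_A t1 \<otimes>\<^bsub>A,H\<^esub> proj_H t2)"]) (simp_all add: assms gens(1))
  show "sw (A \<Otimes>\<^sub>c H) t (\<lambda>t1 t2. proj_A t2 \<otimes>\<^bsub>A,H\<^esub> proj_H t1) = t"
    by (rule lin_tensor_eq[where V=A and W=H and U="A \<Otimes> H" and T=t and g="\<lambda>t. t"
      and f="\<lambda>t. sw (A \<Otimes>\<^sub>c H) t (\<lambda>t1 t2. proj_A t2 \<otimes>\<^bsub>A,H\<^esub> proj_H t1)"]) (simp_all add: assms gens(2))
qed

lemma coalgebra_map_inclusion: "coalgebra_map H (A \<Otimes>\<^sub>c H) (\<lambda>h\<in>vecs H. \<one>\<^bsub>A\<^esub> \<otimes>\<^bsub>A,H\<^esub> h)"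
  by (rule coalgebra_mapI) (simp_all add: linear_map_restrict counit_tens comult_tens sw_unit[OF bialgebras(1), where U="(A \<Otimes> H) \<Otimes> A \<Otimes> H"] cong: sw_cong)

text \<open>
  The projections recover the two actions from the multiplication of the bicrossed product.
\<close>

lemma proj_mult:
  assumes Y: "matched_pair Y" and [simp]: "a \<in> vecs A" "h \<in> vecs H" "c \<in> vecs A" "g \<in> vecs H"
  shows "proj_A ((a \<otimes>\<^bsub>A,H\<^esub> h) \<odot>\<^bsub>bicrossed Y\<^esub> (c \<otimes>\<^bsub>A,H\<^esub> g)) = counit H g \<star>\<^bsub>A\<^esub> (a \<odot>\<^bsub>A\<^esub> (h \<triangleright>\<^bsub>Y\<^esub> c))"
    and "proj_H ((a \<otimes>\<^bsub>A,H\<^esub> h) \<odot>\<^bsub>bicrossed Y\<^esub> (c \<otimes>\<^bsub>A,H\<^esub> g)) = counit A a \<star>\<^bsub>H\<^esub> ((h \<triangleleft>\<^bsub>Y\<^esub> c) \<odot>\<^bsub>H\<^esub> g)"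
proof -
  note [simp] = proj_tens lin_proj[THEN lin_compose] lin_proj[THEN lin_mem] action_rules[OF Y]
    kspace_scale_scale[symmetric] bialgebras[THEN counit_mult] counit_actions[OF Y]
  show "proj_A ((a \<otimes>\<^bsub>A,H\<^esub> h) \<odot>\<^bsub>bicrossed Y\<^esub> (c \<otimes>\<^bsub>A,H\<^esub> g)) = counit H g \<star>\<^bsub>A\<^esub> (a \<odot>\<^bsub>A\<^esub> (h \<triangleright>\<^bsub>Y\<^esub> c))"
    by (simp add: bicrossed_mult[OF Y] lin_sw[OF lin_proj(1)] cong: sw_cong)
  show "proj_H ((a \<otimes>\<^bsub>A,H\<^esub> h) \<odot>\<^bsub>bicrossed Y\<^esub> (c \<otimes>\<^bsub>A,H\<^esub> g)) = counit A a \<star>\<^bsub>H\<^esub> ((h \<triangleleft>\<^bsub>Y\<^esub> c) \<odot>\<^bsub>H\<^esub> g)"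
    by (simp add: bicrossed_mult[OF Y] lin_sw[OF lin_proj(2)] cong: sw_cong)
qed

lemma bicrossed_unit_mult:
  assumes Y: "matched_pair Y"
  shows mult_inclusion_A: "a \<in> vecs A \<Longrightarrow> c \<in> vecs A \<Longrightarrow> g \<in> vecs H \<Longrightarrow>
      (a \<otimes>\<^bsub>A,H\<^esub> \<one>\<^bsub>H\<^esub>) \<odot>\<^bsub>bicrossed Y\<^esub> (c \<otimes>\<^bsub>A,H\<^esub> g) = (a \<odot>\<^bsub>A\<^esub> c) \<otimes>\<^bsub>A,H\<^esub> g"
    and mult_inclusion_H: "h \<in> vecs H \<Longrightarrow> g \<in> vecs H \<Longrightarrow>
      (\<one>\<^bsub>A\<^esub> \<otimes>\<^bsub>A,H\<^esub> h) \<odot>\<^bsub>bicrossed Y\<^esub> (\<one>\<^bsub>A\<^esub> \<otimes>\<^bsub>A,H\<^esub> g) = \<one>\<^bsub>A\<^esub> \<otimes>\<^bsub>A,H\<^esub> (h \<odot>\<^bsub>H\<^esub> g)"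
proof -
  note [simp] = action_rules[OF Y] action_units[OF Y] sw_unit[OF bialgebras(1), where U="A \<Otimes> H"]
    sw_unit[OF bialgebras(2), where U="A \<Otimes> H"]
  show "a \<in> vecs A \<Longrightarrow> c \<in> vecs A \<Longrightarrow> g \<in> vecs H \<Longrightarrow>
      (a \<otimes>\<^bsub>A,H\<^esub> \<one>\<^bsub>H\<^esub>) \<odot>\<^bsub>bicrossed Y\<^esub> (c \<otimes>\<^bsub>A,H\<^esub> g) = (a \<odot>\<^bsub>A\<^esub> c) \<otimes>\<^bsub>A,H\<^esub> g"
    by (simp add: bicrossed_mult[OF Y] cong: sw_cong)
  show "h \<in> vecs H \<Longrightarrow> g \<in> vecs H \<Longrightarrow>
      (\<one>\<^bsub>A\<^esub> \<otimes>\<^bsub>A,H\<^esub> h) \<odot>\<^bsub>bicrossed Y\<^esub> (\<one>\<^bsub>A\<^esub> \<otimes>\<^bsub>A,H\<^esub> g) = \<one>\<^bsub>A\<^esub> \<otimes>\<^bsub>A,H\<^esub> (h \<odot>\<^bsub>H\<^esub> g)"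
    by (simp add: bicrossed_mult[OF Y] cong: sw_cong)
qed

definition A_part where "A_part \<psi> = (\<lambda>h\<in>vecs H. proj_A (\<psi> (\<one>\<^bsub>A\<^esub> \<otimes>\<^bsub>A,H\<^esub> h)))"
definition H_part where "H_part \<psi> = (\<lambda>h\<in>vecs H. proj_H (\<psi> (\<one>\<^bsub>A\<^esub> \<otimes>\<^bsub>A,H\<^esub> h)))"

context
  fixes X Y \<psi>
  assumes X: "matched_pair X" and Y: "matched_pair Y" and \<psi>: "\<psi> \<in> MP_hom X Y"
begin

lemma MP_homD:
  shows coalgebra_map_MP_hom: "coalgebra_map (A \<Otimes>\<^sub>c H) (A \<Otimes>\<^sub>c H) \<psi>"
    and MP_hom_mult: "s \<in> vecs (A \<Otimes> H) \<Longrightarrow> t \<in> vecs (A \<Otimes> H) \<Longrightarrow>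
      \<psi> (s \<odot>\<^bsub>bicrossed X\<^esub> t) = \<psi> s \<odot>\<^bsub>bicrossed Y\<^esub> \<psi> t"
    and MP_hom_stabilizes: "a \<in> vecs A \<Longrightarrow> \<psi> (a \<otimes>\<^bsub>A,H\<^esub> \<one>\<^bsub>H\<^esub>) = a \<otimes>\<^bsub>A,H\<^esub> \<one>\<^bsub>H\<^esub>"
  using \<psi> by (auto simp: MP_hom_def hopf_map_bicrossed)

text \<open>
  \<open>h \<mapsto> \<psi>(1 \<otimes> h)\<close> is a coalgebra map, so \<open>proj_decomposition\<close> can be evaluated on the parts of \<open>h\<close>.
\<close>

lemma
  shows coalgebra_map_A_part: "coalgebra_map H A (A_part \<psi>)"
    and coalgebra_map_H_part: "coalgebra_map H H (H_part \<psi>)"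
    and MP_hom_inclusion: "h \<in> vecs H \<Longrightarrow> \<psi> (\<one>\<^bsub>A\<^esub> \<otimes>\<^bsub>A,H\<^esub> h) = sw H h (\<lambda>h1 h2. A_part \<psi> h1 \<otimes>\<^bsub>A,H\<^esub> H_part \<psi> h2)"
    and MP_hom_inclusion_flip: "h \<in> vecs H \<Longrightarrow> \<psi> (\<one>\<^bsub>A\<^esub> \<otimes>\<^bsub>A,H\<^esub> h) = sw H h (\<lambda>h1 h2. A_part \<psi> h2 \<otimes>\<^bsub>A,H\<^esub> H_part \<psi> h1)"
proof -
  have \<iota>: "coalgebra_map H (A \<Otimes>\<^sub>c H) (\<lambda>h\<in>vecs H. \<psi> ((\<lambda>h\<in>vecs H. \<one>\<^bsub>A\<^esub> \<otimes>\<^bsub>A,H\<^esub> h) h))"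
    by (rule coalgebra_map_compose[OF coalgebra_map_inclusion coalgebra_map_MP_hom]) simp_all
  have eqs: "(\<lambda>h\<in>vecs H. proj_A ((\<lambda>h\<in>vecs H. \<psi> ((\<lambda>h\<in>vecs H. \<one>\<^bsub>A\<^esub> \<otimes>\<^bsub>A,H\<^esub> h) h)) h)) = A_part \<psi>"
    "(\<lambda>h\<in>vecs H. proj_H ((\<lambda>h\<in>vecs H. \<psi> ((\<lambda>h\<in>vecs H. \<one>\<^bsub>A\<^esub> \<otimes>\<^bsub>A,H\<^esub> h) h)) h)) = H_part \<psi>"
    by (auto simp: A_part_def H_part_def)
  show "coalgebra_map H A (A_part \<psi>)"
    using coalgebra_map_compose[OF \<iota> coalgebra_map_proj(1)] unfolding eqs by simp
  show "coalgebra_map H H (H_part \<psi>)"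
    using coalgebra_map_compose[OF \<iota> coalgebra_map_proj(2)] unfolding eqs by simp
  note L = lin_coalgebra_map[OF coalgebra_map_MP_hom, unfolded tensor_coalg_carrier]
  note [simp] = L[THEN lin_compose] L[THEN lin_mem] lin_proj[THEN lin_compose] lin_proj[THEN lin_mem]
  assume [simp]: "h \<in> vecs H"
  have \<iota>_apply: "(\<lambda>h\<in>vecs H. \<psi> ((\<lambda>h\<in>vecs H. \<one>\<^bsub>A\<^esub> \<otimes>\<^bsub>A,H\<^esub> h) h)) h = \<psi> (\<one>\<^bsub>A\<^esub> \<otimes>\<^bsub>A,H\<^esub> h)"
    by simp
  have "\<psi> (\<one>\<^bsub>A\<^esub> \<otimes>\<^bsub>A,H\<^esub> h) = sw (A \<Otimes>\<^sub>c H) (\<psi> (\<one>\<^bsub>A\<^esub> \<otimes>\<^bsub>A,H\<^esub> h)) (\<lambda>t1 t2. proj_A t1 \<otimes>\<^bsub>A,H\<^esub> proj_H t2)"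
    by (simp add: proj_decomposition(1))
  also have "\<dots> = sw H h (\<lambda>h1 h2. A_part \<psi> h1 \<otimes>\<^bsub>A,H\<^esub> H_part \<psi> h2)"
    using sw_coalgebra_map[OF \<iota>, of "A \<Otimes> H" h "\<lambda>t1 t2. proj_A t1 \<otimes>\<^bsub>A,H\<^esub> proj_H t2", unfolded \<iota>_apply]
    by (simp add: A_part_def H_part_def cong: sw_cong)
  finally show "\<psi> (\<one>\<^bsub>A\<^esub> \<otimes>\<^bsub>A,H\<^esub> h) = sw H h (\<lambda>h1 h2. A_part \<psi> h1 \<otimes>\<^bsub>A,H\<^esub> H_part \<psi> h2)" .
  have "\<psi> (\<one>\<^bsub>A\<^esub> \<otimes>\<^bsub>A,H\<^esub> h) = sw (A \<Otimes>\<^sub>c H) (\<psi> (\<one>\<^bsub>A\<^esub> \<otimes>\<^bsub>A,H\<^esub> h)) (\<lambda>t1 t2. proj_A t2 \<otimes>\<^bsub>A,H\<^esub> proj_H t1)"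
    by (simp add: proj_decomposition(2))
  also have "\<dots> = sw H h (\<lambda>h1 h2. A_part \<psi> h2 \<otimes>\<^bsub>A,H\<^esub> H_part \<psi> h1)"
    using sw_coalgebra_map[OF \<iota>, of "A \<Otimes> H" h "\<lambda>t1 t2. proj_A t2 \<otimes>\<^bsub>A,H\<^esub> proj_H t1", unfolded \<iota>_apply]
    by (simp add: A_part_def H_part_def cong: sw_cong)
  finally show "\<psi> (\<one>\<^bsub>A\<^esub> \<otimes>\<^bsub>A,H\<^esub> h) = sw H h (\<lambda>h1 h2. A_part \<psi> h2 \<otimes>\<^bsub>A,H\<^esub> H_part \<psi> h1)" .
qed

lemma part_units: "A_part \<psi> \<one>\<^bsub>H\<^esub> = \<one>\<^bsub>A\<^esub>" "H_part \<psi> \<one>\<^bsub>H\<^esub> = \<one>\<^bsub>H\<^esub>"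
  by (simp_all add: A_part_def H_part_def MP_hom_stabilizes proj_tens kspace_scale_one)

text \<open>
  \<open>a \<otimes> h = (a \<otimes> 1)(1 \<otimes> h)\<close> holds in every bicrossed product, and \<open>\<psi>\<close> fixes \<open>a \<otimes> 1\<close>.
\<close>

lemma MP_hom_eq_twist:
  assumes t: "t \<in> vecs (A \<Otimes> H)"
  shows "\<psi> t = twist (A_part \<psi>) (H_part \<psi>) t"
proof -
  note L = lin_coalgebra_map[OF coalgebra_map_MP_hom, unfolded tensor_coalg_carrier]
  note lr = lin_coalgebra_map[OF coalgebra_map_A_part] and lv = lin_coalgebra_map[OF coalgebra_map_H_part]
  note tw = linear_map_lin[OF linear_map_twist[OF lr lv]]
  note [simp] = lr[THEN lin_mem] lv[THEN lin_mem] L tw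
  have "\<psi> (a \<otimes>\<^bsub>A,H\<^esub> h) = twist (A_part \<psi>) (H_part \<psi>) (a \<otimes>\<^bsub>A,H\<^esub> h)" if [simp]: "a \<in> vecs A" "h \<in> vecs H" for a h
  proof -
    have "\<psi> (a \<otimes>\<^bsub>A,H\<^esub> h) = \<psi> ((a \<otimes>\<^bsub>A,H\<^esub> \<one>\<^bsub>H\<^esub>) \<odot>\<^bsub>bicrossed X\<^esub> (\<one>\<^bsub>A\<^esub> \<otimes>\<^bsub>A,H\<^esub> h))"
      by (simp add: mult_inclusion_A[OF X])
    also have "\<dots> = (a \<otimes>\<^bsub>A,H\<^esub> \<one>\<^bsub>H\<^esub>) \<odot>\<^bsub>bicrossed Y\<^esub> \<psi> (\<one>\<^bsub>A\<^esub> \<otimes>\<^bsub>A,H\<^esub> h)"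
      by (simp add: MP_hom_mult MP_hom_stabilizes)
    also have "\<dots> = twist (A_part \<psi>) (H_part \<psi>) (a \<otimes>\<^bsub>A,H\<^esub> h)"
      by (simp add: MP_hom_inclusion twist_tens[OF lr lv] lin_sw[OF lin_bicrossed_right[OF Y _ lin_id]]
        mult_inclusion_A[OF Y] cong: sw_cong)
    finally show ?thesis .
  qed
  then show ?thesis
    using t by (intro lin_tensor_eq[where V=A and W=H and U="A \<Otimes> H" and T=t and f=\<psi>]) simp_all
qed

lemma
  assumes [simp]: "a \<in> vecs A" "h \<in> vecs H"
  shows proj_A_MP_hom: "proj_A (\<psi> (a \<otimes>\<^bsub>A,H\<^esub> h)) = a \<odot>\<^bsub>A\<^esub> A_part \<psi> h"
    and proj_H_MP_hom: "proj_H (\<psi> (a \<otimes>\<^bsub>A,H\<^esub> h)) = counit A a \<star>\<^bsub>H\<^esub> H_part \<psi> h"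
proof -
  note cr = coalgebra_map_A_part and cv = coalgebra_map_H_part
  note lr = lin_coalgebra_map[OF cr] and lv = lin_coalgebra_map[OF cv]
  note [simp] = lr[THEN lin_mem] lv[THEN lin_mem] lr[THEN lin_compose] lv[THEN lin_compose] proj_tens
    kspace_scale_scale[symmetric] bialgebras[THEN counit_mult]
    counit_coalgebra_map[OF cr] counit_coalgebra_map[OF cv]
  show "proj_A (\<psi> (a \<otimes>\<^bsub>A,H\<^esub> h)) = a \<odot>\<^bsub>A\<^esub> A_part \<psi> h"
    by (simp add: MP_hom_eq_twist twist_tens[OF lr lv] lin_sw[OF lin_proj(1)] cong: sw_cong)
  show "proj_H (\<psi> (a \<otimes>\<^bsub>A,H\<^esub> h)) = counit A a \<star>\<^bsub>H\<^esub> H_part \<psi> h"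
    by (simp add: MP_hom_eq_twist twist_tens[OF lr lv] lin_sw[OF lin_proj(2)] cong: sw_cong)
qed

text \<open>
  Passing to the quotient \<open>H\<close>, the morphism becomes its \<open>H\<close>-part. In particular \<open>H\<close>-parts of mutually
  inverse morphisms are mutually inverse.
\<close>

lemma proj_H_comp:
  assumes "t \<in> vecs (A \<Otimes> H)"
  shows "proj_H (\<psi> t) = H_part \<psi> (proj_H t)"
proof -
  note L = lin_coalgebra_map[OF coalgebra_map_MP_hom, unfolded tensor_coalg_carrier]
  note lv = lin_coalgebra_map[OF coalgebra_map_H_part]
  note [simp] = lv[THEN lin_mem] lv[THEN lin_compose] lv[THEN lin_scale] L lin_proj lin_proj[THEN lin_compose]
  show ?thesis
    using assms by (intro lin_tensor_eq[where V=A and W=H and U=H and T=t and f="\<lambda>t. proj_H (\<psi> t)"])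
      (simp_all add: proj_H_MP_hom proj_tens)
qed

text \<open>
  The two projections of \<open>\<psi>((1 \<otimes> h)(1 \<otimes> g)) = \<psi>(1 \<otimes> h) \<psi>(1 \<otimes> g)\<close>.
\<close>

lemma
  assumes [simp]: "h \<in> vecs H" "g \<in> vecs H"
  shows A_part_mult: "A_part \<psi> (h \<odot>\<^bsub>H\<^esub> g) = sw H h (\<lambda>h1 h2. A_part \<psi> h1 \<odot>\<^bsub>A\<^esub> (H_part \<psi> h2 \<triangleright>\<^bsub>Y\<^esub> A_part \<psi> g))"
    and H_part_mult: "H_part \<psi> (h \<odot>\<^bsub>H\<^esub> g) = sw H g (\<lambda>g1 g2. (H_part \<psi> h \<triangleleft>\<^bsub>Y\<^esub> A_part \<psi> g1) \<odot>\<^bsub>H\<^esub> H_part \<psi> g2)"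
proof -
  note cr = coalgebra_map_A_part and cv = coalgebra_map_H_part
  note lr = lin_coalgebra_map[OF cr] and lv = lin_coalgebra_map[OF cv]
  note [simp] = lr[THEN lin_mem] lv[THEN lin_mem] lr[THEN lin_compose] lv[THEN lin_compose]
    bicrossed_mult_mem[OF Y] action_rules[OF Y] counit_coalgebra_map[OF cr] counit_coalgebra_map[OF cv]
  have "\<psi> (\<one>\<^bsub>A\<^esub> \<otimes>\<^bsub>A,H\<^esub> (h \<odot>\<^bsub>H\<^esub> g)) = \<psi> (\<one>\<^bsub>A\<^esub> \<otimes>\<^bsub>A,H\<^esub> h) \<odot>\<^bsub>bicrossed Y\<^esub> \<psi> (\<one>\<^bsub>A\<^esub> \<otimes>\<^bsub>A,H\<^esub> g)"
    by (simp add: mult_inclusion_H[OF X, symmetric] MP_hom_mult)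
  also have "\<dots> = sw H g (\<lambda>g1 g2. sw H h (\<lambda>h1 h2.
    (A_part \<psi> h1 \<otimes>\<^bsub>A,H\<^esub> H_part \<psi> h2) \<odot>\<^bsub>bicrossed Y\<^esub> (A_part \<psi> g1 \<otimes>\<^bsub>A,H\<^esub> H_part \<psi> g2)))"
    by (simp add: MP_hom_inclusion lin_sw[OF lin_bicrossed_right[OF Y _ lin_id]] lin_sw[OF lin_bicrossed_left[OF Y _ lin_id]]
      cong: sw_cong)
  finally have eq: "\<psi> (\<one>\<^bsub>A\<^esub> \<otimes>\<^bsub>A,H\<^esub> (h \<odot>\<^bsub>H\<^esub> g)) = sw H g (\<lambda>g1 g2. sw H h (\<lambda>h1 h2.
    (A_part \<psi> h1 \<otimes>\<^bsub>A,H\<^esub> H_part \<psi> h2) \<odot>\<^bsub>bicrossed Y\<^esub> (A_part \<psi> g1 \<otimes>\<^bsub>A,H\<^esub> H_part \<psi> g2)))" .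
  show "A_part \<psi> (h \<odot>\<^bsub>H\<^esub> g) = sw H h (\<lambda>h1 h2. A_part \<psi> h1 \<odot>\<^bsub>A\<^esub> (H_part \<psi> h2 \<triangleright>\<^bsub>Y\<^esub> A_part \<psi> g))"
    using arg_cong[OF eq, of proj_A]
    by (simp add: proj_A_MP_hom lin_sw[OF lin_proj(1)] proj_mult[OF Y] cong: sw_cong)
  show "H_part \<psi> (h \<odot>\<^bsub>H\<^esub> g) = sw H g (\<lambda>g1 g2. (H_part \<psi> h \<triangleleft>\<^bsub>Y\<^esub> A_part \<psi> g1) \<odot>\<^bsub>H\<^esub> H_part \<psi> g2)"
    using arg_cong[OF eq, of proj_H]
    by (simp add: proj_H_MP_hom lin_sw[OF lin_proj(2)] proj_mult[OF Y] kspace_scale_one cong: sw_cong)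
qed

text \<open>
  The two projections of \<open>\<psi>((1 \<otimes> h)(a \<otimes> 1)) = \<psi>(1 \<otimes> h)(a \<otimes> 1)\<close>.
\<close>

lemma
  assumes [simp]: "h \<in> vecs H" "a \<in> vecs A"
  shows A_part_lact: "sw H h (\<lambda>h1 h2. sw A a (\<lambda>a1 a2. (h1 \<triangleright>\<^bsub>X\<^esub> a1) \<odot>\<^bsub>A\<^esub> A_part \<psi> (h2 \<triangleleft>\<^bsub>X\<^esub> a2))) =
      sw H h (\<lambda>h1 h2. A_part \<psi> h1 \<odot>\<^bsub>A\<^esub> (H_part \<psi> h2 \<triangleright>\<^bsub>Y\<^esub> a))"
    and H_part_ract: "H_part \<psi> (h \<triangleleft>\<^bsub>X\<^esub> a) = H_part \<psi> h \<triangleleft>\<^bsub>Y\<^esub> a"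
proof -
  note cr = coalgebra_map_A_part and cv = coalgebra_map_H_part
  note lr = lin_coalgebra_map[OF cr] and lv = lin_coalgebra_map[OF cv]
  note L = lin_coalgebra_map[OF coalgebra_map_MP_hom, unfolded tensor_coalg_carrier]
  note [simp] = lr[THEN lin_mem] lv[THEN lin_mem] lr[THEN lin_compose] lv[THEN lin_compose] L[THEN lin_mem]
    lv[THEN lin_scale] action_rules[OF X] kspace_scale_scale[symmetric] counit_actions[OF X]
    bicrossed_mult_mem[OF Y] action_rules[OF Y] counit_coalgebra_map[OF cr] counit_coalgebra_map[OF cv]
  have "\<psi> (\<one>\<^bsub>A\<^esub> \<otimes>\<^bsub>A,H\<^esub> h) \<odot>\<^bsub>bicrossed Y\<^esub> (a \<otimes>\<^bsub>A,H\<^esub> \<one>\<^bsub>H\<^esub>) =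
    \<psi> ((\<one>\<^bsub>A\<^esub> \<otimes>\<^bsub>A,H\<^esub> h) \<odot>\<^bsub>bicrossed X\<^esub> (a \<otimes>\<^bsub>A,H\<^esub> \<one>\<^bsub>H\<^esub>))"
    by (simp add: MP_hom_mult MP_hom_stabilizes)
  then have eq: "sw H h (\<lambda>h1 h2. (A_part \<psi> h1 \<otimes>\<^bsub>A,H\<^esub> H_part \<psi> h2) \<odot>\<^bsub>bicrossed Y\<^esub> (a \<otimes>\<^bsub>A,H\<^esub> \<one>\<^bsub>H\<^esub>)) =
    sw H h (\<lambda>h1 h2. sw A a (\<lambda>a1 a2. \<psi> ((h1 \<triangleright>\<^bsub>X\<^esub> a1) \<otimes>\<^bsub>A,H\<^esub> (h2 \<triangleleft>\<^bsub>X\<^esub> a2))))"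
    by (simp add: MP_hom_inclusion lin_sw[OF lin_bicrossed_left[OF Y _ lin_id]] bicrossed_mult[OF X]
      lin_sw[OF L] cong: sw_cong)
  show "sw H h (\<lambda>h1 h2. sw A a (\<lambda>a1 a2. (h1 \<triangleright>\<^bsub>X\<^esub> a1) \<odot>\<^bsub>A\<^esub> A_part \<psi> (h2 \<triangleleft>\<^bsub>X\<^esub> a2))) =
      sw H h (\<lambda>h1 h2. A_part \<psi> h1 \<odot>\<^bsub>A\<^esub> (H_part \<psi> h2 \<triangleright>\<^bsub>Y\<^esub> a))"
    using arg_cong[OF eq, of proj_A]
    by (simp add: proj_A_MP_hom lin_sw[OF lin_proj(1)] proj_mult[OF Y] kspace_scale_one cong: sw_cong)
  show "H_part \<psi> (h \<triangleleft>\<^bsub>X\<^esub> a) = H_part \<psi> h \<triangleleft>\<^bsub>Y\<^esub> a"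
    using arg_cong[OF eq, of proj_H]
    by (simp add: proj_H_MP_hom lin_sw[OF lin_proj(2)] proj_mult[OF Y] cong: sw_cong)
qed

end

lemma twisting_if_MP_iso:
  assumes "(X, Y) \<in> MP_iso"
  shows "\<exists>r v. twisting X Y r v"
proof -
  obtain \<psi> \<phi> where X: "matched_pair X" and Y: "matched_pair Y" and \<psi>: "\<psi> \<in> MP_hom X Y" and \<phi>: "\<phi> \<in> MP_hom Y X"
    and inv: "\<And>t. t \<in> vecs (A \<Otimes> H) \<Longrightarrow> \<phi> (\<psi> t) = t" "\<And>t. t \<in> vecs (A \<Otimes> H) \<Longrightarrow> \<psi> (\<phi> t) = t"
    using assms by (auto simp: MP_iso_def MP_def)
  define r v w where "r = A_part \<psi>" and "v = H_part \<psi>" and "w = H_part \<phi>"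
  have cr: "coalgebra_map H A r" and cv: "coalgebra_map H H v" and cw: "coalgebra_map H H w"
    using coalgebra_map_A_part[OF X Y \<psi>] coalgebra_map_H_part[OF X Y \<psi>] coalgebra_map_H_part[OF Y X \<phi>]
    by (simp_all add: r_def v_def w_def)
  note lr = lin_coalgebra_map[OF cr] and lv = lin_coalgebra_map[OF cv] and lw = lin_coalgebra_map[OF cw]
  note L = lin_coalgebra_map[OF coalgebra_map_MP_hom[OF X Y \<psi>], unfolded tensor_coalg_carrier]
    lin_coalgebra_map[OF coalgebra_map_MP_hom[OF Y X \<phi>], unfolded tensor_coalg_carrier]
  note [simp] = lr[THEN lin_mem] lv[THEN lin_mem] lr[THEN lin_compose] lv[THEN lin_compose] lw[THEN lin_compose] L[THEN lin_mem]
  have wv: "w (v h) = h" if [simp]: "h \<in> vecs H" for h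
    using proj_H_comp[OF Y X \<phi>, of "\<psi> (\<one>\<^bsub>A\<^esub> \<otimes>\<^bsub>A,H\<^esub> h)"] proj_H_comp[OF X Y \<psi>, of "\<one>\<^bsub>A\<^esub> \<otimes>\<^bsub>A,H\<^esub> h"] inv(1)[of "\<one>\<^bsub>A\<^esub> \<otimes>\<^bsub>A,H\<^esub> h"]
    by (simp add: proj_tens kspace_scale_one v_def w_def)
  have vw: "v (w h) = h" if [simp]: "h \<in> vecs H" for h
    using proj_H_comp[OF X Y \<psi>, of "\<phi> (\<one>\<^bsub>A\<^esub> \<otimes>\<^bsub>A,H\<^esub> h)"] proj_H_comp[OF Y X \<phi>, of "\<one>\<^bsub>A\<^esub> \<otimes>\<^bsub>A,H\<^esub> h"] inv(2)[of "\<one>\<^bsub>A\<^esub> \<otimes>\<^bsub>A,H\<^esub> h"]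
    by (simp add: proj_tens kspace_scale_one v_def w_def)
  have iso: "coalgebra_iso H H v" unfolding coalgebra_iso_def using cv cw wv vw by blast
  have "sw H h (\<lambda>h1 h2. r h1 \<otimes>\<^bsub>A,H\<^esub> h2) = sw H h (\<lambda>h1 h2. r h2 \<otimes>\<^bsub>A,H\<^esub> h1)" if [simp]: "h \<in> vecs H" for h
  proof -
    \<comment> \<open>Applying \<open>id \<otimes> w\<close> removes \<open>v\<close> from the symmetry \<open>r(h\<^sub>1) \<otimes> v(h\<^sub>2) = r(h\<^sub>2) \<otimes> v(h\<^sub>1)\<close>.\<close>
    define W where "W = tlift A H (A \<Otimes> H) (\<lambda>a h. a \<otimes>\<^bsub>A,H\<^esub> w h)"
    have W: "lin (A \<Otimes> H) (A \<Otimes> H) W" "\<And>a h. a \<in> vecs A \<Longrightarrow> h \<in> vecs H \<Longrightarrow> W (a \<otimes>\<^bsub>A,H\<^esub> h) = a \<otimes>\<^bsub>A,H\<^esub> w h"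
      using lw[THEN lin_mem] by (simp_all add: W_def lin_tlift)
    have "sw H h (\<lambda>h1 h2. r h1 \<otimes>\<^bsub>A,H\<^esub> v h2) = sw H h (\<lambda>h1 h2. r h2 \<otimes>\<^bsub>A,H\<^esub> v h1)"
      using MP_hom_inclusion[OF X Y \<psi>, of h] MP_hom_inclusion_flip[OF X Y \<psi>, of h] by (simp add: r_def v_def)
    from arg_cong[OF this, of W] show ?thesis
      by (simp add: lin_sw[OF W(1)] W(2) wv cong: sw_cong)
  qed
  then have "cocentral H A r" using cr by (simp add: cocentral_def sweedler_eq_sw)
  then have "twisting X Y r v"
    using iso part_units[OF X Y \<psi>] A_part_mult[OF X Y \<psi>] H_part_mult[OF X Y \<psi>] A_part_lact[OF X Y \<psi>] H_part_ract[OF X Y \<psi>]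
    by (simp add: twisting_def r_def v_def)
  then show ?thesis by blast
qed

section \<open>The quotient sets\<close>

lemma cohomologous_eq_MP_iso: "cohomologous = MP_iso"
proof -
  have "(X, Y) \<in> cohomologous \<longleftrightarrow> (X, Y) \<in> MP_iso" for X Y
    using MP_iso_if_twisting[of X Y] twisting_if_MP_iso[of X Y]
    by (auto simp: cohomologous_iff_twisting) (auto simp: MP_iso_def MP_def)
  then show ?thesis by auto
qed

lemma MP_hom_id: "X \<in> MP \<Longrightarrow> (\<lambda>t\<in>vecs (A \<Otimes> H). t) \<in> MP_hom X X"
  using coalgebra_map_id[of "A \<Otimes>\<^sub>c H"] bicrossed_mult_mem[of X]
  by (simp add: MP_def MP_hom_def hopf_map_bicrossed)

lemma MP_hom_compose:
  assumes "X \<in> MP" "Y \<in> MP" "Z \<in> MP" "\<psi> \<in> MP_hom X Y" "\<phi> \<in> MP_hom Y Z"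
  shows "(\<lambda>t\<in>vecs (A \<Otimes> H). \<phi> (\<psi> t)) \<in> MP_hom X Z"
proof -
  have X: "matched_pair X" and Y: "matched_pair Y" and Z: "matched_pair Z" using assms by (simp_all add: MP_def)
  note c = coalgebra_map_MP_hom[OF X Y assms(4)] coalgebra_map_MP_hom[OF Y Z assms(5)]
  note L = c[THEN lin_coalgebra_map, unfolded tensor_coalg_carrier]
  note [simp] = L[THEN lin_mem] bicrossed_mult_mem[OF X]
  have "coalgebra_map (A \<Otimes>\<^sub>c H) (A \<Otimes>\<^sub>c H) (\<lambda>t\<in>vecs (A \<Otimes> H). \<phi> (\<psi> t))"
    using coalgebra_map_compose[OF c] by simp
  then show ?thesis
    by (simp add: MP_hom_def hopf_map_bicrossed MP_hom_mult[OF X Y assms(4)] MP_hom_mult[OF Y Z assms(5)]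
      MP_hom_stabilizes[OF X Y assms(4)] MP_hom_stabilizes[OF Y Z assms(5)])
qed

lemma MP_iso_iff:
  "(X, Y) \<in> MP_iso \<longleftrightarrow> X \<in> MP \<and> Y \<in> MP \<and> (\<exists>\<psi>\<in>MP_hom X Y. \<exists>\<phi>\<in>MP_hom Y X.
    (\<forall>t\<in>vecs (A \<Otimes> H). \<phi> (\<psi> t) = t) \<and> (\<forall>t\<in>vecs (A \<Otimes> H). \<psi> (\<phi> t) = t))"
  by (simp add: MP_iso_def)

lemma equiv_MP_iso: "equiv MP MP_iso"
proof (rule equivI)
  show "MP_iso \<subseteq> MP \<times> MP" by (auto simp: MP_iso_iff)
  show "refl_on MP MP_iso"
  proof (rule refl_onI)
    fix X assume X: "X \<in> MP"
    define f where "f = (\<lambda>t\<in>vecs (A \<Otimes> H). t)"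
    have "f \<in> MP_hom X X" "\<forall>t\<in>vecs (A \<Otimes> H). f (f t) = t"
      using MP_hom_id[OF X] by (simp_all add: f_def)
    with X show "(X, X) \<in> MP_iso" unfolding MP_iso_iff by (intro conjI bexI[of _ f])
  qed
  show "sym MP_iso"
  proof (rule symI)
    fix X Y assume "(X, Y) \<in> MP_iso"
    then obtain \<psi> \<phi> where "X \<in> MP" "Y \<in> MP" "\<psi> \<in> MP_hom X Y" "\<phi> \<in> MP_hom Y X"
      "\<forall>t\<in>vecs (A \<Otimes> H). \<phi> (\<psi> t) = t" "\<forall>t\<in>vecs (A \<Otimes> H). \<psi> (\<phi> t) = t"
      unfolding MP_iso_iff by blast
    then show "(Y, X) \<in> MP_iso" unfolding MP_iso_iff by (intro conjI bexI[of _ \<phi>] bexI[of _ \<psi>])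
  qed
  show "trans MP_iso"
  proof (rule transI)
    fix X Y Z assume XY: "(X, Y) \<in> MP_iso" and YZ: "(Y, Z) \<in> MP_iso"
    obtain \<psi> \<psi>' where \<psi>: "X \<in> MP" "Y \<in> MP" "\<psi> \<in> MP_hom X Y" "\<psi>' \<in> MP_hom Y X"
      "\<forall>t\<in>vecs (A \<Otimes> H). \<psi>' (\<psi> t) = t" "\<forall>t\<in>vecs (A \<Otimes> H). \<psi> (\<psi>' t) = t"
      using XY unfolding MP_iso_iff by blast
    obtain \<phi> \<phi>' where \<phi>: "Y \<in> MP" "Z \<in> MP" "\<phi> \<in> MP_hom Y Z" "\<phi>' \<in> MP_hom Z Y"
      "\<forall>t\<in>vecs (A \<Otimes> H). \<phi>' (\<phi> t) = t" "\<forall>t\<in>vecs (A \<Otimes> H). \<phi> (\<phi>' t) = t"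
      using YZ unfolding MP_iso_iff by blast
    have mem: "f t \<in> vecs (A \<Otimes> H)" if "f \<in> MP_hom U V" "U \<in> MP" "V \<in> MP" "t \<in> vecs (A \<Otimes> H)" for f U V t
      using lin_mem[OF lin_coalgebra_map[OF coalgebra_map_MP_hom[OF _ _ that(1)]]] that by (simp add: MP_def)
    define f g where "f = (\<lambda>t\<in>vecs (A \<Otimes> H). \<phi> (\<psi> t))" and "g = (\<lambda>t\<in>vecs (A \<Otimes> H). \<psi>' (\<phi>' t))"
    have "f \<in> MP_hom X Z" unfolding f_def by (rule MP_hom_compose[OF \<psi>(1,2) \<phi>(2) \<psi>(3) \<phi>(3)])
    moreover have "g \<in> MP_hom Z X" unfolding g_def by (rule MP_hom_compose[OF \<phi>(2) \<psi>(2,1) \<phi>(4) \<psi>(4)])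
    moreover have "\<forall>t\<in>vecs (A \<Otimes> H). g (f t) = t"
      using mem[OF \<psi>(3,1,2)] mem[OF \<phi>(3,1,2)] \<psi>(5) \<phi>(5) by (simp add: f_def g_def)
    moreover have "\<forall>t\<in>vecs (A \<Otimes> H). f (g t) = t"
      using mem[OF \<phi>(4,2,1)] mem[OF \<psi>(4,2,1)] \<psi>(6) \<phi>(6) by (simp add: f_def g_def)
    ultimately show "(X, Z) \<in> MP_iso"
      unfolding MP_iso_iff using \<psi>(1) \<phi>(2) by (intro conjI bexI[of _ f] bexI[of _ g])
  qed
qed

end

theorem theorem3p8:
  fixes A :: "('k::field, 'a::ab_group_add) bialg"
    and H :: "('k, 'h::ab_group_add) bialg"
  assumes "hopf_algebra A" and "hopf_algebra H"
  shows "equiv (hopf_pair.MP A H) (hopf_pair.cohomologous A H) \<and>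
    hopf_pair.H2_point A H \<in> hopf_pair.H2 A H \<and>
    (\<exists>\<Phi>. bij_betw \<Phi> (hopf_pair.skeleton_objects A H) (hopf_pair.H2 A H) \<and>
      (\<forall>X\<in>hopf_pair.MP A H.
        \<Phi> (hopf_pair.MP_iso A H `` {X}) = hopf_pair.cohomologous A H `` {X}))"
proof -
  interpret hopf_algebra_pair A H
    by unfold_locales (fact assms)+
  have "trivial_object \<in> MP" using matched_pair_trivial by (simp add: MP_def)
  then have "H2_point \<in> H2" by (simp add: H2_point_def H2_def quotientI)
  moreover have "bij_betw id skeleton_objects H2"
    by (simp add: skeleton_objects_def H2_def cohomologous_eq_MP_iso)
  ultimately show ?thesis
    using equiv_MP_iso by (auto simp: cohomologous_eq_MP_iso intro!: exI[of _ id])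
qed

end
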